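(* Let $d$ be a fixed positive integer and let $\epsilon<d/3$. If $n^{-d/3-\epsilon}\le p\le n^{-d/3}(\log n)^{8/3}$, then there exist a positive absolute constant $c_3$ and a positive constant $c_4=c_4(d)$, depending only on $d$, such that asymptotically almost surely $$c_3\, n^{d/3}(\log n)^{1/3}\ \le\ F([n]^d_p)\ \le\ c_4\, n^{d/3}(\log n)^{4/3}.$$
   Context: For positive integers $d,n$, $[n]^d$ denotes the set of all vectors $(a_1,\dots,a_d)$ where each $a_i$ is an integer with $0\le a_i\le n-1$. A subset $S\subseteq[n]^d$ is a Sidon set if all sums of two (not necessarily distinct) vectors of $S$ are distinct, i.e. whenever $a+b=c+e$ with $a,b,c,e\in S$ one has $\{a,b\}=\{c,e\}$. $[n]^d_p$ denotes the random subset of $[n]^d$ obtained by choosing each element independently with probability $p=p(n)$, and $F([n]^d_p)$ is the maximum size of a Sidon set contained in $[n]^d_p$. "Asymptotically almost surely" means with probability tending to $1$ as $n\to\infty$.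
   Formalization: The constant c_3 may depend on the fixed ε (but not on d, p or n); a c_3 independent of ε cannot exist, since for d=1, p=n^{-2/3+η} one has F ≤ Kη^{1/3}(n log n)^{1/3} a.a.s. with K absolute, and η may tend to 0. *)

theory Defs
  imports "HOL-Probability.Probability" "HOL-Library.Function_Algebras"
begin

text \<open>
  Since the dimension \<open>d\<close> is quantified inside the statement, a vector of length \<open>d\<close> is encoded as
  a function \<open>nat \<Rightarrow> int\<close> whose entries are its values on \<open>{..<d}\<close> and which is 0 elsewhere.
  Pointwise addition of such functions is then vector addition.
\<close>

definition vec_box :: "nat \<Rightarrow> nat \<Rightarrow> (nat \<Rightarrow> int) set" where
  "vec_box d n = PiE_dflt {..<d} 0 (\<lambda>_. {0..int n - 1})"

definition sidon :: "'a::ab_semigroup_add set \<Rightarrow> bool" where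
  "sidon S \<longleftrightarrow> (\<forall>a\<in>S. \<forall>b\<in>S. \<forall>c\<in>S. \<forall>e\<in>S. a + b = c + e \<longrightarrow> {a, b} = {c, e})"

text \<open>Meaningful for finite \<open>A\<close> only; the empty set is Sidon, so the maximum is then attained.\<close>

definition max_sidon :: "'a::ab_semigroup_add set \<Rightarrow> nat" where
  "max_sidon A = Max (card ` {S. S \<subseteq> A \<and> sidon S})"

text \<open>Each element of the finite set \<open>A\<close> is kept independently with probability \<open>p\<close>.\<close>

definition random_subset :: "'a set \<Rightarrow> real \<Rightarrow> 'a set pmf" where
  "random_subset A p =
     map_pmf (\<lambda>f. {x \<in> A. f x}) (Pi_pmf A False (\<lambda>_. bernoulli_pmf p))"

definition asym_almost_surely :: "(nat \<Rightarrow> 'a pmf) \<Rightarrow> (nat \<Rightarrow> 'a \<Rightarrow> bool) \<Rightarrow> bool" where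
  "asym_almost_surely M P \<longleftrightarrow>
     (\<lambda>n. measure_pmf.prob (M n) {x. P n x}) \<longlonglongrightarrow> 1"

end

theory Submission
  imports Defs "HOL-Real_Asymp.Real_Asymp"
begin

text \<open>
  Write \<open>N = n ^ d\<close> for the size of the box.

  Lower bound. The minimal non-Sidon sets form a hypergraph with edges of size 3 and 4. Give each
  independent set \<open>I\<close> the weight \<open>p ^ card I\<close> with \<open>p = N powr (-2/3 + \<delta>)\<close>. Such an \<open>I\<close> is a uniformly
  random independent subset of a tilted random set \<open>R\<close> that is so sparse that around a typical vertex
  \<open>v\<close> there are no short cycles. Then, as in Shearer's and Alon's arguments for triangle-free graphs,
  either \<open>v\<close> can be added to \<open>I\<close> with probability at least a small power of \<open>N\<close>, or \<open>I\<close> contains on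
  average at least a constant times \<open>ln N\<close> triples completing \<open>v\<close> to an edge. As \<open>I\<close> has at most
  \<open>card I ^ 3\<close> triples, each blocking boundedly many vertices, large \<open>I\<close> of size of order
  \<open>(N * ln N) powr (1/3)\<close> have at least polynomially small probability. Slightly raising the fugacity
  makes them overwhelmingly likely, and by Harris' inequality a random set is at least as likely to
  contain a large independent set as when conditioned on being independent.

  Upper bound. A Sidon set of size \<open>2 * s\<close> is a Sidon set \<open>S\<close> of size \<open>s\<close> together with an independent
  set in the graph joining \<open>x\<close> and \<open>y\<close> if \<open>x - y\<close> is a difference of elements of \<open>S\<close>. This graph is dense on
  large vertex sets, so the graph container method bounds the number of choices. Iterating over
  dyadic \<open>s\<close> and taking a union bound over all Sidon sets of a given size gives the claim.
\<close>

section \<open>Sums over subsets\<close>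

text \<open>In terms of N the hypothesis \<epsilon> < d/3 says that p exceeds N^(-2/3) by a power of
  N. One exponent \<delta> serves all admissible d, so c3 depends on \<epsilon> only. At the upper
  end of the range of p a vertex lies in far too many edges for a sparse argument, hence the detour
  through the fugacity N^(-2/3+\<delta>). There a vertex has about N^(3\<delta>) blocking triples,
  while short cycles through it have expected number about N^(8\<delta>-1/3), which tends to 0. The
  surplus N^\<delta> over N^(-2/3) pays for \<alpha> = N^(\<delta>/2), and ln \<alpha> is the source
  of the factor ln N. On the way back to p the ratio of the fugacities is at least N^\<delta> and
  enters with exponent m/2, where m is the target size; this outweighs every polynomial loss. In the
  upper bound two costs compete. The first s0 ~ (N ln N)^(1/3) elements are chosen freely, at cost
  s0 ln N in the exponent; the later doublings cost at most a multiple of sqrt(N p) in the end. For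
  the largest p allowed both are of order n^(d/3) (ln n)^(4/3), up to factors depending on
  d.\<close>

lemma sum_Pow_insert:
  fixes f :: "'a set \<Rightarrow> 'b::comm_monoid_add"
  assumes "finite V" "x \<notin> V"
  shows "(\<Sum>A\<in>Pow (insert x V). f A) = (\<Sum>A\<in>Pow V. f A) + (\<Sum>A\<in>Pow V. f (insert x A))"
proof -
  have inj: "inj_on (insert x) (Pow V)"
    using assms(2) by (intro inj_onI) (metis PowD insert_ident subsetD)
  have "(\<Sum>A\<in>Pow (insert x V). f A) = (\<Sum>A\<in>Pow V \<union> insert x ` Pow V. f A)"
    by (simp add: Pow_insert)
  also have "\<dots> = (\<Sum>A\<in>Pow V. f A) + (\<Sum>A\<in>insert x ` Pow V. f A)"
    using assms by (intro sum.union_disjoint) auto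
  finally show ?thesis
    by (simp add: sum.reindex[OF inj])
qed

lemma sum_prod_weight_Pow:
  fixes a b :: "'b::comm_semiring_1"
  assumes "finite V"
  shows "(\<Sum>A\<in>Pow V. a ^ card A * b ^ card (V - A)) = (a + b) ^ card V"
  using assms
proof (induction V rule: finite_induct)
  case (insert x V)
  have "(\<Sum>A\<in>Pow V. a ^ card A * b ^ card (insert x V - A))
      = b * (\<Sum>A\<in>Pow V. a ^ card A * b ^ card (V - A))"
    unfolding sum_distrib_left
  proof (intro sum.cong refl)
    fix A assume "A \<in> Pow V"
    then have "insert x V - A = insert x (V - A)" using insert.hyps by auto
    then show "a ^ card A * b ^ card (insert x V - A) = b * (a ^ card A * b ^ card (V - A))"
      using insert.hyps by (simp add: mult_ac)
  qed
  moreover have "(\<Sum>A\<in>Pow V. a ^ card (insert x A) * b ^ card (insert x V - insert x A))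
      = a * (\<Sum>A\<in>Pow V. a ^ card A * b ^ card (V - A))"
    unfolding sum_distrib_left
  proof (intro sum.cong refl)
    fix A assume A: "A \<in> Pow V"
    then have "insert x V - insert x A = V - A" "x \<notin> A" "finite A"
      using insert.hyps by (auto intro: finite_subset)
    then show "a ^ card (insert x A) * b ^ card (insert x V - insert x A)
        = a * (a ^ card A * b ^ card (V - A))"
      by (simp add: mult_ac)
  qed
  ultimately show ?case
    using insert by (simp add: sum_Pow_insert distrib_right add.commute)
qed simp

lemma sum_power_card_Pow:
  fixes a :: "'b::comm_semiring_1"
  assumes "finite V"
  shows "(\<Sum>A\<in>Pow V. a ^ card A) = (a + 1) ^ card V"
  using sum_prod_weight_Pow[OF assms, of a 1] by simp

lemma sum_bernoulli_weight_superset: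
  fixes p :: real
  assumes "finite V" "T \<subseteq> V"
  shows "(\<Sum>R\<in>{R. T \<subseteq> R \<and> R \<subseteq> V}. p ^ card R * (1 - p) ^ card (V - R)) = p ^ card T"
proof -
  have "(\<Sum>R\<in>{R. T \<subseteq> R \<and> R \<subseteq> V}. p ^ card R * (1 - p) ^ card (V - R))
      = (\<Sum>B\<in>Pow (V - T). p ^ card (T \<union> B) * (1 - p) ^ card (V - (T \<union> B)))"
  proof (rule sum.reindex_bij_witness[where i = "\<lambda>B. T \<union> B" and j = "\<lambda>R. R - T"])
  qed (use assms(2) in \<open>auto simp: Un_absorb1\<close>)
  also have "\<dots> = (\<Sum>B\<in>Pow (V - T). p ^ card T * (p ^ card B * (1 - p) ^ card (V - T - B)))"
  proof (intro sum.cong refl)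
    fix B assume B: "B \<in> Pow (V - T)"
    then have "card (T \<union> B) = card T + card B"
      using assms by (intro card_Un_disjoint) (auto intro: finite_subset)
    moreover have "V - (T \<union> B) = V - T - B" by auto
    ultimately show "p ^ card (T \<union> B) * (1 - p) ^ card (V - (T \<union> B))
        = p ^ card T * (p ^ card B * (1 - p) ^ card (V - T - B))"
      by (simp add: power_add)
  qed
  also have "\<dots> = p ^ card T"
    using sum_prod_weight_Pow[of "V - T" p "1 - p"] assms(1)
    by (simp add: sum_distrib_left [symmetric])
  finally show ?thesis .
qed

text \<open>Induction on the ground set, splitting each sum by whether the new element x is chosen.
  The weights \<open>l ^ card A\<close> are not normalised, so the total weight stands on the right.
  This serves uniform subsets (l = 1) as well as random sets given by their odds.\<close>

lemma harris_inequality: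
  fixes f g :: "'a set \<Rightarrow> real"
  assumes "finite V" "0 \<le> l"
    and "\<And>A B. A \<subseteq> B \<Longrightarrow> B \<subseteq> V \<Longrightarrow> f B \<le> f A"
    and "\<And>A B. A \<subseteq> B \<Longrightarrow> B \<subseteq> V \<Longrightarrow> g B \<le> g A"
  shows "(\<Sum>A\<in>Pow V. l ^ card A * f A) * (\<Sum>A\<in>Pow V. l ^ card A * g A)
       \<le> (\<Sum>A\<in>Pow V. l ^ card A * (f A * g A)) * (\<Sum>A\<in>Pow V. l ^ card A)"
  using assms
proof (induction V arbitrary: f g rule: finite_induct)
  case (insert x V)
  define S where "S = (\<lambda>h :: 'a set \<Rightarrow> real. \<Sum>A\<in>Pow V. l ^ card A * h A)"
  have split: "(\<Sum>A\<in>Pow (insert x V). l ^ card A * h A) = S h + l * S (\<lambda>A. h (insert x A))" for h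
  proof -
    have "(\<Sum>A\<in>Pow V. l ^ card (insert x A) * h (insert x A)) = l * S (\<lambda>A. h (insert x A))"
      unfolding S_def sum_distrib_left
    proof (intro sum.cong refl)
      fix A assume "A \<in> Pow V"
      then have "x \<notin> A" "finite A" using insert.hyps by (auto intro: finite_subset)
      then show "l ^ card (insert x A) * h (insert x A) = l * (l ^ card A * h (insert x A))"
        by simp
    qed
    then show ?thesis using insert.hyps by (simp add: sum_Pow_insert S_def)
  qed
  define f1 g1 where "f1 = (\<lambda>A. f (insert x A))" and "g1 = (\<lambda>A. g (insert x A))"
  have IH0: "S f * S g \<le> S (\<lambda>A. f A * g A) * S (\<lambda>_. 1)"
    unfolding S_def mult_1_right
    by (rule insert.IH[OF insert.prems(1)]; rule insert.prems; auto)
  have IH1: "S f1 * S g1 \<le> S (\<lambda>A. f1 A * g1 A) * S (\<lambda>_. 1)"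
    unfolding S_def mult_1_right f1_def g1_def
    by (rule insert.IH[OF insert.prems(1)]; rule insert.prems; auto)
  have "f (insert x A) \<le> f A" "g (insert x A) \<le> g A" if "A \<subseteq> V" for A
    using that by (intro insert.prems(2,3); auto)+
  then have "S f1 \<le> S f" "S g1 \<le> S g"
    unfolding S_def f1_def g1_def using insert.prems(1)
    by (auto intro!: sum_mono mult_left_mono)
  \<comment> \<open>This product is exactly what the mixed terms S f * S g1 and S f1 * S g lack to
    be bounded by the two diagonal ones.\<close>
  then have "0 \<le> l * ((S f - S f1) * (S g - S g1))"
    using insert.prems(1) by simp
  moreover have "(1 + l) * (S f * S g + l * (S f1 * S g1))
      \<le> (1 + l) * (S (\<lambda>A. f A * g A) * S (\<lambda>_. 1) + l * (S (\<lambda>A. f1 A * g1 A) * S (\<lambda>_. 1)))"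
    using insert.prems(1) IH0 IH1 by (intro mult_left_mono add_mono) auto
  ultimately have prod: "(S f + l * S f1) * (S g + l * S g1)
      \<le> (S (\<lambda>A. f A * g A) + l * S (\<lambda>A. f1 A * g1 A)) * (S (\<lambda>_. 1) + l * S (\<lambda>_. 1))"
    by (simp add: algebra_simps)
  have "(\<Sum>A\<in>Pow (insert x V). l ^ card A) = S (\<lambda>_. 1) + l * S (\<lambda>_. 1)"
    using split[of "\<lambda>_. 1"] by simp
  then show ?case
    using prod unfolding split f1_def g1_def by simp
qed simp

section \<open>Random subsets\<close>

lemma pmf_random_subset:
  assumes "finite V" "0 \<le> p" "p \<le> 1" "A \<subseteq> V"
  shows "pmf (random_subset V p) A = p ^ card A * (1 - p) ^ card (V - A)"
proof -
  let ?M = "Pi_pmf V False (\<lambda>_. bernoulli_pmf p)"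
  let ?f = "\<lambda>x. x \<in> A"
  \<comment> \<open>Outside V a sampled function takes the default value False. The random set thus
    determines the function, and the preimage of A is almost surely a single function.\<close>
  have supp: "set_pmf ?M \<subseteq> {f. \<forall>x. x \<notin> V \<longrightarrow> f x = False}"
    using set_Pi_pmf_subset[OF assms(1), of False "\<lambda>_. bernoulli_pmf p"] by auto
  have "pmf (random_subset V p) A = measure_pmf.prob ?M ((\<lambda>f. {x \<in> V. f x}) -` {A})"
    by (simp add: random_subset_def pmf_map)
  also have "\<dots> = measure_pmf.prob ?M {?f}"
  proof (rule measure_pmf.finite_measure_eq_AE)
    show "AE f in ?M. (f \<in> (\<lambda>f. {x \<in> V. f x}) -` {A}) = (f \<in> {?f})"
      unfolding AE_measure_pmf_iff
    proof
      fix f assume "f \<in> set_pmf ?M"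
      then have "\<And>x. f x \<Longrightarrow> x \<in> V" using supp by blast
      then show "(f \<in> (\<lambda>f. {x \<in> V. f x}) -` {A}) = (f \<in> {?f})"
        using assms(4) by (auto simp: fun_eq_iff)
    qed
  qed auto
  also have "\<dots> = (\<Prod>x\<in>V. pmf (bernoulli_pmf p) (x \<in> A))"
    using assms(1,4) by (simp add: measure_pmf_single pmf_Pi subset_eq)
      (auto intro: prod.cong)
  also have "\<dots> = (\<Prod>x\<in>A. p) * (\<Prod>x\<in>V - A. 1 - p)"
  proof -
    have V: "V = A \<union> (V - A)" using assms(4) by auto
    have "(\<Prod>x\<in>V. pmf (bernoulli_pmf p) (x \<in> A))
        = (\<Prod>x\<in>A. pmf (bernoulli_pmf p) (x \<in> A)) * (\<Prod>x\<in>V - A. pmf (bernoulli_pmf p) (x \<in> A))"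
      by (subst V, rule prod.union_disjoint) (use assms in \<open>auto intro: finite_subset\<close>)
    also have "(\<Prod>x\<in>A. pmf (bernoulli_pmf p) (x \<in> A)) = (\<Prod>x\<in>A. p)"
      using assms by (intro prod.cong) auto
    also have "(\<Prod>x\<in>V - A. pmf (bernoulli_pmf p) (x \<in> A)) = (\<Prod>x\<in>V - A. 1 - p)"
      using assms by (intro prod.cong) auto
    finally show ?thesis .
  qed
  finally show ?thesis by simp
qed

lemma set_pmf_random_subset:
  assumes "finite V"
  shows "set_pmf (random_subset V p) \<subseteq> Pow V"
  by (auto simp: random_subset_def)

lemma prob_random_subset:
  assumes "finite V" "0 \<le> p" "p \<le> 1"
  shows "measure_pmf.prob (random_subset V p) {A. P A}
    = (\<Sum>A\<in>{A. A \<subseteq> V \<and> P A}. p ^ card A * (1 - p) ^ card (V - A))"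
proof -
  have "measure_pmf.prob (random_subset V p) {A. P A}
      = measure_pmf.prob (random_subset V p) {A. A \<subseteq> V \<and> P A}"
    using set_pmf_random_subset[OF assms(1), of p]
    by (intro measure_pmf.finite_measure_eq_AE) (auto simp: AE_measure_pmf_iff)
  also have "\<dots> = (\<Sum>A\<in>{A. A \<subseteq> V \<and> P A}. pmf (random_subset V p) A)"
    using assms(1) by (intro measure_measure_pmf_finite) auto
  also have "\<dots> = (\<Sum>A\<in>{A. A \<subseteq> V \<and> P A}. p ^ card A * (1 - p) ^ card (V - A))"
    using assms by (intro sum.cong refl pmf_random_subset) auto
  finally show ?thesis .
qed

lemma prob_random_subset_superset:
  assumes "finite V" "0 \<le> p" "p \<le> 1" "T \<subseteq> V"
  shows "measure_pmf.prob (random_subset V p) {A. T \<subseteq> A} = p ^ card T"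
proof -
  have "{A. A \<subseteq> V \<and> T \<subseteq> A} = {R. T \<subseteq> R \<and> R \<subseteq> V}" by auto
  then show ?thesis
    using assms by (simp add: prob_random_subset sum_bernoulli_weight_superset)
qed

section \<open>Independent sets in sparse hypergraphs\<close>

lemma card_supersets:
  assumes "finite Y" "t \<subseteq> Y"
  shows "real (card {A. t \<subseteq> A \<and> A \<subseteq> Y}) = 2 ^ card Y / 2 ^ card t"
proof -
  have "(\<Sum>R\<in>{R. t \<subseteq> R \<and> R \<subseteq> Y}. (1/2) ^ card R * (1 - 1/2) ^ card (Y - R))
      = (\<Sum>R\<in>{R. t \<subseteq> R \<and> R \<subseteq> Y}. (1/2::real) ^ card Y)"
  proof (intro sum.cong refl)
    fix R assume "R \<in> {R. t \<subseteq> R \<and> R \<subseteq> Y}"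
    then have "R \<subseteq> Y" by simp
    then have "card R + card (Y - R) = card Y"
      using assms(1) by (metis card_Diff_subset card_mono finite_subset le_add_diff_inverse)
    then show "(1/2) ^ card R * (1 - 1/2) ^ card (Y - R) = (1/2::real) ^ card Y"
      by (simp flip: power_add)
  qed
  then have "real (card {A. t \<subseteq> A \<and> A \<subseteq> Y}) * (1/2) ^ card Y = (1/2) ^ card t"
    using sum_bernoulli_weight_superset[OF assms, of "1/2"] by simp
  then show ?thesis by (simp add: field_simps power_divide)
qed

text \<open>A uniform subset of Y avoids one triple with probability 7/8. Avoidance is a decreasing
  event, so by Harris the events are positively correlated however the triples overlap.\<close>

lemma card_avoiding_subsets_ge:
  assumes "finite Y" "finite L" "\<And>t. t \<in> L \<Longrightarrow> t \<subseteq> Y \<and> card t = 3"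
  shows "2 ^ card Y * (7/8) ^ card L \<le> (\<Sum>A\<in>Pow Y. of_bool (\<forall>t\<in>L. \<not> t \<subseteq> A) :: real)"
  using assms(2,3)
proof (induction L rule: finite_induct)
  case empty
  then show ?case using assms(1) by (simp add: card_Pow)
next
  case (insert t L)
  have t: "t \<subseteq> Y" "card t = 3" using insert.prems by auto
  have "(\<Sum>A\<in>Pow Y. of_bool (\<not> t \<subseteq> A) :: real)
      = (\<Sum>A\<in>Pow Y. 1) - (\<Sum>A\<in>Pow Y. of_bool (t \<subseteq> A))"
    by (simp add: of_bool_not_iff sum_subtractf)
  also have "(\<Sum>A\<in>Pow Y. of_bool (t \<subseteq> A) :: real) = real (card {A. t \<subseteq> A \<and> A \<subseteq> Y})"
    using assms(1) by (simp add: sum_of_bool_eq Int_def conj_commute)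
  finally have t_sum: "(\<Sum>A\<in>Pow Y. of_bool (\<not> t \<subseteq> A) :: real) = 2 ^ card Y * (7/8)"
    using assms(1) t by (simp add: card_supersets card_Pow)
  have "2 ^ card Y * (7/8) ^ card (insert t L) * 2 ^ card Y
      = (2 ^ card Y * (7/8) ^ card L) * (2 ^ card Y * (7/8 :: real))"
    using insert.hyps by simp
  also have "\<dots> \<le> (\<Sum>A\<in>Pow Y. of_bool (\<forall>t\<in>L. \<not> t \<subseteq> A)) * (\<Sum>A\<in>Pow Y. of_bool (\<not> t \<subseteq> A))"
    unfolding t_sum using insert by (intro mult_right_mono) auto
  also have "\<dots> \<le> (\<Sum>A\<in>Pow Y. of_bool (\<forall>t\<in>L. \<not> t \<subseteq> A) * of_bool (\<not> t \<subseteq> A)) * (\<Sum>A\<in>Pow Y. 1)"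
    using harris_inequality[OF assms(1), of 1 "\<lambda>A. of_bool (\<forall>t\<in>L. \<not> t \<subseteq> A)"
        "\<lambda>A. of_bool (\<not> t \<subseteq> A)"]
    by (simp only: power_one mult_1) (use order_trans in fastforce)
  also have "(\<Sum>A\<in>Pow Y. of_bool (\<forall>t\<in>L. \<not> t \<subseteq> A) * of_bool (\<not> t \<subseteq> A))
      = (\<Sum>A\<in>Pow Y. of_bool (\<forall>t\<in>insert t L. \<not> t \<subseteq> A) :: real)"
    by (intro sum.cong) auto
  finally have "2 ^ card Y * (7/8) ^ card (insert t L) * 2 ^ card Y
      \<le> (\<Sum>A\<in>Pow Y. of_bool (\<forall>t\<in>insert t L. \<not> t \<subseteq> A)) * (2 ^ card Y :: real)"
    using assms(1) by (simp only: sum_constant card_Pow of_nat_power of_nat_numeral mult_1_right)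
  then show ?case
    by (rule mult_right_le_imp_le) simp
qed

text \<open>The crossover is at k = 2 ln \<alpha>. Above it the linear term suffices; below it
  exp(-1/4) \<le> 7/8 leaves at least sqrt \<alpha> in the exponential term, which exceeds ln
  \<alpha> / 2.\<close>

lemma exponential_tradeoff:
  fixes \<alpha> :: real
  assumes "\<alpha> \<ge> 1"
  shows "ln \<alpha> / 4 \<le> \<alpha> * (7/8) ^ k + real k / 8"
proof (cases "real k \<ge> 2 * ln \<alpha>")
  case True
  moreover have "0 \<le> \<alpha> * (7/8) ^ k" using assms by simp
  ultimately show ?thesis by simp
next
  case False
  have "exp (1/4 :: real) \<ge> 5/4" using exp_ge_add_one_self[of "1/4"] by simp
  then have "exp (- 1/4 :: real) \<le> 7/8"
    by (simp add: exp_minus field_simps)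
  then have "exp (- 1/4) ^ k \<le> (7/8 :: real) ^ k" by (intro power_mono) auto
  then have *: "exp (- real k / 4) \<le> (7/8) ^ k"
    by (simp flip: exp_of_nat_mult)
  have "ln \<alpha> / 4 \<le> 1 + ln \<alpha> / 2" using assms by simp
  also have "\<dots> \<le> exp (ln \<alpha> / 2)" by (rule exp_ge_add_one_self)
  also have "\<dots> \<le> exp (ln \<alpha> - real k / 4)" using False by simp
  also have "\<dots> = \<alpha> * exp (- real k / 4)"
    using assms exp_add[of "ln \<alpha>" "- real k / 4"] by simp
  also have "\<dots> \<le> \<alpha> * (7/8) ^ k" using * assms by (intro mult_left_mono) auto
  finally show ?thesis by simp
qed

text \<open>For a uniform A the set L is avoided with probability at least (7/8)^|L|, and A contains
  |L|/8 triples on average. The resulting bound is free of |L|, so it can later be averaged over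
  varying L.\<close>

lemma cube_tradeoff:
  fixes \<alpha> :: real
  assumes "finite Y" "finite L" "\<And>t. t \<in> L \<Longrightarrow> t \<subseteq> Y \<and> card t = 3" "\<alpha> \<ge> 1"
  shows "ln \<alpha> / 4 * 2 ^ card Y
    \<le> (\<Sum>A\<in>Pow Y. \<alpha> * of_bool (\<forall>t\<in>L. \<not> t \<subseteq> A) + real (card {t\<in>L. t \<subseteq> A}))"
proof -
  have "(\<Sum>A\<in>Pow Y. real (card {t\<in>L. t \<subseteq> A})) = (\<Sum>A\<in>Pow Y. \<Sum>t\<in>L. of_bool (t \<subseteq> A))"
    using assms(2) by (intro sum.cong) (auto simp: sum_of_bool_eq Int_def)
  also have "\<dots> = (\<Sum>t\<in>L. \<Sum>A\<in>Pow Y. of_bool (t \<subseteq> A))"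
    by (rule sum.swap)
  also have "\<dots> = (\<Sum>t\<in>L. real (card {A. t \<subseteq> A \<and> A \<subseteq> Y}))"
    using assms(1) by (intro sum.cong) (auto simp: sum_of_bool_eq Int_def conj_commute)
  also have "\<dots> = 2 ^ card Y * (real (card L) / 8)"
    using assms by (simp add: card_supersets)
  finally have X: "(\<Sum>A\<in>Pow Y. real (card {t\<in>L. t \<subseteq> A})) = 2 ^ card Y * (real (card L) / 8)" .
  have "ln \<alpha> / 4 * 2 ^ card Y \<le> (\<alpha> * (7/8) ^ card L + real (card L) / 8) * 2 ^ card Y"
    using exponential_tradeoff[OF assms(4)] by (intro mult_right_mono) auto
  also have "\<dots> = \<alpha> * (2 ^ card Y * (7/8) ^ card L) + 2 ^ card Y * (real (card L) / 8)"
    by (simp add: algebra_simps)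
  also have "\<dots> \<le> \<alpha> * (\<Sum>A\<in>Pow Y. of_bool (\<forall>t\<in>L. \<not> t \<subseteq> A)) + 2 ^ card Y * (real (card L) / 8)"
    using card_avoiding_subsets_ge[of Y L] assms by (intro add_mono mult_left_mono) auto
  finally show ?thesis
    by (simp only: X sum.distrib sum_distrib_left)
qed

text \<open>The bound K on completions of pairs and triples limits a vertex to O(N) edges of size 3
  and O(N^2) of size 4, and controls the edges that meet a given set twice. Since edges form an
  antichain, two distinct edges sharing two vertices always form a genuine cycle.\<close>

locale sparse_hypergraph =
  fixes V :: "'a set" and E :: "'a set set" and K :: nat
  assumes finite_V: "finite V"
    and edge_subset: "e \<in> E \<Longrightarrow> e \<subseteq> V"
    and edge_card: "e \<in> E \<Longrightarrow> card e = 3 \<or> card e = 4"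
    and edge_antichain: "e \<in> E \<Longrightarrow> f \<in> E \<Longrightarrow> e \<subseteq> f \<Longrightarrow> e = f"
    and card_extensions:
      "g \<subseteq> V \<Longrightarrow> card g = 2 \<or> card g = 3 \<Longrightarrow> card {x \<in> V - g. insert x g \<in> E} \<le> K"
begin

section \<open>Independent sets and the vertices they block\<close>

definition indep :: "'a set \<Rightarrow> bool" where
  "indep I \<longleftrightarrow> (\<forall>e\<in>E. \<not> e \<subseteq> I)"

definition ind_sets :: "'a set \<Rightarrow> 'a set set" where
  "ind_sets R = {I. I \<subseteq> R \<and> indep I}"

definition blockers :: "'a \<Rightarrow> 'a set \<Rightarrow> 'a set set" where
  "blockers v I = {t. t \<subseteq> I \<and> card t = 3 \<and> v \<notin> t \<and> insert v t \<in> E}"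

lemma finite_E: "finite E"
proof (rule finite_subset)
  show "E \<subseteq> Pow V" using edge_subset by auto
  show "finite (Pow V)" using finite_V by simp
qed

lemma finite_ind_sets: "R \<subseteq> V \<Longrightarrow> finite (ind_sets R)"
  unfolding ind_sets_def
  by (rule finite_subset[of _ "Pow V"]) (auto simp: finite_V)

lemma finite_blockers: "I \<subseteq> V \<Longrightarrow> finite (blockers v I)"
  unfolding blockers_def
  by (rule finite_subset[of _ "Pow V"]) (auto simp: finite_V)

lemma indep_mono: "indep I \<Longrightarrow> J \<subseteq> I \<Longrightarrow> indep J"
  by (simp add: indep_def) (meson order_trans)

text \<open>If no edge inside \<open>R\<close> meets the union \<open>Y\<close> of the blockers of \<open>v\<close> twice, then the
  independent subsets of \<open>R\<close> with a given trace outside \<open>Y\<close> form a cube.\<close>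

lemma sum_ind_sets_cubes:
  fixes h :: "'a set \<Rightarrow> real"
  assumes R: "R \<subseteq> V" and Y: "Y \<subseteq> R"
    and sparse: "\<And>f. f \<in> E \<Longrightarrow> f \<subseteq> R \<Longrightarrow> card (f \<inter> Y) \<le> 1"
  shows "(\<Sum>I\<in>ind_sets R. h I)
    = (\<Sum>W\<in>ind_sets (R - Y). \<Sum>A\<in>Pow {y\<in>Y. indep (insert y W)}. h (W \<union> A))"
proof -
  have fin: "finite R" "finite Y"
    using finite_subset[OF R finite_V] finite_subset[OF subset_trans[OF Y R] finite_V] by simp_all
  \<comment> \<open>An edge inside W \<union> A has at most one vertex y in Y, so it lies in
    \<open>insert y W\<close>. Hence each y can be tested against W alone, and tested elements may
    be combined freely.\<close>
  have cube: "indep (W \<union> A) \<longleftrightarrow> A \<subseteq> {y\<in>Y. indep (insert y W)}"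
    if W: "W \<in> ind_sets (R - Y)" and A: "A \<subseteq> Y" for W A
  proof
    assume "indep (W \<union> A)"
    then show "A \<subseteq> {y\<in>Y. indep (insert y W)}"
      using A indep_mono[of "W \<union> A"] by auto
  next
    assume A': "A \<subseteq> {y\<in>Y. indep (insert y W)}"
    show "indep (W \<union> A)"
      unfolding indep_def
    proof (intro ballI notI)
      fix f assume f: "f \<in> E" "f \<subseteq> W \<union> A"
      have "f \<subseteq> R" using f W A Y by (auto simp: ind_sets_def)
      then have "card (f \<inter> Y) \<le> 1" using sparse f by blast
      then have "card (f \<inter> A) \<le> 1"
        using A fin by (meson Int_mono card_mono finite_Int order_refl order_trans)
      then consider "f \<inter> A = {}" | y where "f \<inter> A = {y}"
        using fin A finite_subset[OF A]
        by (metis card_0_eq card_1_singletonE finite_Int le_eq_less_or_eq less_one)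
      then show False
      proof cases
        case 1
        then have "f \<subseteq> W" using f by auto
        then show False using W f by (auto simp: ind_sets_def indep_def)
      next
        case 2
        then have "f \<subseteq> insert y W" "y \<in> A" using f by auto
        then show False using A' f by (auto simp: indep_def)
      qed
    qed
  qed
  have "(\<Sum>W\<in>ind_sets (R - Y). \<Sum>A\<in>Pow {y\<in>Y. indep (insert y W)}. h (W \<union> A))
      = (\<Sum>(W, A)\<in>(SIGMA W:ind_sets (R - Y). Pow {y\<in>Y. indep (insert y W)}). h (W \<union> A))"
    using fin R by (intro sum.Sigma finite_ind_sets ballI) auto
  also have "\<dots> = (\<Sum>I\<in>ind_sets R. h I)"
  proof (rule sum.reindex_bij_witness[where i = "\<lambda>I. (I - Y, I \<inter> Y)" and j = "\<lambda>(W, A). W \<union> A"])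
    fix WA assume WA: "WA \<in> (SIGMA W:ind_sets (R - Y). Pow {y\<in>Y. indep (insert y W)})"
    obtain W A where eq: "WA = (W, A)" by force
    have W: "W \<in> ind_sets (R - Y)" and A: "A \<subseteq> {y\<in>Y. indep (insert y W)}"
      using WA eq by auto
    have "indep (W \<union> A)" using cube[OF W] A by blast
    moreover have "W \<union> A \<subseteq> R" using W A Y by (auto simp: ind_sets_def)
    ultimately show "(case WA of (W, A) \<Rightarrow> W \<union> A) \<in> ind_sets R"
      by (simp add: eq ind_sets_def)
    show "((case WA of (W, A) \<Rightarrow> W \<union> A) - Y, (case WA of (W, A) \<Rightarrow> W \<union> A) \<inter> Y) = WA"
      using W A by (auto simp: eq ind_sets_def)
    show "h (case WA of (W, A) \<Rightarrow> W \<union> A) = (case WA of (W, A) \<Rightarrow> h (W \<union> A))"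
      by (simp add: eq)
  next
    fix I assume I: "I \<in> ind_sets R"
    then have W: "I - Y \<in> ind_sets (R - Y)"
      using indep_mono[of I "I - Y"] by (auto simp: ind_sets_def)
    have "indep ((I - Y) \<union> (I \<inter> Y))"
      using I by (simp add: ind_sets_def Un_Diff_Int)
    then have "I \<inter> Y \<subseteq> {y\<in>Y. indep (insert y (I - Y))}"
      using cube[OF W, of "I \<inter> Y"] by blast
    then show "(I - Y, I \<inter> Y) \<in> (SIGMA W:ind_sets (R - Y). Pow {y\<in>Y. indep (insert y W)})"
      using W by auto
    show "(case (I - Y, I \<inter> Y) of (W, A) \<Rightarrow> W \<union> A) = I" by auto
  qed
  finally show ?thesis by simp
qed

text \<open>Given the trace W outside the blocking vertices, I is uniform on a cube, so
  \<open>cube_tradeoff\<close> applies for each W. As R contains no edge of size 3 through v without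
  v, blocking triples are the only obstruction to adding v to I.\<close>

lemma local_tradeoff:
  fixes \<alpha> :: real
  assumes R: "R \<subseteq> V" and v: "v \<notin> R" and \<alpha>: "\<alpha> \<ge> 1"
    and triples: "\<And>f. f \<in> E \<Longrightarrow> card f = 3 \<Longrightarrow> v \<in> f \<Longrightarrow> \<not> f - {v} \<subseteq> R"
    and sparse: "\<And>f. f \<in> E \<Longrightarrow> f \<subseteq> R \<Longrightarrow> card (f \<inter> \<Union>(blockers v R)) \<le> 1"
  shows "ln \<alpha> / 4 * card (ind_sets R)
    \<le> (\<Sum>I\<in>ind_sets R. \<alpha> * of_bool (indep (insert v I)) + real (card (blockers v I)))"
proof -
  define Y where "Y = \<Union>(blockers v R)"
  have Y: "Y \<subseteq> R" by (auto simp: Y_def blockers_def)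
  have fin: "finite R" "finite Y"
    using finite_subset[OF R finite_V] finite_subset[OF subset_trans[OF Y R] finite_V] by simp_all
  \<comment> \<open>A triple with a vertex that W excludes is never completed in the cube of W, so
    only the triples kept here matter.\<close>
  define L where "L = (\<lambda>W. {t \<in> blockers v R. t \<subseteq> {y\<in>Y. indep (insert y W)}})"
  have cubes: "(\<Sum>I\<in>ind_sets R. h I)
      = (\<Sum>W\<in>ind_sets (R - Y). \<Sum>A\<in>Pow {y\<in>Y. indep (insert y W)}. h (W \<union> A))" for h :: "_ \<Rightarrow> real"
    using sum_ind_sets_cubes[OF R Y] sparse by (simp add: Y_def)
  have free: "indep (insert v I) \<longleftrightarrow> blockers v I = {}" if I: "I \<in> ind_sets R" for I
  proof
    assume "indep (insert v I)"
    then show "blockers v I = {}"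
      by (auto simp: indep_def blockers_def insert_mono)
  next
    assume *: "blockers v I = {}"
    show "indep (insert v I)"
      unfolding indep_def
    proof (intro ballI notI)
      fix f assume f: "f \<in> E" "f \<subseteq> insert v I"
      then have "v \<in> f" using I by (auto simp: ind_sets_def indep_def)
      have sub: "f - {v} \<subseteq> I" using f by auto
      have "card f \<noteq> 3" using triples[OF f(1)] \<open>v \<in> f\<close> sub I by (auto simp: ind_sets_def)
      then have "card f = 4" using edge_card f by blast
      then have "card (f - {v}) = 3"
        using \<open>v \<in> f\<close> by (simp add: card_Diff_singleton)
      then have "f - {v} \<in> blockers v I"
        using sub f \<open>v \<in> f\<close> by (simp add: blockers_def insert_absorb)
      then show False using * by simp
    qed
  qed
  have "ln \<alpha> / 4 * card (ind_sets R) = (\<Sum>I\<in>ind_sets R. ln \<alpha> / 4)" by simp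
  also have "\<dots> = (\<Sum>W\<in>ind_sets (R - Y). ln \<alpha> / 4 * 2 ^ card {y\<in>Y. indep (insert y W)})"
    unfolding cubes using fin by (simp add: card_Pow mult.commute)
  also have "\<dots> \<le> (\<Sum>W\<in>ind_sets (R - Y). \<Sum>A\<in>Pow {y\<in>Y. indep (insert y W)}.
      \<alpha> * of_bool (\<forall>t\<in>L W. \<not> t \<subseteq> A) + real (card {t\<in>L W. t \<subseteq> A}))"
    using fin \<alpha> finite_blockers[OF R]
    by (intro sum_mono cube_tradeoff) (auto simp: L_def blockers_def)
  also have "\<dots> = (\<Sum>W\<in>ind_sets (R - Y). \<Sum>A\<in>Pow {y\<in>Y. indep (insert y W)}.
      \<alpha> * of_bool (blockers v (W \<union> A) = {}) + real (card (blockers v (W \<union> A))))"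
  proof (intro sum.cong refl)
    fix W A assume W: "W \<in> ind_sets (R - Y)" and A: "A \<in> Pow {y\<in>Y. indep (insert y W)}"
    have WA: "W \<union> A \<subseteq> R" "W \<inter> Y = {}" using W A Y by (auto simp: ind_sets_def)
    have "{t\<in>L W. t \<subseteq> A} = blockers v (W \<union> A)"
    proof (intro equalityI subsetI)
      fix t assume "t \<in> {t\<in>L W. t \<subseteq> A}"
      then show "t \<in> blockers v (W \<union> A)" by (auto simp: L_def blockers_def)
    next
      fix t assume t: "t \<in> blockers v (W \<union> A)"
      then have tR: "t \<in> blockers v R" using WA by (auto simp: blockers_def)
      then have "t \<subseteq> Y" by (auto simp: Y_def)
      then have "t \<subseteq> A" using t WA by (auto simp: blockers_def)
      then show "t \<in> {t\<in>L W. t \<subseteq> A}" using tR A by (simp add: L_def)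
    qed
    then show "\<alpha> * of_bool (\<forall>t\<in>L W. \<not> t \<subseteq> A) + real (card {t\<in>L W. t \<subseteq> A})
        = \<alpha> * of_bool (blockers v (W \<union> A) = {}) + real (card (blockers v (W \<union> A)))"
      by auto
  qed
  also have "\<dots> = (\<Sum>I\<in>ind_sets R. \<alpha> * of_bool (blockers v I = {}) + real (card (blockers v I)))"
    by (simp only: cubes)
  also have "\<dots> = (\<Sum>I\<in>ind_sets R. \<alpha> * of_bool (indep (insert v I)) + real (card (blockers v I)))"
    by (intro sum.cong) (auto simp: free)
  finally show ?thesis .
qed

section \<open>The hard-core model on independent sets, with fugacity p\<close>

definition partition_fun :: "real \<Rightarrow> real" where
  "partition_fun p = (\<Sum>I\<in>ind_sets V. p ^ card I)"

text \<open>The law of a p-random set reweighted by its number of independent subsets. It is left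
  unnormalised: the event that always holds has weight \<open>partition_fun p\<close>.\<close>

definition tilted :: "real \<Rightarrow> ('a set \<Rightarrow> bool) \<Rightarrow> real" where
  "tilted p X = (\<Sum>R\<in>{R\<in>Pow V. X R}. p ^ card R * (1 - p) ^ card (V - R) * real (card (ind_sets R)))"

lemma ind_sets_subset: "I \<in> ind_sets R \<Longrightarrow> I \<subseteq> R"
  by (simp add: ind_sets_def)

text \<open>A set \<open>I\<close> weighted by \<open>p ^ card I\<close> is the marginal of a pair \<open>(R, I)\<close>, where \<open>R\<close>
  is a \<open>p\<close>-random set and \<open>I\<close> ranges uniformly over the independent subsets of \<open>R\<close>.\<close>

lemma sum_joint_weight:
  fixes h :: "'a set \<Rightarrow> real"
  shows "(\<Sum>R\<in>Pow V. p ^ card R * (1 - p) ^ card (V - R) * (\<Sum>I\<in>ind_sets R. of_bool (T \<subseteq> R) * h I))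
    = (\<Sum>I\<in>ind_sets V. h I * (\<Sum>R\<in>{R. T \<union> I \<subseteq> R \<and> R \<subseteq> V}. p ^ card R * (1 - p) ^ card (V - R)))"
proof -
  let ?w = "\<lambda>R. p ^ card R * (1 - p) ^ card (V - R)"
  have "(\<Sum>R\<in>Pow V. ?w R * (\<Sum>I\<in>ind_sets R. of_bool (T \<subseteq> R) * h I))
      = (\<Sum>R\<in>Pow V. \<Sum>I\<in>ind_sets V. of_bool (T \<union> I \<subseteq> R) * (h I * ?w R))"
  proof (intro sum.cong refl)
    fix R assume R: "R \<in> Pow V"
    have "(\<Sum>I\<in>ind_sets V. of_bool (T \<union> I \<subseteq> R) * (h I * ?w R))
        = (\<Sum>I\<in>ind_sets R. of_bool (T \<union> I \<subseteq> R) * (h I * ?w R))"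
      using R by (intro sum.mono_neutral_right finite_ind_sets) (auto simp: ind_sets_def)
    also have "\<dots> = (\<Sum>I\<in>ind_sets R. ?w R * (of_bool (T \<subseteq> R) * h I))"
      by (intro sum.cong) (auto simp: ind_sets_def)
    finally show "?w R * (\<Sum>I\<in>ind_sets R. of_bool (T \<subseteq> R) * h I)
        = (\<Sum>I\<in>ind_sets V. of_bool (T \<union> I \<subseteq> R) * (h I * ?w R))"
      by (simp add: sum_distrib_left)
  qed
  also have "\<dots> = (\<Sum>I\<in>ind_sets V. \<Sum>R\<in>Pow V. of_bool (T \<union> I \<subseteq> R) * (h I * ?w R))"
    by (rule sum.swap)
  also have "\<dots> = (\<Sum>I\<in>ind_sets V. h I * (\<Sum>R\<in>{R. T \<union> I \<subseteq> R \<and> R \<subseteq> V}. ?w R))"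
  proof (intro sum.cong refl)
    fix I
    have "(\<Sum>R\<in>Pow V. of_bool (T \<union> I \<subseteq> R) * (h I * ?w R))
        = (\<Sum>R\<in>{R. T \<union> I \<subseteq> R \<and> R \<subseteq> V}. of_bool (T \<union> I \<subseteq> R) * (h I * ?w R))"
      using finite_V by (intro sum.mono_neutral_right) auto
    then show "(\<Sum>R\<in>Pow V. of_bool (T \<union> I \<subseteq> R) * (h I * ?w R))
        = h I * (\<Sum>R\<in>{R. T \<union> I \<subseteq> R \<and> R \<subseteq> V}. ?w R)"
      by (simp add: sum_distrib_left)
  qed
  finally show ?thesis .
qed

lemma sum_joint_weight_marginal:
  fixes h :: "'a set \<Rightarrow> real"
  shows "(\<Sum>R\<in>Pow V. p ^ card R * (1 - p) ^ card (V - R) * (\<Sum>I\<in>ind_sets R. h I))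
    = (\<Sum>I\<in>ind_sets V. p ^ card I * h I)"
proof -
  have "(\<Sum>I\<in>ind_sets V. h I * (\<Sum>R\<in>{R. {} \<union> I \<subseteq> R \<and> R \<subseteq> V}. p ^ card R * (1 - p) ^ card (V - R)))
      = (\<Sum>I\<in>ind_sets V. p ^ card I * h I)"
    by (intro sum.cong refl)
       (simp add: sum_bernoulli_weight_superset[OF finite_V ind_sets_subset])
  then show ?thesis using sum_joint_weight[of p "{}" h] by simp
qed

text \<open>The tilt costs a factor 2 per vertex. Summing out R leaves p^|T \<union> I| = p^|T| p^|I
  - T|. The remainder I - T is again independent, and at most 2^|T| sets I share it.\<close>

lemma tilted_superset_le:
  assumes "0 \<le> p" and T: "T \<subseteq> V"
  shows "tilted p (\<lambda>R. T \<subseteq> R) \<le> partition_fun p * (2 * p) ^ card T"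
proof -
  have finT: "finite T" using finite_subset[OF T finite_V] .
  have "tilted p (\<lambda>R. T \<subseteq> R)
      = (\<Sum>R\<in>Pow V. p ^ card R * (1 - p) ^ card (V - R) * (\<Sum>I\<in>ind_sets R. of_bool (T \<subseteq> R) * 1))"
    unfolding tilted_def using finite_V by (intro sum.mono_neutral_cong_left) auto
  also have "\<dots> = (\<Sum>I\<in>ind_sets V. p ^ card (T \<union> I))"
    unfolding sum_joint_weight mult_1
    by (intro sum.cong refl sum_bernoulli_weight_superset[OF finite_V])
       (use T ind_sets_subset in blast)
  also have "\<dots> = (\<Sum>I\<in>ind_sets V. p ^ card T * p ^ card (I - T))"
  proof (intro sum.cong refl)
    fix I assume "I \<in> ind_sets V"
    then have "finite I" using finite_subset[OF ind_sets_subset finite_V] by blast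
    then have "card (T \<union> (I - T)) = card T + card (I - T)"
      using finT by (intro card_Un_disjoint) auto
    then show "p ^ card (T \<union> I) = p ^ card T * p ^ card (I - T)"
      by (simp add: power_add)
  qed
  finally have tilted: "tilted p (\<lambda>R. T \<subseteq> R) = p ^ card T * (\<Sum>I\<in>ind_sets V. p ^ card (I - T))"
    by (simp add: sum_distrib_left)
  have "(\<Sum>I\<in>ind_sets V. p ^ card (I - T))
      = (\<Sum>(J, S)\<in>(\<lambda>I. (I - T, I \<inter> T)) ` ind_sets V. p ^ card J)"
  proof -
    have "inj_on (\<lambda>I. (I - T, I \<inter> T)) (ind_sets V)"
      by (intro inj_onI) (metis Un_Diff_Int prod.inject)
    then show ?thesis by (simp add: sum.reindex)
  qed
  also have "\<dots> \<le> (\<Sum>(J, S)\<in>ind_sets V \<times> Pow T. p ^ card J)"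
  proof (intro sum_mono2)
    show "(\<lambda>I. (I - T, I \<inter> T)) ` ind_sets V \<subseteq> ind_sets V \<times> Pow T"
      by (auto simp: ind_sets_def intro: indep_mono)
  qed (use finT finite_ind_sets[of V] assms in auto)
  also have "\<dots> = partition_fun p * 2 ^ card T"
    using finT by (simp add: sum.cartesian_product[symmetric] partition_fun_def card_Pow
        sum_distrib_left mult.commute)
  finally have "p ^ card T * (\<Sum>I\<in>ind_sets V. p ^ card (I - T))
      \<le> p ^ card T * (partition_fun p * 2 ^ card T)"
    using assms(1) by (intro mult_left_mono) auto
  then show ?thesis
    by (simp add: tilted power_mult_distrib mult_ac)
qed

lemma tilted_union_bound:
  assumes p: "0 \<le> p" "p \<le> 1" and "finite J" "\<And>j. j \<in> J \<Longrightarrow> T j \<subseteq> V"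
    and cover: "\<And>R. R \<subseteq> V \<Longrightarrow> X R \<Longrightarrow> \<exists>j\<in>J. T j \<subseteq> R"
  shows "tilted p X \<le> partition_fun p * (\<Sum>j\<in>J. (2 * p) ^ card (T j))"
proof -
  let ?g = "\<lambda>R. p ^ card R * (1 - p) ^ card (V - R) * real (card (ind_sets R))"
  have nonneg: "0 \<le> ?g R" for R using p by simp
  have "tilted p X \<le> (\<Sum>R\<in>{R\<in>Pow V. X R}. \<Sum>j\<in>J. of_bool (T j \<subseteq> R) * ?g R)"
    unfolding tilted_def
  proof (intro sum_mono)
    fix R assume "R \<in> {R\<in>Pow V. X R}"
    then obtain j where j: "j \<in> J" "T j \<subseteq> R" using cover[of R] by auto
    have "?g R = of_bool (T j \<subseteq> R) * ?g R" using j by simp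
    also have "\<dots> \<le> (\<Sum>j\<in>J. of_bool (T j \<subseteq> R) * ?g R)"
      by (rule member_le_sum[OF j(1)]) (use assms(3) nonneg in auto)
    finally show "?g R \<le> (\<Sum>j\<in>J. of_bool (T j \<subseteq> R) * ?g R)" .
  qed
  also have "\<dots> \<le> (\<Sum>R\<in>Pow V. \<Sum>j\<in>J. of_bool (T j \<subseteq> R) * ?g R)"
    using finite_V p by (intro sum_mono2) (auto intro!: sum_nonneg mult_nonneg_nonneg)
  also have "\<dots> = (\<Sum>j\<in>J. \<Sum>R\<in>Pow V. of_bool (T j \<subseteq> R) * ?g R)"
    by (rule sum.swap)
  also have "\<dots> = (\<Sum>j\<in>J. tilted p (\<lambda>R. T j \<subseteq> R))"
    unfolding tilted_def using finite_V
    by (intro sum.cong refl sum.mono_neutral_cong_right) auto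
  also have "\<dots> \<le> (\<Sum>j\<in>J. partition_fun p * (2 * p) ^ card (T j))"
    using assms by (intro sum_mono tilted_superset_le) auto
  finally show ?thesis by (simp add: sum_distrib_left)
qed

section \<open>Short cycles through a vertex\<close>

definition links :: "'a \<Rightarrow> 'a set set" where
  "links v = {e\<in>E. card e = 4 \<and> v \<in> e}"

text \<open>Such an edge closes a cycle with A. As edges have at most four vertices, it brings one
  or two new ones.\<close>

definition crossing :: "'a set \<Rightarrow> 'a set set" where
  "crossing A = {f\<in>E. 2 \<le> card (f \<inter> A) \<and> \<not> f \<subseteq> A}"

lemma finite_edge: "e \<in> E \<Longrightarrow> finite e"
  using edge_card by (metis card.infinite zero_neq_numeral)

lemma card_triples_through_le:
  assumes "v \<in> V"
  shows "card {f\<in>E. card f = 3 \<and> v \<in> f} \<le> card V * K"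
proof -
  let ?ext = "\<lambda>g. {x \<in> V - g. insert x g \<in> E}"
  have "{f\<in>E. card f = 3 \<and> v \<in> f}
      \<subseteq> (\<Union>y\<in>V - {v}. (\<lambda>x. insert x {v, y}) ` ?ext {v, y})"
  proof
    fix f assume "f \<in> {f\<in>E. card f = 3 \<and> v \<in> f}"
    then have f: "f \<in> E" "card f = 3" "v \<in> f" by auto
    then have "card (f - {v}) = 2" by simp
    then obtain y x where yx: "f - {v} = {y, x}" "y \<noteq> x" by (meson card_2_iff)
    then have "f = insert x {v, y}" "y \<noteq> v" "x \<noteq> v" using f by auto
    moreover have "f \<subseteq> V" using edge_subset f by blast
    ultimately show "f \<in> (\<Union>y\<in>V - {v}. (\<lambda>x. insert x {v, y}) ` ?ext {v, y})"
      using f yx by (intro UN_I[of y] image_eqI[of _ _ x]) auto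
  qed
  then have "card {f\<in>E. card f = 3 \<and> v \<in> f}
      \<le> card (\<Union>y\<in>V - {v}. (\<lambda>x. insert x {v, y}) ` ?ext {v, y})"
    using finite_V by (intro card_mono) auto
  also have "\<dots> \<le> (\<Sum>y\<in>V - {v}. card ((\<lambda>x. insert x {v, y}) ` ?ext {v, y}))"
    using finite_V by (intro card_UN_le) auto
  also have "\<dots> \<le> (\<Sum>y\<in>V - {v}. K)"
  proof (intro sum_mono order_trans[OF card_image_le])
    fix y assume "y \<in> V - {v}"
    then show "card (?ext {v, y}) \<le> K" using assms by (intro card_extensions) auto
  qed (use finite_V in auto)
  also have "\<dots> \<le> card V * K"
    using finite_V by (simp add: card_mono)
  finally show ?thesis .
qed

lemma card_links_le:
  assumes "v \<in> V"
  shows "card (links v) \<le> card V ^ 2 * K"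
proof -
  let ?ext = "\<lambda>g. {x \<in> V - g. insert x g \<in> E}"
  let ?P = "{(y, z). y \<in> V \<and> z \<in> V \<and> y \<noteq> v \<and> z \<noteq> v \<and> y \<noteq> z}"
  let ?U = "\<Union>(y, z)\<in>?P. (\<lambda>x. insert x {v, y, z}) ` ?ext {v, y, z}"
  have P: "?P \<subseteq> V \<times> V" by auto
  then have finP: "finite ?P" using finite_V by (meson finite_SigmaI finite_subset)
  have "links v \<subseteq> ?U"
  proof
    fix f assume "f \<in> links v"
    then have f: "f \<in> E" "card f = 4" "v \<in> f" by (auto simp: links_def)
    then have "card (f - {v}) = 3" by simp
    then obtain y z x where yzx: "f - {v} = {y, z, x}" "y \<noteq> z" "y \<noteq> x" "z \<noteq> x"
      by (metis card_3_iff)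
    then have eq: "f = insert x {v, y, z}" "y \<noteq> v" "z \<noteq> v" "x \<noteq> v" using f by auto
    moreover have "f \<subseteq> V" using edge_subset f by blast
    ultimately have "(y, z) \<in> ?P" "x \<in> ?ext {v, y, z}" using f yzx by auto
    then show "f \<in> ?U" using eq(1) by blast
  qed
  then have "card (links v) \<le> card ?U"
    using finP finite_V by (intro card_mono) auto
  also have "\<dots> \<le> (\<Sum>yz\<in>?P. card (case yz of (y, z) \<Rightarrow> (\<lambda>x. insert x {v, y, z}) ` ?ext {v, y, z}))"
    using finP by (intro card_UN_le)
  also have "\<dots> \<le> (\<Sum>yz\<in>?P. K)"
  proof (intro sum_mono)
    fix yz assume "yz \<in> ?P"
    then obtain y z where yz: "yz = (y, z)" "y \<in> V" "z \<in> V" "card {v, y, z} = 3" by auto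
    have "card ((\<lambda>x. insert x {v, y, z}) ` ?ext {v, y, z}) \<le> card (?ext {v, y, z})"
      using finite_V by (intro card_image_le) auto
    also have "\<dots> \<le> K" using yz assms by (intro card_extensions) auto
    finally show "card (case yz of (y, z) \<Rightarrow> (\<lambda>x. insert x {v, y, z}) ` ?ext {v, y, z}) \<le> K"
      using yz by simp
  qed
  also have "\<dots> \<le> card (V \<times> V) * K"
    using finite_V card_mono[OF _ P] by simp
  finally show ?thesis by (simp add: card_cartesian_product power2_eq_square)
qed

text \<open>With one new vertex the edge is determined by its trace on A up to K choices. With two,
  the trace is a pair, the first new vertex is arbitrary, and K choices remain for the second. In
  either case there are at most 2^|A| traces.\<close>

lemma sum_crossing_le:
  fixes x :: real
  assumes A: "A \<subseteq> V" and x: "0 \<le> x"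
  shows "(\<Sum>f\<in>crossing A. x ^ card (f - A)) \<le> 2 ^ card A * real K * (x + real (card V) * x ^ 2)"
proof -
  have finA: "finite A" using finite_subset[OF A finite_V] .
  let ?ext = "\<lambda>g. {x \<in> V - g. insert x g \<in> E}"
  have finc: "finite (crossing A)" using finite_E by (simp add: crossing_def)
  define F where "F = (\<lambda>i. {f\<in>crossing A. card (f - A) = i})"
  have decomp: "card f = card (f \<inter> A) + card (f - A)" "f \<subseteq> V" "finite f" if "f \<in> crossing A" for f
  proof -
    have "f \<in> E" using that by (simp add: crossing_def)
    then show "finite f" "f \<subseteq> V" by (auto simp: finite_edge dest: edge_subset)
    then show "card f = card (f \<inter> A) + card (f - A)"
      by (simp add: card_Int_Diff)
  qed
  have split: "crossing A = F 1 \<union> F 2"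
  proof -
    have "card (f - A) = 1 \<or> card (f - A) = 2" if "f \<in> crossing A" for f
    proof -
      have "card (f - A) \<noteq> 0" using that decomp(3)[OF that] by (auto simp: crossing_def)
      moreover have "card f \<le> 4" "2 \<le> card (f \<inter> A)"
        using that edge_card by (fastforce simp: crossing_def)+
      ultimately show ?thesis using decomp(1)[OF that] by linarith
    qed
    then show ?thesis by (auto simp: F_def)
  qed
  have F1: "card (F 1) \<le> 2 ^ card A * K"
  proof -
    let ?G = "{g\<in>Pow A. card g = 2 \<or> card g = 3}"
    have "F 1 \<subseteq> (\<Union>g\<in>?G. (\<lambda>y. insert y g) ` ?ext g)"
    proof
      fix f assume "f \<in> F 1"
      then have f: "f \<in> crossing A" "card (f - A) = 1" by (auto simp: F_def)
      then obtain y where y: "f - A = {y}" by (metis card_1_singletonE)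
      then have eq: "f = insert y (f \<inter> A)" "y \<notin> A" by auto
      have E: "f \<in> E" using f by (simp add: crossing_def)
      then have "f \<inter> A \<in> ?G" using decomp(1)[OF f(1)] f(2) edge_card[OF E] by auto
      moreover have "y \<in> ?ext (f \<inter> A)" using eq E decomp(2)[OF f(1)] by auto
      ultimately show "f \<in> (\<Union>g\<in>?G. (\<lambda>y. insert y g) ` ?ext g)" using eq(1) by blast
    qed
    then have "card (F 1) \<le> card (\<Union>g\<in>?G. (\<lambda>y. insert y g) ` ?ext g)"
      using finA finite_V by (intro card_mono) auto
    also have "\<dots> \<le> (\<Sum>g\<in>?G. card ((\<lambda>y. insert y g) ` ?ext g))"
      using finA by (intro card_UN_le) auto
    also have "\<dots> \<le> (\<Sum>g\<in>?G. K)"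
    proof (intro sum_mono order_trans[OF card_image_le])
      fix g assume "g \<in> ?G"
      then show "card (?ext g) \<le> K" using A by (intro card_extensions) auto
    qed (use finite_V in auto)
    also have "\<dots> \<le> card (Pow A) * K"
      using finA by (auto intro!: card_mono)
    finally show ?thesis using finA by (simp add: card_Pow)
  qed
  have F2: "card (F 2) \<le> 2 ^ card A * card V * K"
  proof -
    let ?G = "{(g, y). g \<subseteq> A \<and> card g = 2 \<and> y \<in> V - A}"
    let ?U = "\<Union>(g, y)\<in>?G. (\<lambda>z. insert z (insert y g)) ` ?ext (insert y g)"
    have G: "?G \<subseteq> Pow A \<times> V" by auto
    have finG: "finite ?G" using finA finite_V by (intro finite_subset[OF G]) simp
    have "F 2 \<subseteq> ?U"
    proof
      fix f assume "f \<in> F 2"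
      then have f: "f \<in> crossing A" "card (f - A) = 2" by (auto simp: F_def)
      then obtain y z where yz: "f - A = {y, z}" "y \<noteq> z" by (meson card_2_iff)
      then have eq: "f = insert z (insert y (f \<inter> A))" "y \<notin> A" "z \<notin> A" by auto
      have E: "f \<in> E" using f by (simp add: crossing_def)
      have "card (f \<inter> A) = 2"
        using decomp(1)[OF f(1)] f edge_card[OF E] by (auto simp: crossing_def)
      then have "(f \<inter> A, y) \<in> ?G" using decomp(2)[OF f(1)] yz by auto
      moreover have "z \<in> ?ext (insert y (f \<inter> A))"
        using eq yz(2) E decomp(2)[OF f(1)] by auto
      ultimately show "f \<in> ?U" using eq(1) by blast
    qed
    then have "card (F 2) \<le> card ?U"
      using finG finite_V by (intro card_mono) auto
    also have "\<dots> \<le> (\<Sum>gy\<in>?G. card (case gy of (g, y) \<Rightarrow> (\<lambda>z. insert z (insert y g)) ` ?ext (insert y g)))"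
      using finG by (intro card_UN_le)
    also have "\<dots> \<le> (\<Sum>gy\<in>?G. K)"
    proof (intro sum_mono)
      fix gy assume "gy \<in> ?G"
      then obtain g y where gy: "gy = (g, y)" "g \<subseteq> A" "card g = 2" "y \<in> V - A" by auto
      have "finite g" using gy(2) finA by (rule finite_subset)
      then have card3: "card (insert y g) = 3" using gy by (subst card_insert_disjoint) auto
      have "card ((\<lambda>z. insert z (insert y g)) ` ?ext (insert y g)) \<le> card (?ext (insert y g))"
        using finite_V by (intro card_image_le) auto
      also have "\<dots> \<le> K" using gy A card3 by (intro card_extensions) auto
      finally show "card (case gy of (g, y) \<Rightarrow> (\<lambda>z. insert z (insert y g)) ` ?ext (insert y g)) \<le> K"
        using gy by simp
    qed
    also have "\<dots> \<le> card (Pow A \<times> V) * K"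
      using finA finite_V card_mono[OF _ G] by simp
    finally show ?thesis using finA by (simp add: card_cartesian_product card_Pow)
  qed
  have "(\<Sum>f\<in>crossing A. x ^ card (f - A)) = (\<Sum>f\<in>F 1. x ^ card (f - A)) + (\<Sum>f\<in>F 2. x ^ card (f - A))"
    unfolding split using finc by (intro sum.union_disjoint) (auto simp: F_def)
  also have "\<dots> = real (card (F 1)) * x + real (card (F 2)) * x ^ 2"
    by (simp add: F_def)
  also have "\<dots> \<le> real (2 ^ card A * K) * x + real (2 ^ card A * card V * K) * x ^ 2"
    using x F1 F2 by (intro add_mono mult_right_mono) (simp_all only: of_nat_le_iff zero_le_power)
  finally show ?thesis by (simp add: algebra_simps)
qed

text \<open>A set \<open>R\<close> is crowded at \<open>v\<close> if it contains \<open>v\<close>, or the other vertices of a short edge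
  or of a cycle of length two or three through \<open>v\<close>.\<close>

definition crowded :: "'a \<Rightarrow> 'a set \<Rightarrow> bool" where
  "crowded v R \<longleftrightarrow> v \<in> R
    \<or> (\<exists>f\<in>E. card f = 3 \<and> v \<in> f \<and> f - {v} \<subseteq> R)
    \<or> (\<exists>e\<in>links v. \<exists>f\<in>crossing e. (e \<union> f) - {v} \<subseteq> R)
    \<or> (\<exists>e\<in>links v. \<exists>e'\<in>links v. e \<inter> e' = {v} \<and> (\<exists>f\<in>crossing (e \<union> e'). (e \<union> e' \<union> f) - {v} \<subseteq> R))"

text \<open>Suppose f contains two blocking vertices. If they lie on one link through v, then f and
  this link form a cycle of length two. Otherwise the links meet only in v, and f meets each of them
  at most once. Having at least three vertices, f then leaves their union and closes a cycle of
  length three.\<close>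

lemma not_crowded_sparse:
  assumes R: "R \<subseteq> V" and good: "\<not> crowded v R" and f: "f \<in> E" "f \<subseteq> R"
  shows "card (f \<inter> \<Union>(blockers v R)) \<le> 1"
proof (rule ccontr)
  assume "\<not> card (f \<inter> \<Union>(blockers v R)) \<le> 1"
  then obtain y1 y2 where y: "y1 \<noteq> y2" "y1 \<in> f" "y2 \<in> f"
    "y1 \<in> \<Union>(blockers v R)" "y2 \<in> \<Union>(blockers v R)"
    using finite_edge[OF f(1)] card_le_Suc0_iff_eq[of "f \<inter> \<Union>(blockers v R)"] by auto
  then obtain t1 t2 where t: "t1 \<in> blockers v R" "y1 \<in> t1" "t2 \<in> blockers v R" "y2 \<in> t2" by auto
  have v: "v \<notin> R" using good by (simp add: crowded_def)
  have link: "insert v t \<in> links v" if "t \<in> blockers v R" for t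
  proof -
    have "finite t" using that card_ge_0_finite[of t] by (simp add: blockers_def)
    then show ?thesis using that by (auto simp: links_def blockers_def)
  qed
  \<comment> \<open>Used for the edge f inside R and for a second link at v alike. The antichain
    condition excludes g \<subseteq> e, so a second common vertex would make g a crossing edge of
    e.\<close>
  have few: "card (g \<inter> e) \<le> 1"
    if "e \<in> links v" "e - {v} \<subseteq> R" "g \<in> E" "g - {v} \<subseteq> R" "g \<noteq> e" for e g
  proof (rule ccontr)
    assume "\<not> card (g \<inter> e) \<le> 1"
    moreover have "\<not> g \<subseteq> e" using that edge_antichain[of g e] by (auto simp: links_def)
    ultimately have "g \<in> crossing e" using that by (simp add: crossing_def)
    moreover have "(e \<union> g) - {v} \<subseteq> R" using that by auto
    ultimately show False using good that(1) by (auto simp: crowded_def)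
  qed
  define e1 e2 where "e1 = insert v t1" and "e2 = insert v t2"
  have e: "e1 \<in> links v" "e2 \<in> links v" "e1 - {v} \<subseteq> R" "e2 - {v} \<subseteq> R"
    using link t by (auto simp: e1_def e2_def blockers_def)
  have fE: "f - {v} \<subseteq> R" "f \<noteq> e1" "f \<noteq> e2" using f v by (auto simp: e1_def e2_def)
  have c: "card (f \<inter> e1) \<le> 1" "card (f \<inter> e2) \<le> 1"
    using few e f(1) fE by blast+
  have "e1 \<noteq> e2"
  proof
    assume "e1 = e2"
    then have "{y1, y2} \<subseteq> f \<inter> e1" using y t by (auto simp: e1_def e2_def)
    then have "card {y1, y2} \<le> card (f \<inter> e1)"
      using finite_edge[OF f(1)] by (intro card_mono) auto
    then show False using c y(1) by simp
  qed
  then have "card (e2 \<inter> e1) \<le> 1"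
    using few[OF e(1,3), of e2] e by (auto simp: links_def)
  moreover have "finite (e2 \<inter> e1)" "v \<in> e2 \<inter> e1"
    using e finite_edge by (auto simp: links_def)
  ultimately have "e1 \<inter> e2 = {v}"
    using card_le_Suc0_iff_eq[of "e2 \<inter> e1"] by auto
  moreover have "f \<in> crossing (e1 \<union> e2)"
  proof -
    have "{y1, y2} \<subseteq> f \<inter> (e1 \<union> e2)" using y t by (auto simp: e1_def e2_def)
    then have "card {y1, y2} \<le> card (f \<inter> (e1 \<union> e2))"
      using finite_edge[OF f(1)] by (intro card_mono) auto
    moreover have "\<not> f \<subseteq> e1 \<union> e2"
    proof
      assume "f \<subseteq> e1 \<union> e2"
      then have "f = (f \<inter> e1) \<union> (f \<inter> e2)" by auto
      then have "card f \<le> card (f \<inter> e1) + card (f \<inter> e2)" by (metis card_Un_le)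
      then show False using c edge_card[OF f(1)] by auto
    qed
    ultimately show ?thesis using y(1) f(1) by (simp add: crossing_def)
  qed
  moreover have "(e1 \<union> e2 \<union> f) - {v} \<subseteq> R" using e fE by auto
  ultimately show False using good e by (auto simp: crowded_def)
qed

text \<open>One summand per clause of \<open>crowded\<close>, each an expected number with x per
  vertex: v itself, the edges of size 3 at v, and then one link or a pair of links times a crossing
  edge. A link contributes N^2 K x^3, since v is not counted.\<close>

definition crowding_bound :: "real \<Rightarrow> real" where
  "crowding_bound x = x + real (card V) * real K * x ^ 2
    + (real (card V) ^ 2 * real K * x ^ 3 + (real (card V) ^ 2 * real K * x ^ 3) ^ 2)
      * (2 ^ 7 * real K * (x + real (card V) * x ^ 2))"

lemma tilted_disj:
  assumes "0 \<le> p" "p \<le> 1"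
  shows "tilted p (\<lambda>R. X R \<or> Y R) \<le> tilted p X + tilted p Y"
proof -
  let ?g = "\<lambda>R. p ^ card R * (1 - p) ^ card (V - R) * real (card (ind_sets R))"
  have "tilted p (\<lambda>R. X R \<or> Y R) = sum ?g ({R\<in>Pow V. X R} \<union> {R\<in>Pow V. Y R})"
    unfolding tilted_def by (intro sum.cong) auto
  also have "\<dots> \<le> tilted p X + tilted p Y"
    unfolding tilted_def using finite_V assms by (subst sum_Un) (auto intro!: sum_nonneg)
  finally show ?thesis .
qed

lemma partition_fun_nonneg: "0 \<le> p \<Longrightarrow> 0 \<le> partition_fun p"
  unfolding partition_fun_def by (intro sum_nonneg) auto

lemma tilted_crowded_le:
  assumes p: "0 \<le> p" "p \<le> 1" and v: "v \<in> V"
  shows "tilted p (crowded v) \<le> partition_fun p * crowding_bound (2 * p)"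
proof -
  define x where "x = 2 * p"
  have x: "0 \<le> x" using p by (simp add: x_def)
  define Z where "Z = partition_fun p"
  have Z: "0 \<le> Z" using p by (simp add: Z_def partition_fun_nonneg)
  define N where "N = real (card V)"
  define \<rho> where "\<rho> = 2 ^ 7 * real K * (x + N * x ^ 2)"
  have \<rho>: "0 \<le> \<rho>" using x by (simp add: \<rho>_def N_def)
  have finl: "finite (links v)" using finite_E by (simp add: links_def)
  have finc: "finite (crossing A)" for A using finite_E by (simp add: crossing_def)
  have subV: "e \<subseteq> V" if "e \<in> links v" for e using that edge_subset by (auto simp: links_def)
  have subV': "f \<subseteq> V" if "f \<in> crossing A" for f A using that edge_subset by (auto simp: crossing_def)
  have card_link: "card e = 4" "finite e" "v \<in> e" if "e \<in> links v" for e
    using that finite_edge by (auto simp: links_def)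
  have links_real: "real (card (links v)) \<le> N ^ 2 * real K"
    using card_links_le[OF v] unfolding N_def by (metis of_nat_le_iff of_nat_mult of_nat_power)
  \<comment> \<open>A will be one link, with 4 vertices, or two links sharing only v, with 4 + 4 - 1
    = 7; \<rho> covers both.\<close>
  have cross: "(\<Sum>f\<in>crossing A. x ^ card (f - A)) \<le> \<rho>" if "A \<subseteq> V" "card A \<le> 7" for A
  proof -
    have "(\<Sum>f\<in>crossing A. x ^ card (f - A)) \<le> 2 ^ card A * real K * (x + N * x ^ 2)"
      using sum_crossing_le[OF that(1) x] by (simp add: N_def)
    also have "\<dots> \<le> \<rho>"
      unfolding \<rho>_def using x that(2)
      by (intro mult_right_mono power_increasing) (auto simp: N_def)
    finally show ?thesis .
  qed
  have b0: "tilted p (\<lambda>R. v \<in> R) \<le> Z * x"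
    using tilted_union_bound[OF p, of "{()}" "\<lambda>_. {v}" "\<lambda>R. v \<in> R"] v
    by (simp add: Z_def x_def)
  have b1: "tilted p (\<lambda>R. \<exists>f\<in>E. card f = 3 \<and> v \<in> f \<and> f - {v} \<subseteq> R) \<le> Z * (N * real K * x ^ 2)"
  proof -
    let ?J = "{f\<in>E. card f = 3 \<and> v \<in> f}"
    have "tilted p (\<lambda>R. \<exists>f\<in>E. card f = 3 \<and> v \<in> f \<and> f - {v} \<subseteq> R)
        \<le> Z * (\<Sum>f\<in>?J. x ^ card (f - {v}))"
      unfolding Z_def x_def using finite_E edge_subset
      by (intro tilted_union_bound p) auto
    also have "(\<Sum>f\<in>?J. x ^ card (f - {v})) = real (card ?J) * x ^ 2" by simp
    also have "\<dots> \<le> real (card V * K) * x ^ 2"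
      using x card_triples_through_le[OF v] by (intro mult_right_mono) (auto simp only: of_nat_le_iff zero_le_power)
    finally show ?thesis using Z by (simp add: N_def mult_left_mono)
  qed
  have b2: "tilted p (\<lambda>R. \<exists>e\<in>links v. \<exists>f\<in>crossing e. (e \<union> f) - {v} \<subseteq> R)
      \<le> Z * (N ^ 2 * real K * x ^ 3 * \<rho>)"
  proof -
    have "tilted p (\<lambda>R. \<exists>e\<in>links v. \<exists>f\<in>crossing e. (e \<union> f) - {v} \<subseteq> R)
        \<le> Z * (\<Sum>ef\<in>(SIGMA e:links v. crossing e). x ^ card ((fst ef \<union> snd ef) - {v}))"
      unfolding Z_def x_def using finl finc subV subV'
      by (intro tilted_union_bound p) (auto, blast+)
    also have "(\<Sum>ef\<in>(SIGMA e:links v. crossing e). x ^ card ((fst ef \<union> snd ef) - {v}))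
        = (\<Sum>e\<in>links v. \<Sum>f\<in>crossing e. x ^ card ((e \<union> f) - {v}))"
      using finl finc by (subst sum.Sigma) (auto simp: case_prod_unfold)
    also have "\<dots> = (\<Sum>e\<in>links v. x ^ 3 * (\<Sum>f\<in>crossing e. x ^ card (f - e)))"
    proof (intro sum.cong refl, subst sum_distrib_left, intro sum.cong refl)
      fix e f assume ef: "e \<in> links v" "f \<in> crossing e"
      have "finite f" using ef by (simp add: crossing_def finite_edge)
      moreover have "(e \<union> f) - {v} = (e - {v}) \<union> (f - e)" using card_link[OF ef(1)] by auto
      moreover have "(e - {v}) \<inter> (f - e) = {}" by auto
      ultimately have "card ((e \<union> f) - {v}) = card (e - {v}) + card (f - e)"
        using card_link(2)[OF ef(1)] by (metis card_Un_disjoint finite_Diff)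
      then show "x ^ card ((e \<union> f) - {v}) = x ^ 3 * x ^ card (f - e)"
        using card_link[OF ef(1)] by (simp add: power_add)
    qed
    also have "\<dots> \<le> (\<Sum>e\<in>links v. x ^ 3 * \<rho>)"
      using x subV card_link by (intro sum_mono mult_left_mono cross) auto
    also have "\<dots> = real (card (links v)) * (x ^ 3 * \<rho>)" by simp
    also have "\<dots> \<le> N ^ 2 * real K * (x ^ 3 * \<rho>)"
      using x \<rho> links_real by (intro mult_right_mono) auto
    finally show ?thesis using Z by (simp add: mult_left_mono mult.assoc)
  qed
  have b3: "tilted p (\<lambda>R. \<exists>e\<in>links v. \<exists>e'\<in>links v. e \<inter> e' = {v} \<and>
        (\<exists>f\<in>crossing (e \<union> e'). (e \<union> e' \<union> f) - {v} \<subseteq> R))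
      \<le> Z * ((N ^ 2 * real K * x ^ 3) ^ 2 * \<rho>)"
  proof -
    define P where "P = {ee\<in>links v \<times> links v. fst ee \<inter> snd ee = {v}}"
    have P: "P \<subseteq> links v \<times> links v" by (auto simp: P_def)
    have finP: "finite P" using finl by (intro finite_subset[OF P]) simp
    have cardP: "card (fst ee \<union> snd ee) = 7" "finite (fst ee \<union> snd ee)" "v \<in> fst ee \<union> snd ee"
        "fst ee \<union> snd ee \<subseteq> V" if "ee \<in> P" for ee
    proof -
      have l: "fst ee \<in> links v" "snd ee \<in> links v" "fst ee \<inter> snd ee = {v}"
        using that by (auto simp: P_def)
      show "finite (fst ee \<union> snd ee)" "v \<in> fst ee \<union> snd ee" "fst ee \<union> snd ee \<subseteq> V"
        using l card_link subV by auto
      have "card (fst ee) + card (snd ee) = card (fst ee \<union> snd ee) + card (fst ee \<inter> snd ee)"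
        using l card_link by (intro card_Un_Int) auto
      then show "card (fst ee \<union> snd ee) = 7" using l card_link by simp
    qed
    let ?S = "SIGMA ee:P. crossing (fst ee \<union> snd ee)"
    let ?T = "\<lambda>ef. (fst (fst ef) \<union> snd (fst ef) \<union> snd ef) - {v}"
    have "tilted p (\<lambda>R. \<exists>e\<in>links v. \<exists>e'\<in>links v. e \<inter> e' = {v} \<and>
        (\<exists>f\<in>crossing (e \<union> e'). (e \<union> e' \<union> f) - {v} \<subseteq> R))
      \<le> Z * (\<Sum>ef\<in>?S. x ^ card (?T ef))"
      unfolding Z_def x_def
    proof (intro tilted_union_bound p)
      show "finite ?S" using finP finc by auto
      show "?T ef \<subseteq> V" if "ef \<in> ?S" for ef
        using that cardP(4)[of "fst ef"] subV'[of "snd ef" "fst (fst ef) \<union> snd (fst ef)"] by auto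
      show "\<exists>ef\<in>?S. ?T ef \<subseteq> R" if *: "\<exists>e\<in>links v. \<exists>e'\<in>links v. e \<inter> e' = {v} \<and>
        (\<exists>f\<in>crossing (e \<union> e'). (e \<union> e' \<union> f) - {v} \<subseteq> R)" for R
      proof -
        obtain e e' f where "e \<in> links v" "e' \<in> links v" "e \<inter> e' = {v}" "f \<in> crossing (e \<union> e')"
          "(e \<union> e' \<union> f) - {v} \<subseteq> R" using * by blast
        then show ?thesis by (intro bexI[of _ "((e, e'), f)"]) (auto simp: P_def)
      qed
    qed
    also have "(\<Sum>ef\<in>?S. x ^ card (?T ef))
        = (\<Sum>ee\<in>P. \<Sum>f\<in>crossing (fst ee \<union> snd ee). x ^ card ((fst ee \<union> snd ee \<union> f) - {v}))"
      using finP finc by (subst sum.Sigma) (auto simp: case_prod_unfold)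
    also have "\<dots> = (\<Sum>ee\<in>P. x ^ 6 * (\<Sum>f\<in>crossing (fst ee \<union> snd ee). x ^ card (f - (fst ee \<union> snd ee))))"
    proof (intro sum.cong refl, subst sum_distrib_left, intro sum.cong refl)
      fix ee f assume ee: "ee \<in> P" and f: "f \<in> crossing (fst ee \<union> snd ee)"
      let ?A = "fst ee \<union> snd ee"
      have "finite f" using f by (simp add: crossing_def finite_edge)
      moreover have "(?A \<union> f) - {v} = (?A - {v}) \<union> (f - ?A)" using cardP(3)[OF ee] by auto
      moreover have "(?A - {v}) \<inter> (f - ?A) = {}" by auto
      ultimately have "card ((?A \<union> f) - {v}) = card (?A - {v}) + card (f - ?A)"
        using cardP(2)[OF ee] by (metis card_Un_disjoint finite_Diff)
      also have "card (?A - {v}) = 6" using cardP[OF ee] by simp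
      finally show "x ^ card ((?A \<union> f) - {v}) = x ^ 6 * x ^ card (f - ?A)"
        by (simp add: power_add)
    qed
    also have "\<dots> \<le> (\<Sum>ee\<in>P. x ^ 6 * \<rho>)"
      using x cardP by (intro sum_mono mult_left_mono cross) auto
    also have "\<dots> = real (card P) * (x ^ 6 * \<rho>)" by simp
    also have "real (card P) \<le> real (card (links v)) ^ 2"
      using card_mono[OF _ P] finl by (simp add: card_cartesian_product power2_eq_square flip: of_nat_mult)
    also have "\<dots> \<le> (N ^ 2 * real K) ^ 2"
      using links_real by (intro power_mono) auto
    finally have "tilted p (\<lambda>R. \<exists>e\<in>links v. \<exists>e'\<in>links v. e \<inter> e' = {v} \<and>
        (\<exists>f\<in>crossing (e \<union> e'). (e \<union> e' \<union> f) - {v} \<subseteq> R))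
      \<le> Z * ((N ^ 2 * real K) ^ 2 * (x ^ 6 * \<rho>))"
      using x \<rho> Z by (simp add: mult_left_mono mult_right_mono)
    moreover have "(N ^ 2 * real K) ^ 2 * (x ^ 6 * \<rho>) = (N ^ 2 * real K * x ^ 3) ^ 2 * \<rho>"
      by (simp add: power_mult_distrib flip: power_mult)
    ultimately show ?thesis by simp
  qed
  have "tilted p (crowded v) \<le> Z * x + (Z * (N * real K * x ^ 2)
      + (Z * (N ^ 2 * real K * x ^ 3 * \<rho>) + Z * ((N ^ 2 * real K * x ^ 3) ^ 2 * \<rho>)))"
    unfolding crowded_def
    by (intro order_trans[OF tilted_disj[OF p]] add_mono b0 b1 b2 b3)
  also have "\<dots> = Z * crowding_bound x"
    by (simp add: crowding_bound_def N_def \<rho>_def algebra_simps)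
  finally show ?thesis by (simp add: Z_def x_def)
qed

section \<open>Averaging over all vertices\<close>

lemma sum_free_extensions:
  fixes p :: real
  shows "p * (\<Sum>I\<in>ind_sets V. p ^ card I * real (card {v\<in>V - I. indep (insert v I)}))
    = (\<Sum>I\<in>ind_sets V. p ^ card I * real (card I))"
proof -
  have fin: "finite I" if "I \<in> ind_sets V" for I
    using finite_subset[OF ind_sets_subset[OF that] finite_V] .
  have finV: "finite (ind_sets V)" by (rule finite_ind_sets) simp
  have "p * (\<Sum>I\<in>ind_sets V. p ^ card I * real (card {v\<in>V - I. indep (insert v I)}))
      = (\<Sum>I\<in>ind_sets V. \<Sum>v\<in>{v\<in>V - I. indep (insert v I)}. p ^ Suc (card I))"
    by (simp add: sum_distrib_left mult_ac)
  also have "\<dots> = (\<Sum>(I, v)\<in>(SIGMA I:ind_sets V. {v\<in>V - I. indep (insert v I)}). p ^ Suc (card I))"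
    using finV finite_V by (intro sum.Sigma) auto
  \<comment> \<open>Double counting: adding a free vertex v to I and deleting a marked vertex v from
    J are inverse to each other, and the factor p pays for the added vertex.\<close>
  also have "\<dots> = (\<Sum>(J, v)\<in>(SIGMA J:ind_sets V. J). p ^ card J)"
  proof (rule sum.reindex_bij_witness[where j = "\<lambda>(I, v). (insert v I, v)" and i = "\<lambda>(J, v). (J - {v}, v)"])
    fix a assume a: "a \<in> (SIGMA I:ind_sets V. {v\<in>V - I. indep (insert v I)})"
    then obtain I v where "a = (I, v)" "I \<in> ind_sets V" "v \<in> V - I" "indep (insert v I)" by auto
    then show "(case case a of (I, v) \<Rightarrow> (insert v I, v) of (J, v) \<Rightarrow> (J - {v}, v)) = a"
      "(case a of (I, v) \<Rightarrow> (insert v I, v)) \<in> (SIGMA J:ind_sets V. J)"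
      "(case case a of (I, v) \<Rightarrow> (insert v I, v) of (J, v) \<Rightarrow> p ^ card J) = (case a of (I, v) \<Rightarrow> p ^ Suc (card I))"
      using fin by (auto simp: ind_sets_def)
  next
    fix b assume b: "b \<in> (SIGMA J:ind_sets V. J)"
    then obtain J v where J: "b = (J, v)" "J \<in> ind_sets V" "v \<in> J" by auto
    then show "(case case b of (J, v) \<Rightarrow> (J - {v}, v) of (I, v) \<Rightarrow> (insert v I, v)) = b"
      by (auto simp: insert_absorb)
    show "(case b of (J, v) \<Rightarrow> (J - {v}, v)) \<in> (SIGMA I:ind_sets V. {v\<in>V - I. indep (insert v I)})"
      using J indep_mono[of J "J - {v}"] by (auto simp: ind_sets_def insert_absorb)
  qed
  also have "\<dots> = (\<Sum>J\<in>ind_sets V. \<Sum>v\<in>J. p ^ card J)"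
    using finV fin by (intro sum.Sigma[symmetric]) auto
  finally show ?thesis by (simp add: mult.commute)
qed

lemma sum_card_blockers_le:
  assumes I: "I \<subseteq> V"
  shows "(\<Sum>v\<in>V. card (blockers v I)) \<le> K * card I ^ 3"
proof -
  have finI: "finite I" using finite_subset[OF I finite_V] .
  let ?T = "{t. t \<subseteq> I \<and> card t = 3}"
  have finT: "finite ?T" using finI by simp
  have "(\<Sum>v\<in>V. card (blockers v I)) = (\<Sum>v\<in>V. \<Sum>t\<in>?T. of_bool (v \<notin> t \<and> insert v t \<in> E))"
    using finT by (intro sum.cong refl) (simp add: sum_of_bool_eq blockers_def Int_def conj_ac)
  also have "\<dots> = (\<Sum>t\<in>?T. \<Sum>v\<in>V. of_bool (v \<notin> t \<and> insert v t \<in> E))"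
    by (rule sum.swap)
  also have "\<dots> \<le> (\<Sum>t\<in>?T. K)"
  proof (intro sum_mono)
    fix t assume t: "t \<in> ?T"
    have "V \<inter> {v. v \<notin> t \<and> insert v t \<in> E} = {v \<in> V - t. insert v t \<in> E}" by auto
    then show "(\<Sum>v\<in>V. of_bool (v \<notin> t \<and> insert v t \<in> E)) \<le> K"
      using t order_trans[of t I V] I finite_V card_extensions[of t] by (simp add: sum_of_bool_eq)
  qed
  also have "\<dots> = (card I choose 3) * K"
    using finI by (simp add: n_subsets)
  also have "\<dots> \<le> card I ^ 3 * K"
    by (cases "3 \<le> card I") (auto intro: binomial_le_pow simp: binomial_eq_0)
  finally show ?thesis by (simp add: mult.commute)
qed

text \<open>The local tradeoff, summed over v and over the uncrowded R. The free vertices turn into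
  the mean size of I by \<open>sum_free_extensions\<close>, and the blocking triples into its third
  moment. Both moments appear unnormalised.\<close>

lemma hardcore_tradeoff:
  assumes p: "0 \<le> p" "p \<le> 1" and \<alpha>: "1 \<le> \<alpha>"
  shows "p * (real (card V) * (ln \<alpha> / 4 * (partition_fun p * (1 - crowding_bound (2 * p)))))
    \<le> \<alpha> * (\<Sum>I\<in>ind_sets V. p ^ card I * real (card I))
      + p * (real K * (\<Sum>I\<in>ind_sets V. p ^ card I * real (card I) ^ 3))"
proof -
  let ?w = "\<lambda>R. p ^ card R * (1 - p) ^ card (V - R)"
  let ?free = "\<lambda>I. {v\<in>V - I. indep (insert v I)}"
  \<comment> \<open>Requiring v \<notin> I makes the sum over v count genuine extensions. If R is
    not crowded at v this is automatic, as then v \<notin> R.\<close>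
  define h where "h = (\<lambda>v I. \<alpha> * of_bool (v \<notin> I \<and> indep (insert v I)) + real (card (blockers v I)))"
  have h_nonneg: "0 \<le> h v I" for v I using \<alpha> by (simp add: h_def)
  have local: "ln \<alpha> / 4 * (partition_fun p * (1 - crowding_bound (2 * p)))
      \<le> (\<Sum>I\<in>ind_sets V. p ^ card I * h v I)" if v: "v \<in> V" for v
  proof -
    have "partition_fun p = (\<Sum>R\<in>Pow V. ?w R * real (card (ind_sets R)))"
      using sum_joint_weight_marginal[of p "\<lambda>_. 1"] by (simp add: partition_fun_def)
    also have "Pow V = {R\<in>Pow V. crowded v R} \<union> {R\<in>Pow V. \<not> crowded v R}" by auto
    also have "(\<Sum>R\<in>{R\<in>Pow V. crowded v R} \<union> {R\<in>Pow V. \<not> crowded v R}. ?w R * real (card (ind_sets R)))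
        = tilted p (crowded v) + tilted p (\<lambda>R. \<not> crowded v R)"
      unfolding tilted_def using finite_V by (intro sum.union_disjoint) auto
    finally have "partition_fun p * (1 - crowding_bound (2 * p)) \<le> tilted p (\<lambda>R. \<not> crowded v R)"
      using tilted_crowded_le[OF p v] by (simp add: algebra_simps)
    then have "ln \<alpha> / 4 * (partition_fun p * (1 - crowding_bound (2 * p)))
        \<le> ln \<alpha> / 4 * tilted p (\<lambda>R. \<not> crowded v R)"
      using \<alpha> by (intro mult_left_mono) auto
    also have "\<dots> = (\<Sum>R\<in>{R\<in>Pow V. \<not> crowded v R}. ?w R * (ln \<alpha> / 4 * real (card (ind_sets R))))"
      unfolding tilted_def sum_distrib_left by (intro sum.cong) auto
    also have "\<dots> \<le> (\<Sum>R\<in>{R\<in>Pow V. \<not> crowded v R}. ?w R * (\<Sum>I\<in>ind_sets R. h v I))"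
    proof (intro sum_mono mult_left_mono)
      fix R assume R: "R \<in> {R\<in>Pow V. \<not> crowded v R}"
      then have "ln \<alpha> / 4 * real (card (ind_sets R))
          \<le> (\<Sum>I\<in>ind_sets R. \<alpha> * of_bool (indep (insert v I)) + real (card (blockers v I)))"
        using not_crowded_sparse[of R v]
        by (intro local_tradeoff \<alpha>) (auto simp: crowded_def)
      also have "\<dots> = (\<Sum>I\<in>ind_sets R. h v I)"
        using R by (intro sum.cong refl) (auto simp: h_def crowded_def ind_sets_def)
      finally show "ln \<alpha> / 4 * real (card (ind_sets R)) \<le> (\<Sum>I\<in>ind_sets R. h v I)" .
    qed (use p in auto)
    also have "\<dots> \<le> (\<Sum>R\<in>Pow V. ?w R * (\<Sum>I\<in>ind_sets R. h v I))"
      using finite_V p h_nonneg by (intro sum_mono2) (auto intro!: sum_nonneg mult_nonneg_nonneg)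
    also have "\<dots> = (\<Sum>I\<in>ind_sets V. p ^ card I * h v I)"
      by (rule sum_joint_weight_marginal)
    finally show ?thesis .
  qed
  have "real (card V) * (ln \<alpha> / 4 * (partition_fun p * (1 - crowding_bound (2 * p))))
      = (\<Sum>v\<in>V. ln \<alpha> / 4 * (partition_fun p * (1 - crowding_bound (2 * p))))" by simp
  also have "\<dots> \<le> (\<Sum>v\<in>V. \<Sum>I\<in>ind_sets V. p ^ card I * h v I)"
    by (intro sum_mono local)
  also have "\<dots> = (\<Sum>I\<in>ind_sets V. p ^ card I * (\<Sum>v\<in>V. h v I))"
    by (subst sum.swap) (simp add: sum_distrib_left)
  also have "\<dots> \<le> (\<Sum>I\<in>ind_sets V. p ^ card I * (\<alpha> * real (card (?free I)) + real K * real (card I) ^ 3))"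
  proof (intro sum_mono mult_left_mono)
    fix I assume I: "I \<in> ind_sets V"
    have "(\<Sum>v\<in>V. of_bool (v \<notin> I \<and> indep (insert v I)) :: real) = real (card (?free I))"
      using finite_V by (simp add: sum_of_bool_eq Int_def conj_ac set_diff_eq)
    moreover have "real (\<Sum>v\<in>V. card (blockers v I)) \<le> real (K * card I ^ 3)"
      using sum_card_blockers_le[OF ind_sets_subset[OF I]] by (simp only: of_nat_le_iff)
    ultimately show "(\<Sum>v\<in>V. h v I) \<le> \<alpha> * real (card (?free I)) + real K * real (card I) ^ 3"
      by (simp add: h_def sum.distrib flip: sum_distrib_left)
  qed (use p in auto)
  also have "\<dots> = \<alpha> * (\<Sum>I\<in>ind_sets V. p ^ card I * real (card (?free I)))
      + real K * (\<Sum>I\<in>ind_sets V. p ^ card I * real (card I) ^ 3)"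
    by (simp add: sum.distrib sum_distrib_left algebra_simps)
  finally have "p * (real (card V) * (ln \<alpha> / 4 * (partition_fun p * (1 - crowding_bound (2 * p)))))
      \<le> p * (\<alpha> * (\<Sum>I\<in>ind_sets V. p ^ card I * real (card (?free I)))
      + real K * (\<Sum>I\<in>ind_sets V. p ^ card I * real (card I) ^ 3))"
    using p by (intro mult_left_mono) auto
  also have "\<dots> = \<alpha> * (p * (\<Sum>I\<in>ind_sets V. p ^ card I * real (card (?free I))))
      + p * (real K * (\<Sum>I\<in>ind_sets V. p ^ card I * real (card I) ^ 3))"
    by (simp add: algebra_simps)
  finally show ?thesis
    unfolding sum_free_extensions .
qed

text \<open>Raising the fugacity from \<open>p\<close> to \<open>l\<close> multiplies the weight of the sets of size at least \<open>m\<close>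
  by at least \<open>(l / p) ^ m\<close>, hence a mere \<open>1 / q\<close> fraction of such sets at \<open>p\<close>
  becomes nearly everything at \<open>l\<close>, up to a factor two in the size.\<close>

lemma small_sets_negligible:
  fixes p l m q :: real
  assumes p: "0 < p" "p \<le> l" and q: "0 < q" and m: "0 \<le> m"
    and big: "partition_fun p \<le> q * (\<Sum>I\<in>{I\<in>ind_sets V. m \<le> real (card I)}. p ^ card I)"
  shows "(\<Sum>I\<in>{I\<in>ind_sets V. real (card I) < m / 2}. l ^ card I)
    \<le> q * (l / p) powr (- m / 2) * partition_fun l"
proof -
  define \<eta> where "\<eta> = l / p"
  have \<eta>: "1 \<le> \<eta>" "l = \<eta> * p" using p by (auto simp: \<eta>_def)
  have fin: "finite (ind_sets V)" by (rule finite_ind_sets) simp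
  have pow: "l ^ k = \<eta> powr k * p ^ k" for k
    using \<eta> by (simp add: power_mult_distrib powr_realpow)
  have "(\<Sum>I\<in>{I\<in>ind_sets V. real (card I) < m / 2}. l ^ card I)
      \<le> (\<Sum>I\<in>{I\<in>ind_sets V. real (card I) < m / 2}. \<eta> powr (m / 2) * p ^ card I)"
    unfolding pow using \<eta> p by (intro sum_mono mult_right_mono powr_mono) auto
  also have "\<dots> \<le> \<eta> powr (m / 2) * partition_fun p"
    unfolding partition_fun_def sum_distrib_left[symmetric] using fin p
    by (intro mult_left_mono sum_mono2) auto
  also have "\<dots> \<le> \<eta> powr (m / 2) * (q * (\<Sum>I\<in>{I\<in>ind_sets V. m \<le> real (card I)}. p ^ card I))"
    using big by (intro mult_left_mono) auto
  also have "\<dots> = q * \<eta> powr (- m / 2) * (\<Sum>I\<in>{I\<in>ind_sets V. m \<le> real (card I)}. \<eta> powr m * p ^ card I)"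
    using \<eta> by (simp add: sum_distrib_left [symmetric] powr_add[symmetric] mult_ac)
  also have "\<dots> \<le> q * \<eta> powr (- m / 2) * (\<Sum>I\<in>{I\<in>ind_sets V. m \<le> real (card I)}. l ^ card I)"
    unfolding pow using \<eta> p q by (intro mult_left_mono sum_mono mult_right_mono powr_mono) auto
  also have "\<dots> \<le> q * \<eta> powr (- m / 2) * partition_fun l"
    unfolding partition_fun_def using fin p q by (intro mult_left_mono sum_mono2) auto
  finally show ?thesis by (simp add: \<eta>_def)
qed

text \<open>By Harris' inequality, conditioning a random set to be independent makes large
  independent subsets less likely.\<close>

lemma prob_no_large_ind_set_le:
  fixes p m :: real
  assumes p: "0 \<le> p" "p < 1"
  defines "l \<equiv> p / (1 - p)"
  shows "measure_pmf.prob (random_subset V p) {A. \<forall>I\<in>ind_sets A. real (card I) < m} * partition_fun l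
    \<le> (\<Sum>I\<in>{I\<in>ind_sets V. real (card I) < m}. l ^ card I)"
proof -
  let ?D = "\<lambda>A. \<forall>I\<in>ind_sets A. real (card I) < m"
  have l: "0 \<le> l" using p by (simp add: l_def)
  have ind_mono: "ind_sets A \<subseteq> ind_sets B" if "A \<subseteq> B" for A B
    using that by (auto simp: ind_sets_def)
  have weight: "p ^ card A * (1 - p) ^ card (V - A) = (1 - p) ^ card V * l ^ card A"
    if "A \<subseteq> V" for A
  proof -
    have "card V = card A + card (V - A)"
      using that finite_V by (metis card_Diff_subset card_mono finite_subset le_add_diff_inverse)
    then show ?thesis using p by (simp add: l_def power_add power_divide)
  qed
  have sum_l: "(\<Sum>A\<in>Pow V. l ^ card A) * (1 - p) ^ card V = 1"
    using p finite_V by (simp add: sum_power_card_Pow l_def flip: power_mult_distrib) (simp add: field_simps)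
  have part: "partition_fun l = (\<Sum>A\<in>Pow V. l ^ card A * of_bool (indep A))"
    unfolding partition_fun_def ind_sets_def using finite_V
    by (intro sum.mono_neutral_cong_left) auto
  have prob: "measure_pmf.prob (random_subset V p) {A. ?D A}
      = (1 - p) ^ card V * (\<Sum>A\<in>Pow V. l ^ card A * of_bool (?D A))"
  proof -
    have "measure_pmf.prob (random_subset V p) {A. ?D A}
        = (\<Sum>A\<in>{A. A \<subseteq> V \<and> ?D A}. (1 - p) ^ card V * l ^ card A)"
      using p finite_V weight by (simp add: prob_random_subset)
    also have "\<dots> = (\<Sum>A\<in>Pow V. (1 - p) ^ card V * (l ^ card A * of_bool (?D A)))"
      using finite_V by (intro sum.mono_neutral_cong_left) auto
    finally show ?thesis by (simp add: sum_distrib_left)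
  qed
  have "(\<Sum>A\<in>Pow V. l ^ card A * of_bool (?D A)) * (\<Sum>A\<in>Pow V. l ^ card A * of_bool (indep A))
      \<le> (\<Sum>A\<in>Pow V. l ^ card A * (of_bool (?D A) * of_bool (indep A))) * (\<Sum>A\<in>Pow V. l ^ card A)"
    using ind_mono indep_mono
    by (intro harris_inequality finite_V l) (auto simp: of_bool_def, blast+)
  then have "(1 - p) ^ card V * ((\<Sum>A\<in>Pow V. l ^ card A * of_bool (?D A)) * partition_fun l)
      \<le> (1 - p) ^ card V * ((\<Sum>A\<in>Pow V. l ^ card A * (of_bool (?D A) * of_bool (indep A))) * (\<Sum>A\<in>Pow V. l ^ card A))"
    unfolding part using p by (intro mult_left_mono) auto
  then have "measure_pmf.prob (random_subset V p) {A. ?D A} * partition_fun l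
      \<le> (\<Sum>A\<in>Pow V. l ^ card A * (of_bool (?D A) * of_bool (indep A)))
        * ((\<Sum>A\<in>Pow V. l ^ card A) * (1 - p) ^ card V)"
    unfolding prob by (simp add: mult_ac)
  \<comment> \<open>Let A be independent. Then A is one of its own independent subsets, so
    \<open>?D A\<close> bounds the size of A itself.\<close>
  also have "\<dots> = (\<Sum>A\<in>Pow V. l ^ card A * (of_bool (?D A) * of_bool (indep A)))"
    unfolding sum_l by simp
  also have "\<dots> \<le> (\<Sum>I\<in>{I\<in>ind_sets V. real (card I) < m}. l ^ card I)"
  proof -
    have "(\<Sum>A\<in>Pow V. l ^ card A * (of_bool (?D A) * of_bool (indep A)))
        = (\<Sum>A\<in>{A\<in>Pow V. ?D A \<and> indep A}. l ^ card A)"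
      using finite_V by (intro sum.mono_neutral_cong_right) auto
    also have "\<dots> \<le> (\<Sum>I\<in>{I\<in>ind_sets V. real (card I) < m}. l ^ card I)"
      using l finite_ind_sets[of V, OF order_refl] by (intro sum_mono2) (simp, auto simp: ind_sets_def)
    finally show ?thesis .
  qed
  finally show ?thesis .
qed

lemma partition_fun_ge_1:
  assumes "0 \<le> p"
  shows "1 \<le> partition_fun p"
proof -
  have "{} \<in> ind_sets V"
    using edge_card by (fastforce simp: ind_sets_def indep_def)
  then have "p ^ card ({} :: 'a set) \<le> partition_fun p"
    unfolding partition_fun_def using assms finite_ind_sets[of V]
    by (intro member_le_sum) auto
  then show ?thesis by simp
qed

text \<open>If sets of size at least m had less than a 1/q share of the weight, the k-th moment of
  the size would be at most m^k + |V|^k / q. For k = 1 and k = 3 this contradicts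
  \<open>hardcore_tradeoff\<close>.\<close>

lemma large_sets_not_negligible:
  fixes p m q \<alpha> :: real
  assumes p: "0 < p" "p \<le> 1" and \<alpha>: "1 \<le> \<alpha>" and q: "0 < q" and m: "0 \<le> m"
    and ineq: "\<alpha> * (m + card V / q) + p * (K * (m ^ 3 + real (card V) ^ 3 / q))
      < p * (card V * (ln \<alpha> / 4 * (1 - crowding_bound (2 * p))))"
  shows "partition_fun p \<le> q * (\<Sum>I\<in>{I\<in>ind_sets V. m \<le> real (card I)}. p ^ card I)"
proof (rule ccontr)
  let ?S = "\<Sum>I\<in>{I\<in>ind_sets V. m \<le> real (card I)}. p ^ card I"
  define Z where "Z = partition_fun p"
  have Z: "0 < Z" using partition_fun_ge_1[of p] p by (simp add: Z_def)
  assume "\<not> partition_fun p \<le> q * ?S"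
  then have S: "?S \<le> Z / q" using q by (simp add: Z_def field_simps)
  have moment: "(\<Sum>I\<in>ind_sets V. p ^ card I * real (card I) ^ k) \<le> (m ^ k + real (card V) ^ k / q) * Z" for k
  proof -
    have fin: "finite (ind_sets V)" by (rule finite_ind_sets) simp
    have "(\<Sum>I\<in>ind_sets V. p ^ card I * real (card I) ^ k)
        \<le> (\<Sum>I\<in>ind_sets V. p ^ card I * m ^ k + of_bool (m \<le> real (card I)) * p ^ card I * real (card V) ^ k)"
    proof (intro sum_mono)
      fix I assume "I \<in> ind_sets V"
      then have "card I \<le> card V" using ind_sets_subset finite_V by (intro card_mono) auto
      then have V: "real (card I) ^ k \<le> real (card V) ^ k" by (intro power_mono) auto
      show "p ^ card I * real (card I) ^ k
          \<le> p ^ card I * m ^ k + of_bool (m \<le> real (card I)) * p ^ card I * real (card V) ^ k"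
      proof (cases "m \<le> real (card I)")
        case True
        have "p ^ card I * real (card I) ^ k \<le> p ^ card I * real (card V) ^ k"
          using p V by (intro mult_left_mono) auto
        moreover have "0 \<le> p ^ card I * m ^ k" using p m by simp
        ultimately show ?thesis using True by simp
      next
        case False
        then have "p ^ card I * real (card I) ^ k \<le> p ^ card I * m ^ k"
          using p by (intro mult_left_mono power_mono) auto
        then show ?thesis using False by simp
      qed
    qed
    also have "\<dots> = Z * m ^ k + (\<Sum>I\<in>ind_sets V. of_bool (m \<le> real (card I)) * p ^ card I) * real (card V) ^ k"
      by (simp add: sum.distrib Z_def partition_fun_def sum_distrib_right)
    also have "(\<Sum>I\<in>ind_sets V. of_bool (m \<le> real (card I)) * p ^ card I) = ?S"
      using fin by (intro sum.mono_neutral_cong_right) auto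
    also have "Z * m ^ k + ?S * real (card V) ^ k \<le> Z * m ^ k + Z / q * real (card V) ^ k"
      using S by (intro add_left_mono mult_right_mono) auto
    finally show ?thesis by (simp add: algebra_simps)
  qed
  have "p * (real (card V) * (ln \<alpha> / 4 * (1 - crowding_bound (2 * p)))) * Z
      = p * (real (card V) * (ln \<alpha> / 4 * (Z * (1 - crowding_bound (2 * p)))))" by simp
  also have "\<dots> \<le> \<alpha> * (\<Sum>I\<in>ind_sets V. p ^ card I * real (card I))
      + p * (real K * (\<Sum>I\<in>ind_sets V. p ^ card I * real (card I) ^ 3))"
    unfolding Z_def using p \<alpha> by (intro hardcore_tradeoff) auto
  also have "\<dots> \<le> \<alpha> * ((m + card V / q) * Z) + p * (real K * ((m ^ 3 + real (card V) ^ 3 / q) * Z))"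
    using moment[of 1] moment[of 3] p \<alpha> by (intro add_mono mult_left_mono) auto
  also have "\<dots> = (\<alpha> * (m + card V / q) + p * (K * (m ^ 3 + real (card V) ^ 3 / q))) * Z"
    by (simp add: algebra_simps)
  finally show False using ineq Z by simp
qed

lemma prob_no_large_ind_set_bound:
  fixes p P m q \<alpha> :: real
  assumes p: "0 < p" "p \<le> P" "P < 1" and \<alpha>: "1 \<le> \<alpha>" and q: "0 < q" and m: "0 \<le> m"
    and ineq: "\<alpha> * (m + card V / q) + p * (K * (m ^ 3 + real (card V) ^ 3 / q))
      < p * (card V * (ln \<alpha> / 4 * (1 - crowding_bound (2 * p))))"
  shows "measure_pmf.prob (random_subset V P) {A. \<forall>I\<in>ind_sets A. real (card I) < m / 2}
    \<le> q * (P / p) powr (- m / 2)"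
proof -
  \<comment> \<open>A P-random set has weights proportional to powers of the odds l. As l is at
    least P, the estimate in terms of l / p implies the one in terms of P / p.\<close>
  define l where "l = P / (1 - P)"
  have l: "P \<le> l" using p by (simp add: l_def field_simps)
  have Z: "0 < partition_fun l" using partition_fun_ge_1[of l] p l by simp
  have "measure_pmf.prob (random_subset V P) {A. \<forall>I\<in>ind_sets A. real (card I) < m / 2} * partition_fun l
      \<le> (\<Sum>I\<in>{I\<in>ind_sets V. real (card I) < m / 2}. l ^ card I)"
    unfolding l_def using p by (intro prob_no_large_ind_set_le) auto
  also have "\<dots> \<le> q * (l / p) powr (- m / 2) * partition_fun l"
    using p l by (intro small_sets_negligible q m large_sets_not_negligible[OF _ _ \<alpha> q m ineq]) auto
  finally have "measure_pmf.prob (random_subset V P) {A. \<forall>I\<in>ind_sets A. real (card I) < m / 2}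
      \<le> q * (l / p) powr (- m / 2)"
    using Z by simp
  also have "\<dots> \<le> q * (P / p) powr (- m / 2)"
    using p l q m by (intro mult_left_mono powr_mono2') (auto simp: divide_right_mono)
  finally show ?thesis .
qed

end

section \<open>Choice of parameters in terms of the number x of vertices\<close>

lemma asymptotic_tradeoff:
  fixes K \<delta> :: real
  assumes K: "K > 0" and \<delta>: "0 < \<delta>" "\<delta> \<le> 1/100"
  defines "\<kappa> \<equiv> \<delta> / (32 * K)"
  shows "\<forall>\<^sub>F x in at_top. x powr (\<delta>/2) * ((\<kappa> * x * ln x) powr (1/3) + x / x ^ 4)
     + x powr (-2/3 + \<delta>) * (K * (((\<kappa> * x * ln x) powr (1/3)) ^ 3 + x ^ 3 / x ^ 4))
     < x powr (-2/3 + \<delta>) * (x * (ln (x powr (\<delta>/2)) / 4 * (1/2)))"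
proof -
  \<comment> \<open>Here \<alpha> = x^(\<delta>/2) and q = x^4. The choice of \<kappa> makes K
    \<kappa> x ln x = (\<delta>/32) x ln x, half of what the right side offers. The term with
    \<alpha> has order x^(1/3+\<delta>/2) up to logarithms, against x^(1/3+\<delta>) on the
    right.\<close>
  have "\<forall>\<^sub>F x in at_top. x powr (\<delta>/2) * ((\<kappa> * x * ln x) powr (1/3) + x / x ^ 4)
     + x powr (-2/3 + \<delta>) * (K * (\<kappa> * x * ln x + x ^ 3 / x ^ 4))
     < x powr (-2/3 + \<delta>) * (x * (\<delta> / 16 * ln x))"
    using K \<delta> unfolding \<kappa>_def by real_asymp
  moreover have "\<forall>\<^sub>F x :: real in at_top. x > 1" by real_asymp
  ultimately show ?thesis
  proof eventually_elim
    case (elim x)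
    have "0 < \<kappa> * x * ln x" using elim K \<delta> by (simp add: \<kappa>_def)
    then have "((\<kappa> * x * ln x) powr (1/3)) ^ 3 = \<kappa> * x * ln x"
      by (simp add: powr_powr flip: powr_numeral)
    moreover have "ln (x powr (\<delta>/2)) / 4 * (1/2) = \<delta> / 16 * ln x" using elim by (simp add: ln_powr)
    ultimately show ?case using elim by simp
  qed
qed

text \<open>The largest term is that of two links and a crossing edge, of order x^(6\<delta>)
  x^(2\<delta>-1/3). The bound \<delta> \<le> 1/100 keeps this exponent negative.\<close>

lemma asymptotic_crowding:
  fixes K \<delta> :: real
  assumes K: "K > 0" and \<delta>: "0 < \<delta>" "\<delta> \<le> 1/100"
  shows "((\<lambda>x. let y = 2 * x powr (-2/3 + \<delta>) in
      y + x * K * y ^ 2 + (x ^ 2 * K * y ^ 3 + (x ^ 2 * K * y ^ 3) ^ 2)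
       * (2 ^ 7 * K * (y + x * y ^ 2))) \<longlongrightarrow> 0) at_top"
  unfolding Let_def using K \<delta> by real_asymp

lemma asymptotic_failure:
  fixes \<kappa> \<delta> :: real
  assumes \<kappa>: "\<kappa> > 0" and \<delta>: "0 < \<delta>"
  shows "((\<lambda>x. x ^ 4 * (x powr \<delta>) powr (- ((\<kappa> * x * ln x) powr (1/3)) / 2)) \<longlongrightarrow> 0) at_top"
  using assms by real_asymp

section \<open>Counting Sidon sets\<close>

text \<open>The graph container argument of Kleitman and Winston: branching on a vertex of large degree
  shrinks the available set by a factor \<open>exp (- \<beta>)\<close> whenever the vertex is taken.\<close>

lemma kleitman_winston:
  fixes adj :: "'a \<Rightarrow> 'a \<Rightarrow> bool" and \<mu> \<beta> u :: real
  assumes \<mu>: "0 \<le> \<mu>" "\<mu> \<le> 1" and "finite U"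
    and "\<And>X. X \<subseteq> U \<Longrightarrow> u < card X \<Longrightarrow> \<exists>x\<in>X. \<beta> * card X \<le> card {y\<in>X. y \<noteq> x \<and> adj x y}"
    and "card U \<le> u * exp (\<beta> * real r)"
  shows "(\<Sum>I\<in>{I. I \<subseteq> U \<and> pairwise (\<lambda>x y. \<not> adj x y) I}. \<mu> ^ card I)
    \<le> (1 + real (card U)) ^ r * exp (\<mu> * u)"
  using assms(3-)
proof (induction U arbitrary: r rule: finite_psubset_induct)
  case (psubset U)
  let ?F = "\<lambda>U. {I. I \<subseteq> U \<and> pairwise (\<lambda>x y. \<not> adj x y) I}"
  show ?case
  proof (cases "real (card U) \<le> u")
    case True
    have "(\<Sum>I\<in>?F U. \<mu> ^ card I) \<le> (\<Sum>I\<in>Pow U. \<mu> ^ card I)"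
      using psubset.hyps \<mu> by (intro sum_mono2) auto
    also have "\<dots> = (1 + \<mu>) ^ card U"
      using sum_power_card_Pow[OF psubset.hyps, of \<mu>] by (simp add: add.commute)
    also have "\<dots> \<le> exp \<mu> ^ card U"
      using \<mu> exp_ge_add_one_self[of \<mu>] by (intro power_mono) auto
    also have "\<dots> = exp (\<mu> * card U)" by (simp add: mult.commute flip: exp_of_nat_mult)
    also have "\<dots> \<le> 1 * exp (\<mu> * u)" using True \<mu> by (simp add: mult_left_mono)
    also have "\<dots> \<le> (1 + real (card U)) ^ r * exp (\<mu> * u)"
      by (intro mult_right_mono one_le_power) auto
    finally show ?thesis .
  next
    case False
    \<comment> \<open>The parameter r counts the vertices that may still be taken before the
      available set falls to size u. With r = 0 it would already be that small.\<close>
    then have "r \<noteq> 0" using psubset.prems(2) by (intro notI) simp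
    then obtain r' where r: "r = Suc r'" using not0_implies_Suc by blast
    obtain x where x: "x \<in> U" "\<beta> * card U \<le> card {y\<in>U. y \<noteq> x \<and> adj x y}"
      using psubset.prems(1)[of U] False by auto
    define N where "N = {y\<in>U. y \<noteq> x \<and> adj x y}"
    define U1 U2 where "U1 = U - {x}" and "U2 = U - {x} - N"
    have sub: "U1 \<subset> U" "U2 \<subset> U" using x(1) by (auto simp: U1_def U2_def)
    have card_U: "1 \<le> card U" using x(1) psubset.hyps by (metis One_nat_def Suc_leI card_gt_0_iff empty_iff)
    have card_U1: "real (card U1) = real (card U) - 1"
      using x(1) card_U psubset.hyps by (simp add: U1_def of_nat_diff)
    have "card U2 \<le> card U1" using psubset.hyps by (intro card_mono) (auto simp: U1_def U2_def)
    then have card_U2: "1 + real (card U2) \<le> card U" using card_U1 by simp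
    have "card U2 \<le> card (U - N)" using psubset.hyps by (intro card_mono) (auto simp: U2_def)
    also have "\<dots> = card U - card N"
      using psubset.hyps by (intro card_Diff_subset) (auto simp: N_def)
    finally have "real (card U2) \<le> real (card U) - real (card N)"
      using card_mono[of U N] psubset.hyps by (auto simp: N_def)
    also have "\<dots> \<le> (1 - \<beta>) * card U" using x(2) by (simp add: N_def algebra_simps)
    also have "\<dots> \<le> exp (- \<beta>) * card U"
      using exp_ge_add_one_self[of "- \<beta>"] by (intro mult_right_mono) auto
    also have "\<dots> \<le> exp (- \<beta>) * (u * exp (\<beta> * real r))"
      using psubset.prems(2) by (intro mult_left_mono) auto
    also have "\<dots> = u * exp (\<beta> * real r')"
      by (simp add: r algebra_simps flip: exp_add)
    finally have U2_small: "real (card U2) \<le> u * exp (\<beta> * real r')" .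
    have IH1: "(\<Sum>I\<in>?F U1. \<mu> ^ card I) \<le> (1 + real (card U1)) ^ r * exp (\<mu> * u)"
    proof (rule psubset.IH[OF sub(1)])
      show "real (card U1) \<le> u * exp (\<beta> * real r)" using card_U1 psubset.prems(2) by simp
    qed (use sub psubset.prems(1) in auto)
    have IH2: "(\<Sum>I\<in>?F U2. \<mu> ^ card I) \<le> (1 + real (card U2)) ^ r' * exp (\<mu> * u)"
      using sub psubset.prems(1) U2_small by (intro psubset.IH) auto
    have finF: "finite (?F X)" if "X \<subseteq> U" for X
      by (rule finite_subset[of _ "Pow U"]) (use that psubset.hyps in auto)
    have "?F U \<subseteq> ?F U1 \<union> insert x ` ?F U2"
    proof
      fix I assume I: "I \<in> ?F U"
      show "I \<in> ?F U1 \<union> insert x ` ?F U2"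
      proof (cases "x \<in> I")
        case True
        then have "I - {x} \<in> ?F U2"
          using I by (auto simp: pairwise_def U2_def N_def)
        moreover have "I = insert x (I - {x})" using True by auto
        ultimately show ?thesis by blast
      next
        case False
        then show ?thesis using I by (auto simp: U1_def)
      qed
    qed
    then have "(\<Sum>I\<in>?F U. \<mu> ^ card I) \<le> (\<Sum>I\<in>?F U1 \<union> insert x ` ?F U2. \<mu> ^ card I)"
      using finF[of U1] finF[of U2] sub \<mu> by (intro sum_mono2) auto
    also have "\<dots> \<le> (\<Sum>I\<in>?F U1. \<mu> ^ card I) + (\<Sum>I\<in>insert x ` ?F U2. \<mu> ^ card I)"
      using finF[of U1] finF[of U2] sub \<mu> by (subst sum_Un) (auto intro!: sum_nonneg)
    also have "(\<Sum>I\<in>insert x ` ?F U2. \<mu> ^ card I) = \<mu> * (\<Sum>I\<in>?F U2. \<mu> ^ card I)"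
    proof -
      have out: "x \<notin> I" "finite I" if "I \<in> ?F U2" for I
        using that psubset.hyps sub(2) by (auto simp: U2_def intro: finite_subset)
      then have "inj_on (insert x) (?F U2)" by (intro inj_onI) (metis insert_ident)
      then show ?thesis
        using out by (simp add: sum.reindex sum_distrib_left)
    qed
    also have "\<dots> \<le> 1 * (\<Sum>I\<in>?F U2. \<mu> ^ card I)"
      using \<mu> by (intro mult_right_mono sum_nonneg) auto
    \<comment> \<open>Leaving out x keeps r, taking it spends one. Both remaining sets have at most
      |U| - 1 elements, so the branches contribute |U|^r and |U|^(r-1), which together stay below (1
      + |U|)^r.\<close>
    also have "(\<Sum>I\<in>?F U1. \<mu> ^ card I) + 1 * (\<Sum>I\<in>?F U2. \<mu> ^ card I)
        \<le> real (card U) ^ r * exp (\<mu> * u) + real (card U) ^ r' * exp (\<mu> * u)"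
    proof (intro add_mono)
      show "(\<Sum>I\<in>?F U1. \<mu> ^ card I) \<le> real (card U) ^ r * exp (\<mu> * u)"
        using IH1 card_U1 by simp
      have "(1 + real (card U2)) ^ r' \<le> real (card U) ^ r'"
        using card_U2 by (intro power_mono) auto
      then show "1 * (\<Sum>I\<in>?F U2. \<mu> ^ card I) \<le> real (card U) ^ r' * exp (\<mu> * u)"
        using IH2 by (simp add: order_trans[OF _ mult_right_mono])
    qed
    also have "\<dots> = (1 + real (card U)) * real (card U) ^ r' * exp (\<mu> * u)"
      by (simp add: r algebra_simps)
    also have "\<dots> \<le> (1 + real (card U)) * (1 + real (card U)) ^ r' * exp (\<mu> * u)"
      by (intro mult_right_mono mult_left_mono power_mono) auto
    finally show ?thesis by (simp add: r)
  qed
qed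

section \<open>The graph of forbidden extensions of a Sidon set\<close>

lemma sidonD:
  "sidon S \<Longrightarrow> a \<in> S \<Longrightarrow> b \<in> S \<Longrightarrow> c \<in> S \<Longrightarrow> e \<in> S \<Longrightarrow> a + b = c + e \<Longrightarrow> {a, b} = {c, e}"
  unfolding sidon_def by blast

lemma sidon_subset: "sidon S \<Longrightarrow> T \<subseteq> S \<Longrightarrow> sidon T"
  unfolding sidon_def by (meson subsetD)

text \<open>The t = |U| |S| sums x + a fall into at most M values, so by Cauchy-Schwarz at least t^2
  / M ordered pairs of them coincide. The trivial coincidences number t \<le> t^2 / (2 M). The
  others give distinct ordered pairs (x, y) of adjacent vertices, so the average degree is at least
  |S|^2 |U| / (2 M).\<close>

lemma sidon_extension_high_degree:
  fixes S U W :: "'a::ab_group_add set" and M :: real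
  assumes S: "sidon S" "finite S" and U: "finite U"
    and W: "finite W" "\<And>x a. x \<in> U \<Longrightarrow> a \<in> S \<Longrightarrow> x + a \<in> W" "card W \<le> M"
    and M: "0 < M" "2 * M \<le> real (card U) * real (card S)"
  shows "\<exists>x\<in>U. real (card S) ^ 2 / (2 * M) * card U
    \<le> card {y\<in>U. y \<noteq> x \<and> (\<exists>a\<in>S. \<exists>b\<in>S. x + a = y + b)}"
proof (rule ccontr)
  let ?deg = "\<lambda>x. card {y\<in>U. y \<noteq> x \<and> (\<exists>a\<in>S. \<exists>b\<in>S. x + a = y + b)}"
  define t where "t = real (card U) * real (card S)"
  define r where "r = (\<lambda>z. card {xa\<in>U \<times> S. fst xa + snd xa = z})"
  define Q where "Q = {(p, q). p \<in> U \<times> S \<and> q \<in> U \<times> S \<and> fst p + snd p = fst q + snd q}"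
  define D where "D = (SIGMA x:U. {y\<in>U. y \<noteq> x \<and> (\<exists>a\<in>S. \<exists>b\<in>S. x + a = y + b)})"
  assume "\<not> ?thesis"
  then have low: "real (?deg x) < real (card S) ^ 2 / (2 * M) * card U" if "x \<in> U" for x
    using that by (simp add: not_le)
  have t: "2 * M \<le> t" using M by (simp add: t_def)
  have "U \<noteq> {}" using M by auto
  have finP: "finite (U \<times> S)" using S U by simp
  have fiber_in_W: "fst xa + snd xa \<in> W" if "xa \<in> U \<times> S" for xa using W(2) that by auto
  have "(\<Sum>z\<in>W. r z) = card (U \<times> S)"
    unfolding r_def using finP W(1) fiber_in_W
    by (subst card_eq_sum, subst sum.group[symmetric, of _ W "\<lambda>xa. fst xa + snd xa"]) auto
  then have sum_r: "(\<Sum>z\<in>W. real (r z)) = t"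
    by (simp add: t_def card_cartesian_product flip: of_nat_sum)
  have "card Q = card (\<Union>z\<in>W. {xa\<in>U \<times> S. fst xa + snd xa = z} \<times> {xa\<in>U \<times> S. fst xa + snd xa = z})"
    using fiber_in_W by (intro arg_cong[where f = card]) (auto simp: Q_def)
  also have "\<dots> = (\<Sum>z\<in>W. card ({xa\<in>U \<times> S. fst xa + snd xa = z} \<times> {xa\<in>U \<times> S. fst xa + snd xa = z}))"
    using W(1) finP by (intro card_UN_disjoint) auto
  finally have card_Q: "real (card Q) = (\<Sum>z\<in>W. real (r z) ^ 2)"
    by (simp add: r_def card_cartesian_product power2_eq_square)
  have "t ^ 2 \<le> real (card W) * (\<Sum>z\<in>W. real (r z) ^ 2)"
    using sum_squared_le_sum_of_squares[of "\<lambda>z. real (r z)" W] W(1) by (simp add: sum_r mult.commute)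
  also have "\<dots> \<le> M * real (card Q)"
    unfolding card_Q using W(3) by (intro mult_right_mono sum_nonneg) auto
  finally have lower: "t ^ 2 \<le> M * real (card Q)" .
  have finD: "finite D" using U by (auto simp: D_def)
  let ?diag = "(\<lambda>p. (p, p)) ` (U \<times> S)"
  let ?off = "Q - ?diag"
  \<comment> \<open>Here x - y = b - a is nonzero, and a Sidon set represents a nonzero difference
    in at most one way, so x and y determine a and b.\<close>
  have "inj_on (\<lambda>(p, q). (fst p, fst q)) ?off"
  proof (rule inj_onI)
    fix v w assume v: "v \<in> ?off" and w: "w \<in> ?off"
      and eq: "(case v of (p, q) \<Rightarrow> (fst p, fst q)) = (case w of (p, q) \<Rightarrow> (fst p, fst q))"
    obtain x a y b where v': "v = ((x, a), (y, b))" by (metis prod.collapse)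
    then obtain a' b' where w': "w = ((x, a'), (y, b'))" using eq by (cases w) auto
    have mem: "a \<in> S" "b \<in> S" "a' \<in> S" "b' \<in> S" "x + a = y + b" "x + a' = y + b'"
      using v w v' w' by (auto simp: Q_def)
    have "x \<noteq> y" using v v' by (auto simp: Q_def)
    then have "a \<noteq> b" using mem by auto
    have "a + b' + (x + y) = (x + a) + (y + b')" by (simp add: algebra_simps)
    also have "\<dots> = (y + b) + (x + a')" by (simp only: mem)
    also have "\<dots> = a' + b + (x + y)" by (simp add: algebra_simps)
    finally have "a + b' = a' + b" by simp
    then have "{a, b'} = {a', b}" using sidonD[OF S(1)] mem by blast
    then have "a = a'" using \<open>a \<noteq> b\<close> by (auto simp: doubleton_eq_iff)
    then show "v = w" using mem v' w' by auto
  qed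
  moreover have "(\<lambda>(p, q). (fst p, fst q)) ` ?off \<subseteq> D"
    by (auto simp: Q_def D_def)
  ultimately have "card ?off \<le> card D" using finD card_inj_on_le by blast
  moreover have "card ?diag = card U * card S"
    by (subst card_image) (auto simp: inj_on_def card_cartesian_product)
  moreover have "card Q \<le> card ?diag + card ?off"
  proof -
    have "finite Q" by (rule finite_subset[of _ "(U \<times> S) \<times> (U \<times> S)"]) (use finP in \<open>auto simp: Q_def\<close>)
    then have "card Q \<le> card (?diag \<union> ?off)" using finP by (intro card_mono) auto
    also have "\<dots> \<le> card ?diag + card ?off" by (rule card_Un_le)
    finally show ?thesis .
  qed
  ultimately have "real (card Q) \<le> t + real (card D)"
    unfolding t_def by (simp flip: of_nat_mult of_nat_add)
  moreover have "real (card D) = (\<Sum>x\<in>U. real (?deg x))"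
    unfolding D_def using U by (subst card_SigmaI) auto
  moreover have "(\<Sum>x\<in>U. real (?deg x)) < (\<Sum>x\<in>U. real (card S) ^ 2 / (2 * M) * card U)"
    using U \<open>U \<noteq> {}\<close> low by (intro sum_strict_mono) auto
  moreover have "(\<Sum>x\<in>U. real (card S) ^ 2 / (2 * M) * card U) = t ^ 2 / (2 * M)"
    by (simp add: t_def power2_eq_square)
  ultimately have "real (card Q) < t + t ^ 2 / (2 * M)" by linarith
  then have "M * real (card Q) < M * (t + t ^ 2 / (2 * M))" using M by (intro mult_strict_left_mono)
  then have "t ^ 2 < M * t + t ^ 2 / 2" using lower M by (simp add: algebra_simps)
  moreover have "2 * M * t \<le> t * t" using t M by (intro mult_right_mono) auto
  ultimately show False by (simp add: power2_eq_square)
qed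

definition num_sidon :: "'a::ab_semigroup_add set \<Rightarrow> nat \<Rightarrow> nat" where
  "num_sidon V k = card {S. S \<subseteq> V \<and> sidon S \<and> card S = k}"

text \<open>Split a Sidon set of size 2 s into an arbitrary half S and the rest J. No two distinct
  x, y in J satisfy x + a = y + b with a, b in S, so J is independent in the graph of S.
  \<open>kleitman_winston\<close> with threshold u = 2 M / s bounds the weighted number of such
  J.\<close>

lemma num_sidon_double_le:
  fixes V W :: "'a::ab_group_add set" and M :: real
  assumes V: "finite V" and W: "finite W" "\<And>x y. x \<in> V \<Longrightarrow> y \<in> V \<Longrightarrow> x + y \<in> W" "card W \<le> M"
    and s: "0 < s" "real s ^ 2 \<le> 2 * M"
    and q: "card V \<le> 2 * M / s * exp (real s ^ 2 / (2 * M) * q)"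
  shows "real (num_sidon V (2 * s))
    \<le> real (num_sidon V s) * ((2 * M / real s ^ 2) ^ s * exp s * (1 + real (card V)) ^ q)"
proof -
  \<comment> \<open>This number serves both as weight per element and as degree density \<beta>.
    Then \<mu> u = s, and extracting the sets of size s costs \<mu>^(-s), the first factor of the
    claim.\<close>
  define \<mu> where "\<mu> = real s ^ 2 / (2 * M)"
  have M: "0 < M" using s by (smt (verit) of_nat_0_less_iff zero_less_power)
  have \<mu>: "0 < \<mu>" "\<mu> \<le> 1" using s M by (auto simp: \<mu>_def)
  define adj where "adj = (\<lambda>S (x::'a) y. \<exists>a\<in>S. \<exists>b\<in>S. x + a = y + b)"
  define F where "F = (\<lambda>S. {J. J \<subseteq> V - S \<and> card J = s \<and> pairwise (\<lambda>x y. \<not> adj S x y) J})"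
  define A where "A = {S. S \<subseteq> V \<and> sidon S \<and> card S = s}"
  define A2 where "A2 = {S. S \<subseteq> V \<and> sidon S \<and> card S = 2 * s}"
  have finA: "finite A" by (rule finite_subset[of _ "Pow V"]) (use V in \<open>auto simp: A_def\<close>)
  have finF: "finite (F S)" for S by (rule finite_subset[of _ "Pow V"]) (use V in \<open>auto simp: F_def\<close>)
  have card_F: "real (card (F S)) \<le> (2 * M / real s ^ 2) ^ s * exp s * (1 + real (card V)) ^ q"
    if S: "S \<in> A" for S
  proof -
    have S': "S \<subseteq> V" "sidon S" "card S = s" "finite S"
      using S V by (auto simp: A_def intro: finite_subset)
    have fin: "finite (V - S)" using V by simp
    have "real (card (F S)) * \<mu> ^ s = (\<Sum>I\<in>F S. \<mu> ^ card I)" by (simp add: F_def)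
    also have "\<dots> \<le> (\<Sum>I\<in>{I. I \<subseteq> V - S \<and> pairwise (\<lambda>x y. \<not> adj S x y) I}. \<mu> ^ card I)"
      using \<mu> V by (intro sum_mono2) (auto simp: F_def)
    also have "\<dots> \<le> (1 + real (card (V - S))) ^ q * exp (\<mu> * (2 * M / s))"
    proof (rule kleitman_winston[where \<beta> = \<mu>])
      fix X assume X: "X \<subseteq> V - S" "2 * M / s < card X"
      have "\<exists>x\<in>X. real (card S) ^ 2 / (2 * M) * card X
          \<le> card {y\<in>X. y \<noteq> x \<and> (\<exists>a\<in>S. \<exists>b\<in>S. x + a = y + b)}"
      proof (rule sidon_extension_high_degree[OF S'(2,4) _ W(1) _ W(3) M])
        show "finite X" using X V by (meson finite_Diff finite_subset)
        show "x + a \<in> W" if "x \<in> X" "a \<in> S" for x a using that X S' W(2) by blast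
        show "2 * M \<le> real (card X) * real (card S)" using X(2) s S' by (simp add: field_simps)
      qed
      then show "\<exists>x\<in>X. \<mu> * card X \<le> card {y\<in>X. y \<noteq> x \<and> adj S x y}"
        by (simp add: \<mu>_def adj_def S')
    next
      have "real (card (V - S)) \<le> real (card V)" using V by (simp add: card_mono)
      then show "real (card (V - S)) \<le> 2 * M / s * exp (\<mu> * real q)"
        using q by (simp add: \<mu>_def)
    qed (use \<mu> fin in auto)
    also have "\<dots> \<le> (1 + real (card V)) ^ q * exp s"
    proof (intro mult_mono power_mono)
      show "exp (\<mu> * (2 * M / s)) \<le> exp s" using s M by (simp add: \<mu>_def power2_eq_square)
    qed (use V in \<open>auto simp: card_mono\<close>)
    finally have "real (card (F S)) * \<mu> ^ s / \<mu> ^ s \<le> (1 + real (card V)) ^ q * exp s / \<mu> ^ s"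
      using \<mu> by (intro divide_right_mono) auto
    moreover have "(2 * M / real s ^ 2) ^ s = 1 / \<mu> ^ s"
      by (simp add: \<mu>_def power_divide)
    ultimately show ?thesis using \<mu> by (simp add: mult_ac)
  qed
  define pick where "pick = (\<lambda>S :: 'a set. SOME T. T \<subseteq> S \<and> card T = s)"
  have pick: "pick S \<subseteq> S" "card (pick S) = s" if "S \<in> A2" for S
  proof -
    have "\<exists>T. T \<subseteq> S \<and> card T = s"
      using that obtain_subset_with_card_n[of s S] by (auto simp: A2_def)
    then have "pick S \<subseteq> S \<and> card (pick S) = s" unfolding pick_def by (rule someI_ex)
    then show "pick S \<subseteq> S" "card (pick S) = s" by auto
  qed
  have "inj_on (\<lambda>S. (pick S, S - pick S)) A2"
    by (rule inj_onI) (metis Pair_inject Un_Diff_cancel Un_absorb1 pick(1))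
  moreover have "(\<lambda>S. (pick S, S - pick S)) ` A2 \<subseteq> Sigma A F"
  proof (intro image_subsetI SigmaI)
    fix S assume S: "S \<in> A2"
    then have S': "S \<subseteq> V" "sidon S" "card S = 2 * s" "finite S"
      using V by (auto simp: A2_def intro: finite_subset)
    show "pick S \<in> A" using pick[OF S] S' by (auto simp: A_def intro: sidon_subset)
    have "\<not> adj (pick S) x y" if xy: "x \<in> S - pick S" "y \<in> S - pick S" "x \<noteq> y" for x y
    proof
      assume "adj (pick S) x y"
      then obtain a b where ab: "a \<in> pick S" "b \<in> pick S" "x + a = y + b" by (auto simp: adj_def)
      then have "{x, a} = {y, b}" using sidonD[OF S'(2)] xy pick(1)[OF S] by blast
      then show False using xy ab by (auto simp: doubleton_eq_iff)
    qed
    moreover have "card (S - pick S) = s"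
      using pick[OF S] S' finite_subset[OF pick(1)[OF S] S'(4)] by (simp add: card_Diff_subset)
    ultimately show "S - pick S \<in> F (pick S)"
      using S' by (auto simp: F_def pairwise_def)
  qed
  ultimately have "card A2 \<le> card (Sigma A F)"
    using finA finF by (intro card_inj_on_le) auto
  also have "\<dots> = (\<Sum>S\<in>A. card (F S))" using finA finF by (intro card_SigmaI) auto
  finally have "real (card A2) \<le> (\<Sum>S\<in>A. real (card (F S)))" by (simp flip: of_nat_sum)
  also have "\<dots> \<le> (\<Sum>S\<in>A. (2 * M / real s ^ 2) ^ s * exp s * (1 + real (card V)) ^ q)"
    by (intro sum_mono card_F)
  finally show ?thesis by (simp add: num_sidon_def A_def A2_def)
qed

section \<open>Iterating the doubling step\<close>

lemma ln_le_two_sqrt: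
  fixes y :: real
  assumes "0 < y"
  shows "ln y \<le> 2 * sqrt y"
  using ln_le_minus_one[of "sqrt y"] assms by (simp add: ln_sqrt)

text \<open>The first factors, together with l^s, are at most (D B / s)^(2 s), and ln y \<le> 2 sqrt
  y turns this into exp(4 sqrt(D B s)). The exponent q of the container factor is of order N ln N /
  s^2, which N ln N \<le> s0^3 \<le> s0^2 s reduces to order s0^2 / s.\<close>

lemma doubling_factor_le:
  fixes C D B l :: real and N s s0 :: nat
  assumes C: "1 \<le> C" and N: "3 \<le> N" and s0: "0 < s0" "N * ln N \<le> real s0 ^ 3"
    and s: "s0 \<le> s" "real s ^ 2 \<le> N" and l: "0 \<le> l" and DB: "0 < D" "0 < B"
    and main: "2 * C * N * l * exp 1 \<le> (D * B) ^ 2"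
  defines "q \<equiv> nat \<lceil>ln N * (2 * (C * N)) / real s ^ 2\<rceil>"
  shows "((2 * (C * N) / real s ^ 2) ^ s * exp s * (1 + real N) ^ q) * l ^ s
    \<le> exp (4 * sqrt (D * B * s) + 6 * C * real s0 ^ 2 * ln N / s)"
proof -
  have s_pos: "0 < real s" using s s0 by simp
  have lnN: "1 \<le> ln N"
    using N exp_le by (subst ln_ge_iff) auto
  have "(2 * (C * N) / real s ^ 2) ^ s * exp s * l ^ s = (2 * (C * N) / real s ^ 2 * exp 1 * l) ^ s"
    by (simp add: power_mult_distrib power_divide flip: exp_of_nat_mult)
  also have "2 * (C * N) / real s ^ 2 * exp 1 * l = 2 * C * N * l * exp 1 / real s ^ 2"
    by simp
  also have "(\<dots>) ^ s \<le> ((D * B / s) ^ 2) ^ s"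
    using C l main by (intro power_mono) (auto simp: power_divide divide_right_mono)
  also have "\<dots> = exp (ln (D * B / s)) ^ (2 * s)"
    using s_pos DB by (simp flip: power_mult)
  also have "\<dots> = exp (2 * (s * ln (D * B / s)))"
    by (simp flip: exp_of_nat_mult)
  also have "\<dots> \<le> exp (4 * sqrt (D * B * s))"
  proof -
    have "s * ln (D * B / s) \<le> s * (2 * sqrt (D * B / s))"
      using s_pos DB by (intro mult_left_mono ln_le_two_sqrt) auto
    also have "\<dots> = 2 * sqrt (D * B * s)"
      using s_pos by (simp add: real_sqrt_divide real_sqrt_mult field_simps)
    finally show ?thesis by simp
  qed
  finally have first: "(2 * (C * N) / real s ^ 2) ^ s * exp s * l ^ s \<le> exp (4 * sqrt (D * B * s))" .
  have "real q \<le> ln N * (2 * (C * N)) / real s ^ 2 + 1"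
  proof -
    have "0 \<le> ln N * (2 * (C * N)) / real s ^ 2" using lnN C by simp
    then show ?thesis unfolding q_def by linarith
  qed
  \<comment> \<open>The 1 from rounding q up is absorbed here, thanks to s^2 \<le> N; the constant 2
    becomes 3.\<close>
  also have "1 \<le> C * (N * ln N) / real s ^ 2"
  proof -
    have "real s ^ 2 * 1 \<le> N * (C * ln N)"
      using s C lnN mult_mono[of 1 C 1 "ln N"] by (intro mult_mono) auto
    then show ?thesis using s_pos by (simp add: field_simps)
  qed
  also have "ln N * (2 * (C * N)) / real s ^ 2 + C * (N * ln N) / real s ^ 2
      = 3 * C * (N * ln N) / real s ^ 2" by (simp add: field_simps)
  also have "\<dots> \<le> 3 * C * (real s0 ^ 2 * s) / real s ^ 2"
  proof -
    have "real s0 ^ 3 \<le> real s0 ^ 2 * s" using s by (simp add: power3_eq_cube power2_eq_square mult_left_mono)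
    then have "N * ln N \<le> real s0 ^ 2 * s" using s0 by linarith
    then show ?thesis using C by (intro divide_right_mono mult_left_mono) auto
  qed
  also have "\<dots> = 3 * C * real s0 ^ 2 / s" using s_pos by (simp add: power2_eq_square)
  finally have q: "real q \<le> 3 * C * real s0 ^ 2 / s" by simp
  have "real N * 3 \<le> real N * real N" using N by (intro mult_left_mono) auto
  moreover have "3 \<le> real N" using N by simp
  ultimately have "1 + real N \<le> real N ^ 2" unfolding power2_eq_square by linarith
  then have "(1 + real N) ^ q \<le> (real N ^ 2) ^ q" by (intro power_mono) auto
  also have "\<dots> = exp (ln N) ^ (2 * q)" using N by (simp flip: power_mult)
  also have "\<dots> = exp (2 * ln N * q)" by (simp add: mult_ac flip: exp_of_nat_mult)
  also have "\<dots> \<le> exp (2 * ln N * (3 * C * real s0 ^ 2 / s))"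
    using q lnN by (simp add: mult_left_mono del: times_divide_eq_right)
  also have "\<dots> = exp (6 * C * real s0 ^ 2 * ln N / s)" by (simp add: mult_ac)
  finally have second: "(1 + real N) ^ q \<le> exp (6 * C * real s0 ^ 2 * ln N / s)" .
  have "((2 * (C * N) / real s ^ 2) ^ s * exp s * (1 + real N) ^ q) * l ^ s
      = ((2 * (C * N) / real s ^ 2) ^ s * exp s * l ^ s) * (1 + real N) ^ q" by simp
  also have "\<dots> \<le> exp (4 * sqrt (D * B * s)) * exp (6 * C * real s0 ^ 2 * ln N / s)"
    by (intro mult_mono first second) auto
  finally show ?thesis by (simp flip: exp_add)
qed

lemma num_sidon_le_power:
  assumes "finite V"
  shows "num_sidon V k \<le> card V ^ k"
proof -
  have "num_sidon V k \<le> card {S. S \<subseteq> V \<and> card S = k}"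
    unfolding num_sidon_def by (rule card_mono) (use assms in auto)
  also have "\<dots> = card V choose k" using assms by (simp add: n_subsets)
  also have "\<dots> \<le> card V ^ k"
    by (cases "k \<le> card V") (auto intro: binomial_le_pow simp: binomial_eq_0)
  finally show ?thesis .
qed

text \<open>The exponent is a potential: its growth from \<open>s\<close> to \<open>2 * s\<close> pays for the factor
  bounded in \<open>doubling_factor_le\<close>.\<close>

lemma num_sidon_dyadic_le:
  fixes V W :: "'a::ab_group_add set" and C D B l :: real and s0 i :: nat
  defines "N \<equiv> card V"
  assumes V: "finite V" and W: "finite W" "\<And>x y. x \<in> V \<Longrightarrow> y \<in> V \<Longrightarrow> x + y \<in> W" "card W \<le> C * N"
    and C: "1 \<le> C" and N: "3 \<le> N" and s0: "0 < s0" "N * ln N \<le> real s0 ^ 3"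
    and l: "0 \<le> l" "l \<le> 1" and DB: "0 < D" "0 < B"
    and main: "2 * C * N * l * exp 1 \<le> (D * B) ^ 2"
    and small: "real (2 ^ i * s0) ^ 2 \<le> N"
  shows "real (num_sidon V (2 ^ i * s0)) * l ^ (2 ^ i * s0)
    \<le> exp ((1 + 12 * C) * (s0 * ln N) + 10 * sqrt (D * B * real (2 ^ i * s0))
        - 12 * C * real s0 ^ 2 * ln N / real (2 ^ i * s0))"
  using small
proof (induction i)
  case 0
  have lnN: "0 \<le> ln N" using N by simp
  have "real (num_sidon V s0) * l ^ s0 \<le> real (N ^ s0) * 1"
    using num_sidon_le_power[OF V, of s0] l unfolding N_def
    by (intro mult_mono power_le_one) (auto simp only: of_nat_le_iff of_nat_0_le_iff zero_le_power)
  also have "\<dots> = exp (ln N) ^ s0" using N by simp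
  also have "\<dots> = exp (s0 * ln N)" by (simp flip: exp_of_nat_mult)
  \<comment> \<open>At s = s0 the negative term cancels the summand 12 C s0 ln N, so the trivial
    bound N^s0 fits.\<close>
  also have "\<dots> \<le> exp ((1 + 12 * C) * (s0 * ln N) + 10 * sqrt (D * B * s0) - 12 * C * real s0 ^ 2 * ln N / s0)"
    using s0 DB by (simp add: power2_eq_square algebra_simps)
  finally show ?case by simp
next
  case (Suc i)
  define s where "s = 2 ^ i * s0"
  have s: "s0 \<le> s" "0 < s" "2 ^ Suc i * s0 = 2 * s" using s0 by (auto simp: s_def)
  have sN: "real s ^ 2 \<le> N"
  proof -
    have "real s ^ 2 \<le> real (2 * s) ^ 2" by (intro power_mono) auto
    then show ?thesis using Suc.prems unfolding s(3) by linarith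
  qed
  \<comment> \<open>After q shrinkings by exp(- s^2 / (2 C N)) a factor N is gained. Because 2 C N /
    s \<ge> 1, this is enough to reach the threshold.\<close>
  define q where "q = nat \<lceil>ln N * (2 * (C * N)) / real s ^ 2\<rceil>"
  have CN: "real N \<le> C * N" using C mult_right_mono[of 1 C "real N"] by simp
  have "real (num_sidon V (2 * s))
      \<le> real (num_sidon V s) * ((2 * (C * N) / real s ^ 2) ^ s * exp s * (1 + real (card V)) ^ q)"
  proof (rule num_sidon_double_le[OF V W s(2)])
    show "real s ^ 2 \<le> 2 * (C * N)" using sN CN by linarith
    have "real s * 1 \<le> real s * real s" using s by (intro mult_left_mono) auto
    then have "real s \<le> 2 * (C * N)" using sN CN by (simp add: power2_eq_square)
    then have "1 \<le> 2 * (C * N) / s" using s by simp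
    moreover have "ln N \<le> real s ^ 2 / (2 * (C * N)) * q"
    proof -
      have "ln N * (2 * (C * N)) / real s ^ 2 \<le> q" unfolding q_def by linarith
      then show ?thesis using s C N by (simp add: field_simps)
    qed
    then have "exp (ln N) \<le> exp (real s ^ 2 / (2 * (C * N)) * q)" by simp
    ultimately have "1 * exp (ln N) \<le> 2 * (C * N) / s * exp (real s ^ 2 / (2 * (C * N)) * q)"
      by (intro mult_mono) auto
    then show "real (card V) \<le> 2 * (C * N) / s * exp (real s ^ 2 / (2 * (C * N)) * q)"
      using N by (simp add: N_def)
  qed
  then have "real (num_sidon V (2 * s)) * l ^ (2 * s)
      \<le> real (num_sidon V s) * ((2 * (C * N) / real s ^ 2) ^ s * exp s * (1 + real N) ^ q) * l ^ (2 * s)"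
    unfolding N_def using l by (intro mult_right_mono) auto
  also have "\<dots> = (real (num_sidon V s) * l ^ s)
      * (((2 * (C * N) / real s ^ 2) ^ s * exp s * (1 + real N) ^ q) * l ^ s)"
    unfolding mult_2[of s] power_add by (simp only: mult_ac)
  also have "\<dots> \<le> exp ((1 + 12 * C) * (s0 * ln N) + 10 * sqrt (D * B * s) - 12 * C * real s0 ^ 2 * ln N / s)
      * exp (4 * sqrt (D * B * s) + 6 * C * real s0 ^ 2 * ln N / s)"
  proof (intro mult_mono)
    show "real (num_sidon V s) * l ^ s
        \<le> exp ((1 + 12 * C) * (s0 * ln N) + 10 * sqrt (D * B * s) - 12 * C * real s0 ^ 2 * ln N / s)"
      using Suc.IH sN by (simp add: s_def)
    show "((2 * (C * N) / real s ^ 2) ^ s * exp s * (1 + real N) ^ q) * l ^ s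
        \<le> exp (4 * sqrt (D * B * s) + 6 * C * real s0 ^ 2 * ln N / s)"
      unfolding q_def by (rule doubling_factor_le[OF C N s0 s(1) sN l(1) DB main])
  qed (use l C in auto)
  also have "\<dots> = exp ((1 + 12 * C) * (s0 * ln N) + 14 * sqrt (D * B * s) - 6 * C * real s0 ^ 2 * ln N / s)"
    by (simp add: algebra_simps flip: exp_add)
  also have "\<dots> \<le> exp ((1 + 12 * C) * (s0 * ln N) + 10 * sqrt (D * B * real (2 * s))
      - 12 * C * real s0 ^ 2 * ln N / real (2 * s))"
  proof -
    \<comment> \<open>The square root terms add up to 10 + 4 = 14 \<le> 10 sqrt 2, their coefficient
      after doubling s. The terms in 1/s combine to -12 + 6 = -6, which is -12 with s replaced by 2
      s.\<close>
    have "7 / 5 \<le> sqrt (2 :: real)" by (rule real_le_rsqrt) (simp add: power2_eq_square)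
    then have "7 / 5 * sqrt (D * B * s) \<le> sqrt 2 * sqrt (D * B * s)"
      using DB by (intro mult_right_mono) auto
    also have "\<dots> = sqrt (D * B * real (2 * s))" by (simp add: real_sqrt_mult)
    finally show ?thesis by (simp add: algebra_simps)
  qed
  finally show ?case by (simp only: s(3))
qed

section \<open>From counting to probability\<close>

lemma max_sidon_attained:
  assumes "finite A"
  shows "\<exists>S\<subseteq>A. sidon S \<and> card S = max_sidon A"
proof -
  have "sidon ({} :: 'a set)" by (simp add: sidon_def)
  then have "card ` {S. S \<subseteq> A \<and> sidon S} \<noteq> {}" by blast
  then have "max_sidon A \<in> card ` {S. S \<subseteq> A \<and> sidon S}"
    unfolding max_sidon_def using assms by (intro Max_in) auto
  then show ?thesis by auto
qed

lemma card_le_max_sidon: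
  assumes "finite A" "S \<subseteq> A" "sidon S"
  shows "card S \<le> max_sidon A"
  unfolding max_sidon_def using assms by (intro Max_ge) auto

lemma prob_max_sidon_ge_le:
  assumes V: "finite V" and p: "0 \<le> p" "p \<le> 1"
  shows "measure_pmf.prob (random_subset V p) {A. s \<le> max_sidon A} \<le> real (num_sidon V s) * p ^ s"
proof -
  let ?M = "random_subset V p"
  let ?S = "{S. S \<subseteq> V \<and> sidon S \<and> card S = s}"
  have fin: "finite ?S" using V by simp
  have "measure_pmf.prob ?M {A. s \<le> max_sidon A} = measure_pmf.prob ?M ({A. s \<le> max_sidon A} \<inter> set_pmf ?M)"
    by (simp add: measure_Int_set_pmf)
  also have "\<dots> \<le> measure_pmf.prob ?M (\<Union>S\<in>?S. {A. S \<subseteq> A})"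
  proof (rule measure_pmf.finite_measure_mono)
    show "{A. s \<le> max_sidon A} \<inter> set_pmf ?M \<subseteq> (\<Union>S\<in>?S. {A. S \<subseteq> A})"
    proof
      fix A assume "A \<in> {A. s \<le> max_sidon A} \<inter> set_pmf ?M"
      then have A: "s \<le> max_sidon A" "A \<subseteq> V" using set_pmf_random_subset[OF V] by auto
      then obtain S where S: "S \<subseteq> A" "sidon S" "card S = max_sidon A"
        using max_sidon_attained[of A] finite_subset[OF A(2) V] by auto
      then obtain T where "T \<subseteq> S" "card T = s" using A obtain_subset_with_card_n[of s S] by metis
      then show "A \<in> (\<Union>S\<in>?S. {A. S \<subseteq> A})"
        using S A by (intro UN_I[of T]) (auto intro: sidon_subset)
    qed
  qed simp
  also have "\<dots> \<le> (\<Sum>S\<in>?S. measure_pmf.prob ?M {A. S \<subseteq> A})"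
    using fin by (intro measure_pmf.finite_measure_subadditive_finite) auto
  also have "\<dots> = (\<Sum>S\<in>?S. p ^ s)"
    by (intro sum.cong refl) (auto simp: prob_random_subset_superset[OF V p])
  finally show ?thesis by (simp add: num_sidon_def)
qed

text \<open>A first moment bound at one dyadic size s between a/2 and a. The count is taken with
  weight l = e P instead of P; the spare factor exp(-s) then beats the square root term and leaves
  decay in a.\<close>

lemma prob_max_sidon_gt_le:
  fixes V W :: "'a::ab_group_add set" and C D B p P a :: real and s0 :: nat
  defines "N \<equiv> card V"
  assumes V: "finite V" and W: "finite W" "\<And>x y. x \<in> V \<Longrightarrow> y \<in> V \<Longrightarrow> x + y \<in> W" "card W \<le> C * N"
    and C: "1 \<le> C" and N: "3 \<le> N" and s0: "0 < s0" "N * ln N \<le> real s0 ^ 3"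
    and p: "0 \<le> p" "p \<le> P" and P: "exp 1 * P \<le> 1" and DB: "0 < D" "0 < B"
    and main: "2 * C * N * (exp 1 * P) * exp 1 \<le> (D * B) ^ 2"
    and a: "s0 \<le> a" "a ^ 2 \<le> N"
  shows "measure_pmf.prob (random_subset V p) {A. a < max_sidon A}
    \<le> exp ((1 + 12 * C) * (s0 * ln N) + 50 * D * B - a / 4)"
proof -
  \<comment> \<open>The set of candidates is nonempty because s0 \<le> a, and maximality gives 2^i
    s0 > a / 2.\<close>
  define i where "i = Max {i. real (2 ^ i * s0) \<le> a}"
  have fin: "finite {i. real (2 ^ i * s0) \<le> a}"
  proof (rule finite_subset)
    show "{i. real (2 ^ i * s0) \<le> a} \<subseteq> {..nat \<lceil>a\<rceil>}"
    proof
      fix j assume "j \<in> {i. real (2 ^ i * s0) \<le> a}"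
      then have "real (2 ^ j * s0) \<le> a" by simp
      moreover have "j < 2 ^ j" by simp
      then have "j \<le> 2 ^ j * s0" using s0 by (metis less_imp_le mult.right_neutral mult_le_mono Suc_leI One_nat_def)
      then have "real j \<le> real (2 ^ j * s0)" by (simp only: of_nat_le_iff)
      ultimately show "j \<in> {..nat \<lceil>a\<rceil>}" by simp linarith
    qed
  qed simp
  have "i \<in> {i. real (2 ^ i * s0) \<le> a}"
    unfolding i_def using fin a by (intro Max_in) (auto intro!: exI[of _ 0])
  then have i: "real (2 ^ i * s0) \<le> a" by simp
  have "Suc i \<notin> {i. real (2 ^ i * s0) \<le> a}"
    using Max_ge[OF fin, of "Suc i"] by (auto simp: i_def)
  then have i': "a < 2 * real (2 ^ i * s0)" by simp
  define s where "s = 2 ^ i * s0"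
  have P0: "0 \<le> P" using p by simp
  have "P \<le> exp 1 * P" using P0 mult_right_mono[of 1 "exp 1" P] by simp
  then have p1: "p \<le> 1" using p P by linarith
  have "measure_pmf.prob (random_subset V p) {A. a < max_sidon A}
      \<le> measure_pmf.prob (random_subset V p) {A. s \<le> max_sidon A}"
  proof (intro measure_pmf.finite_measure_mono Collect_mono impI)
    fix A :: "'a set" assume "a < max_sidon A"
    then have "real s \<le> max_sidon A" using i by (simp add: s_def)
    then show "s \<le> max_sidon A" by simp
  qed simp
  also have "\<dots> \<le> real (num_sidon V s) * p ^ s"
    using p p1 by (intro prob_max_sidon_ge_le V) auto
  also have "\<dots> \<le> real (num_sidon V s) * P ^ s"
    using p by (intro mult_left_mono power_mono) auto
  also have "\<dots> = exp (- real s) * (real (num_sidon V s) * (exp 1 * P) ^ s)"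
    by (simp add: power_mult_distrib exp_minus flip: exp_of_nat_mult)
  also have "\<dots> \<le> exp (- real s) * exp ((1 + 12 * C) * (s0 * ln N) + 10 * sqrt (D * B * real s)
        - 12 * C * real s0 ^ 2 * ln N / real s)"
  proof (intro mult_left_mono)
    have "real (2 ^ i * s0) ^ 2 \<le> a ^ 2" using i by (intro power_mono) auto
    then have "real (2 ^ i * s0) ^ 2 \<le> N" using a by linarith
    then show "real (num_sidon V s) * (exp 1 * P) ^ s
      \<le> exp ((1 + 12 * C) * (s0 * ln N) + 10 * sqrt (D * B * real s) - 12 * C * real s0 ^ 2 * ln N / real s)"
      unfolding s_def N_def
      using num_sidon_dyadic_le[OF V W(1) W(2) W(3)[unfolded N_def] C N[unfolded N_def] s0(1)
          s0(2)[unfolded N_def] _ P DB main[unfolded N_def]] P0 by simp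
  qed simp
  also have "\<dots> \<le> exp ((1 + 12 * C) * (s0 * ln N) + 50 * D * B - a / 4)"
  proof -
    have "0 \<le> 12 * C * real s0 ^ 2 * ln N / real s" using C N by simp
    \<comment> \<open>The inequality of arithmetic and geometric means gives up half of exp(-s); the
      other half yields the final -a/4.\<close>
    moreover have "10 * sqrt (D * B * real s) \<le> s / 2 + 50 * D * B"
    proof -
      have "2 * sqrt (100 * D * B) * sqrt s \<le> 100 * D * B + s"
        using sum_squares_bound[of "sqrt (100 * D * B)" "sqrt s"] DB by simp
      then show ?thesis by (simp add: real_sqrt_mult)
    qed
    ultimately show ?thesis using i' by (simp add: s_def flip: exp_add)
  qed
  finally show ?thesis .
qed

section \<open>The hypergraph of additive coincidences\<close>

definition min_nonsidon :: "'a::ab_semigroup_add set \<Rightarrow> 'a set set" where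
  "min_nonsidon V = {f. f \<subseteq> V \<and> \<not> sidon f \<and> (\<forall>g. g \<subset> f \<longrightarrow> sidon g)}"

lemma min_nonsidon_witness:
  assumes "f \<in> min_nonsidon V"
  obtains a b c e where "f = {a, b, c, e}" "a + b = c + e" "{a, b} \<noteq> {c, e}"
proof -
  have f: "\<not> sidon f" "\<And>g. g \<subset> f \<Longrightarrow> sidon g" using assms by (auto simp: min_nonsidon_def)
  obtain a b c e where w: "a \<in> f" "b \<in> f" "c \<in> f" "e \<in> f" "a + b = c + e" "{a, b} \<noteq> {c, e}"
    using f(1) unfolding sidon_def by blast
  have "\<not> sidon {a, b, c, e}"
  proof
    assume "sidon {a, b, c, e}"
    then have "{a, b} = {c, e}" by (rule sidonD) (use w in auto)
    then show False using w by simp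
  qed
  then have "f = {a, b, c, e}" using f(2)[of "{a, b, c, e}"] w by blast
  then show ?thesis using that w by blast
qed

lemma ex_min_nonsidon:
  assumes "finite S" "S \<subseteq> V" "\<not> sidon S"
  shows "\<exists>f\<in>min_nonsidon V. f \<subseteq> S"
  using assms
proof (induction S rule: finite_psubset_induct)
  case (psubset S)
  show ?case
  proof (cases "\<forall>g. g \<subset> S \<longrightarrow> sidon g")
    case True
    then have "S \<in> min_nonsidon V" using psubset.prems by (simp add: min_nonsidon_def)
    then show ?thesis by blast
  next
    case False
    then obtain g where g: "g \<subset> S" "\<not> sidon g" by blast
    then have "\<exists>f\<in>min_nonsidon V. f \<subseteq> g" using psubset.prems by (intro psubset.IH) auto
    then show ?thesis using g by blast
  qed
qed

text \<open>A common element of the two sides could be cancelled, making the sides equal as sets. So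
  a nontrivial coincidence has disjoint sides.\<close>

lemma sidon_pair_distinct:
  fixes a b c e :: "'a::ab_group_add"
  assumes "a + b = c + e" "{a, b} \<noteq> {c, e}"
  shows "a \<noteq> c" "a \<noteq> e" "b \<noteq> c" "b \<noteq> e"
proof -
  have "a = c \<longleftrightarrow> b = e" using assms(1) by (metis add_left_cancel add_right_cancel)
  moreover have "a = e \<longleftrightarrow> b = c"
    using assms(1) by (metis add.commute add_left_cancel)
  ultimately show "a \<noteq> c" "a \<noteq> e" "b \<noteq> c" "b \<noteq> e" using assms(2) by (auto simp: insert_commute)
qed

text \<open>Elements can only repeat within a side. If both sides were doubled, a + a = c + c would
  force a = c. Edges of size 3 are the three-term progressions a + a = c + e.\<close>

lemma card_min_nonsidon:
  fixes V :: "'a::ab_group_add set"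
  assumes no_2_torsion: "\<And>x y :: 'a. x + x = y + y \<Longrightarrow> x = y" and f: "f \<in> min_nonsidon V"
  shows "card f = 3 \<or> card f = 4"
proof -
  obtain a b c e where w: "f = {a, b, c, e}" "a + b = c + e" "{a, b} \<noteq> {c, e}"
    using min_nonsidon_witness[OF f] by blast
  note ne = sidon_pair_distinct[OF w(2,3)]
  have "\<not> (a = b \<and> c = e)" using w(2) no_2_torsion[of a c] ne by auto
  then show ?thesis using ne by (auto simp: w(1) card_insert_if)
qed

text \<open>The new point occurs once in the additive coincidence, or twice on the same side of it.\<close>

lemma card_min_nonsidon_extensions:
  fixes V :: "'a::ab_group_add set"
  assumes no_2_torsion: "\<And>x y :: 'a. x + x = y + y \<Longrightarrow> x = y" and g: "finite g" "card g \<le> 3"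
  shows "card {x. x \<notin> g \<and> insert x g \<in> min_nonsidon V} \<le> 36"
proof -
  define A where "A = (\<lambda>(c, e, b). c + e - b) ` (g \<times> g \<times> g)"
  define B where "B = (\<lambda>(c, e). THE x. x + x = c + e) ` (g \<times> g)"
  have "{x. x \<notin> g \<and> insert x g \<in> min_nonsidon V} \<subseteq> A \<union> B"
  proof
    fix x assume "x \<in> {x. x \<notin> g \<and> insert x g \<in> min_nonsidon V}"
    then have x: "x \<notin> g" "insert x g \<in> min_nonsidon V" by auto
    obtain a b c e where w: "insert x g = {a, b, c, e}" "a + b = c + e" "{a, b} \<noteq> {c, e}"
      using min_nonsidon_witness[OF x(2)] by blast
    have one_side: "x \<in> A \<union> B"
      if eq: "insert x g = {x, b, c, e}" "x + b = c + e" "{x, b} \<noteq> {c, e}" for b c e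
    proof -
      note ne = sidon_pair_distinct[OF eq(2,3)]
      have mem: "c \<in> g" "e \<in> g" "b = x \<or> b \<in> g" using eq(1) ne by auto
      show ?thesis
      proof (cases "b = x")
        case True
        have "(THE x. x + x = c + e) = x"
        proof (rule the_equality)
          show "x + x = c + e" using eq(2) True by simp
          then show "y = x" if "y + y = c + e" for y
            using that no_2_torsion[of y x] by simp
        qed
        then have "x \<in> B" unfolding B_def using mem by force
        then show ?thesis by simp
      next
        case False
        have "x = c + e - b" using eq(2) by (simp add: algebra_simps)
        then have "x \<in> A" unfolding A_def using mem False by force
        then show ?thesis by simp
      qed
    qed
    have "x = a \<or> x = b \<or> x = c \<or> x = e" using w(1) by auto
    then show "x \<in> A \<union> B"
    proof (elim disjE)
      assume "x = a" then show ?thesis using one_side[of b c e] w by simp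
    next
      assume "x = b" then show ?thesis
        using one_side[of a c e] w by (simp add: insert_commute add.commute)
    next
      assume "x = c" then show ?thesis
        using one_side[of e a b] w by (metis insert_commute)
    next
      assume "x = e" then show ?thesis
        using one_side[of c a b] w by (metis insert_commute add.commute)
    qed
  qed
  moreover have finAB: "finite A" "finite B" using g by (auto simp: A_def B_def)
  ultimately have "card {x. x \<notin> g \<and> insert x g \<in> min_nonsidon V} \<le> card (A \<union> B)"
    by (intro card_mono) auto
  \<comment> \<open>At most 3^3 values c + e - b and at most 3^2 halves of c + e: 27 + 9 =
    36.\<close>
  also have "\<dots> \<le> card A + card B" by (rule card_Un_le)
  also have "card A \<le> card (g \<times> g \<times> g)" unfolding A_def using g by (intro card_image_le) auto
  also have "\<dots> \<le> 3 * (3 * 3)" unfolding card_cartesian_product using g by (intro mult_le_mono) auto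
  also have "card B \<le> card (g \<times> g)" unfolding B_def using g by (intro card_image_le) auto
  also have "\<dots> \<le> 3 * 3" unfolding card_cartesian_product using g by (intro mult_le_mono) auto
  finally show ?thesis by simp
qed

lemma sparse_hypergraph_min_nonsidon:
  fixes V :: "'a::ab_group_add set"
  assumes no_2_torsion: "\<And>x y :: 'a. x + x = y + y \<Longrightarrow> x = y" and V: "finite V"
  shows "sparse_hypergraph V (min_nonsidon V) 36"
proof
  fix e f assume "e \<in> min_nonsidon V" "f \<in> min_nonsidon V" "e \<subseteq> f"
  then show "e = f" unfolding min_nonsidon_def psubset_eq by blast
next
  fix g assume g: "g \<subseteq> V" "card g = 2 \<or> card g = 3"
  then have fin: "finite g" using finite_subset[OF _ V] by simp
  have ext: "insert x g \<in> min_nonsidon V \<Longrightarrow> x \<in> V" for x by (auto simp: min_nonsidon_def)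
  have eq: "{x \<in> V - g. insert x g \<in> min_nonsidon V} = {x. x \<notin> g \<and> insert x g \<in> min_nonsidon V}"
    using ext by auto
  show "card {x \<in> V - g. insert x g \<in> min_nonsidon V} \<le> 36"
    unfolding eq by (rule card_min_nonsidon_extensions[OF no_2_torsion fin]) (use g in auto)
next
  fix e assume e: "e \<in> min_nonsidon V"
  show "card e = 3 \<or> card e = 4" by (rule card_min_nonsidon[OF no_2_torsion e])
  show "e \<subseteq> V" using e by (simp add: min_nonsidon_def)
qed (rule V)

lemma indep_min_nonsidon_iff:
  fixes V :: "'a::ab_group_add set"
  assumes "\<And>x y :: 'a. x + x = y + y \<Longrightarrow> x = y" "finite V" "I \<subseteq> V"
  shows "sparse_hypergraph.indep (min_nonsidon V) I \<longleftrightarrow> sidon I"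
proof -
  interpret sparse_hypergraph V "min_nonsidon V" 36
    by (rule sparse_hypergraph_min_nonsidon[OF assms(1,2)])
  have "finite I" using finite_subset[OF assms(3,2)] .
  then show ?thesis
    using ex_min_nonsidon[of I V] assms(3)
    by (auto simp: indep_def) (auto simp: min_nonsidon_def intro: sidon_subset)
qed

section \<open>Random subsets of the box\<close>

lemma finite_vec_box: "finite (vec_box d n)"
  unfolding vec_box_def by (rule finite_PiE_dflt) auto

lemma card_vec_box: "card (vec_box d n) = n ^ d"
  unfolding vec_box_def by (subst card_PiE_dflt) auto

lemma vec_box_add:
  assumes "x \<in> vec_box d n" "y \<in> vec_box d n"
  shows "x + y \<in> vec_box d (2 * n)"
proof -
  have "x i + y i \<in> {0..int (2 * n) - 1}" if "i < d" for i
  proof -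
    have "x i \<in> {0..int n - 1}" "y i \<in> {0..int n - 1}"
      using assms that by (auto simp: vec_box_def PiE_dflt_def)
    then show ?thesis by auto
  qed
  then show ?thesis using assms by (auto simp: vec_box_def PiE_dflt_def)
qed

lemma vec_no_2_torsion:
  fixes x y :: "nat \<Rightarrow> int"
  assumes "x + x = y + y"
  shows "x = y"
proof
  fix i
  have "x i + x i = y i + y i" using fun_cong[OF assms, of i] by simp
  then show "x i = y i" by simp
qed

text \<open>The hypergraph bound for K = 36, fugacity N^(-2/3+\<delta>), \<alpha> = N^(\<delta>/2)
  and q = N^4. The constant c is \<kappa>^(1/3) / 2, the half being lost when the fugacity is
  raised. Replacing ln N by the smaller ln n keeps c free of d.\<close>

lemma max_sidon_lower_bound_whp:
  fixes P :: "nat \<Rightarrow> real" and \<delta> :: real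
  assumes d: "1 \<le> d" and \<delta>: "0 < \<delta>" "\<delta> \<le> 1 / 100"
    and P: "\<forall>\<^sub>F n in sequentially. real (n ^ d) powr (-2/3 + 2 * \<delta>) \<le> P n \<and> P n < 1"
  defines "c \<equiv> (\<delta> / (32 * 36)) powr (1/3) / 2"
  shows "(\<lambda>n. measure_pmf.prob (random_subset (vec_box d n) (P n))
      {A. real (max_sidon A) < c * real n powr (real d / 3) * ln (real n) powr (1/3)}) \<longlonglongrightarrow> 0"
proof -
  define \<kappa> where "\<kappa> = \<delta> / (32 * 36)"
  define m where "m = (\<lambda>x. (\<kappa> * x * ln x) powr (1/3))"
  define \<beta> where "\<beta> = (\<lambda>x :: real. let y = 2 * x powr (-2/3 + \<delta>) in
      y + x * 36 * y ^ 2 + (x ^ 2 * 36 * y ^ 3 + (x ^ 2 * 36 * y ^ 3) ^ 2)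
       * (2 ^ 7 * 36 * (y + x * y ^ 2)))"
  have \<kappa>: "0 < \<kappa>" and c: "c = \<kappa> powr (1/3) / 2" using \<delta> by (simp_all add: \<kappa>_def c_def)
  have lim: "filterlim (\<lambda>n. real (n ^ d)) at_top sequentially"
    using d by (simp add: filterlim_real_sequentially filterlim_pow_at_top of_nat_power)
  have ev_trade: "\<forall>\<^sub>F x in at_top. x powr (\<delta>/2) * (m x + x / x ^ 4)
     + x powr (-2/3 + \<delta>) * (36 * ((m x) ^ 3 + x ^ 3 / x ^ 4))
     < x powr (-2/3 + \<delta>) * (x * (ln (x powr (\<delta>/2)) / 4 * (1/2)))"
    unfolding m_def \<kappa>_def by (rule asymptotic_tradeoff) (use \<delta> in auto)
  have "(\<beta> \<longlongrightarrow> 0) at_top"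
    unfolding \<beta>_def by (rule asymptotic_crowding) (use \<delta> in auto)
  then have ev_crowd: "\<forall>\<^sub>F x in at_top. \<beta> x < 1/2"
    by (rule order_tendstoD) simp
  have fail: "((\<lambda>x. x ^ 4 * (x powr \<delta>) powr (- m x / 2)) \<longlongrightarrow> 0) at_top"
    unfolding m_def using asymptotic_failure[OF \<kappa> \<delta>(1)] by simp
  have ev_large: "\<forall>\<^sub>F x :: real in at_top. 1 < x" by (rule eventually_gt_at_top)
  have ev_n: "\<forall>\<^sub>F n :: nat in sequentially. 1 < n" by (rule eventually_gt_at_top)
  have "\<forall>\<^sub>F n in sequentially. measure_pmf.prob (random_subset (vec_box d n) (P n))
      {A. real (max_sidon A) < c * real n powr (real d / 3) * ln (real n) powr (1/3)}
      \<le> real (n ^ d) ^ 4 * (real (n ^ d) powr \<delta>) powr (- m (real (n ^ d)) / 2)"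
    using P ev_n eventually_compose_filterlim[OF ev_trade lim]
      eventually_compose_filterlim[OF ev_crowd lim] eventually_compose_filterlim[OF ev_large lim]
  proof eventually_elim
    case (elim n)
    define V where "V = vec_box d n"
    define N where "N = real (n ^ d)"
    define p where "p = N powr (-2/3 + \<delta>)"
    have V: "finite V" "real (card V) = N" by (simp_all add: V_def N_def finite_vec_box card_vec_box)
    interpret sparse_hypergraph V "min_nonsidon V" 36
      using vec_no_2_torsion V(1) by (rule sparse_hypergraph_min_nonsidon)
    have ind: "ind_sets A = {I. I \<subseteq> A \<and> sidon I}" if "A \<subseteq> V" for A
      unfolding ind_sets_def
      using indep_min_nonsidon_iff[OF vec_no_2_torsion V(1)] that by auto
    have N1: "1 < N" using elim by (simp add: N_def)
    have p: "0 < p" using N1 by (simp add: p_def)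
    have pP: "N powr \<delta> \<le> P n / p"
    proof -
      have "N powr \<delta> * p = N powr (-2/3 + 2 * \<delta>)" by (simp add: p_def flip: powr_add)
      also have "\<dots> \<le> P n" using elim by (simp add: N_def)
      finally show ?thesis using p by (simp add: field_simps)
    qed
    have "1 \<le> N powr \<delta>" using N1 \<delta> by (intro ge_one_powr_ge_zero) auto
    then have "1 \<le> P n / p" using pP by linarith
    then have pP': "p \<le> P n" using p by simp
    have m0: "0 \<le> m N" by (simp add: m_def)
    have \<alpha>: "1 \<le> N powr (\<delta>/2)" using N1 \<delta> by (intro ge_one_powr_ge_zero) auto
    have crowd: "crowding_bound (2 * p) = \<beta> N"
      by (simp add: crowding_bound_def \<beta>_def Let_def p_def V)
    have "N powr (\<delta>/2) * (m N + N / N ^ 4) + p * (36 * (m N ^ 3 + N ^ 3 / N ^ 4))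
        < p * (N * (ln (N powr (\<delta>/2)) / 4 * (1/2)))"
      using elim unfolding N_def p_def by blast
    also have "\<dots> \<le> p * (N * (ln (N powr (\<delta>/2)) / 4 * (1 - crowding_bound (2 * p))))"
    proof -
      have "\<beta> N < 1/2" "0 \<le> ln (N powr (\<delta>/2))"
        using elim ln_ge_zero[OF \<alpha>] by (simp_all only: N_def)
      then show ?thesis unfolding crowd using p N1 by (intro mult_left_mono) auto
    qed
    finally have ineq: "N powr (\<delta>/2) * (m N + N / N ^ 4) + p * (36 * (m N ^ 3 + N ^ 3 / N ^ 4))
        < p * (N * (ln (N powr (\<delta>/2)) / 4 * (1 - crowding_bound (2 * p))))" .
    have small: "c * real n powr (real d / 3) * ln (real n) powr (1/3) \<le> m N / 2"
    proof -
      have n: "1 < real n" using elim by simp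
      have lnn: "0 < ln (real n)" using n by simp
      have "real n powr (real d / 3) = N powr (1/3)"
        using n by (simp add: N_def powr_powr flip: powr_realpow)
      then have "c * real n powr (real d / 3) * ln (real n) powr (1/3)
          = (\<kappa> * N * ln (real n)) powr (1/3) / 2"
        using \<kappa> N1 lnn by (simp add: c powr_mult)
      also have "\<dots> \<le> m N / 2"
      proof -
        have "1 * ln (real n) \<le> real d * ln (real n)" using d lnn by (intro mult_right_mono) auto
        then have "ln (real n) \<le> ln N" using n by (simp add: N_def ln_realpow)
        then have "\<kappa> * N * ln (real n) \<le> \<kappa> * N * ln N" using \<kappa> N1 by (intro mult_left_mono) auto
        then have "(\<kappa> * N * ln (real n)) powr (1/3) \<le> (\<kappa> * N * ln N) powr (1/3)"
          using \<kappa> N1 lnn by (intro powr_mono2) auto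
        then show ?thesis by (simp add: m_def)
      qed
      finally show ?thesis .
    qed
    have "measure_pmf.prob (random_subset V (P n))
        {A. real (max_sidon A) < c * real n powr (real d / 3) * ln (real n) powr (1/3)}
      \<le> measure_pmf.prob (random_subset V (P n)) {A. \<forall>I\<in>ind_sets A. real (card I) < m N / 2}"
    proof (rule measure_pmf.finite_measure_mono_AE)
      show "AE A in random_subset V (P n).
          A \<in> {A. real (max_sidon A) < c * real n powr (real d / 3) * ln (real n) powr (1/3)} \<longrightarrow>
          A \<in> {A. \<forall>I\<in>ind_sets A. real (card I) < m N / 2}"
        unfolding AE_measure_pmf_iff
      proof (intro ballI impI CollectI)
        fix A I
        assume A: "A \<in> set_pmf (random_subset V (P n))"
          and less: "A \<in> {A. real (max_sidon A) < c * real n powr (real d / 3) * ln (real n) powr (1/3)}"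
          and I: "I \<in> ind_sets A"
        have AV: "A \<subseteq> V" using set_pmf_random_subset[OF V(1)] A by blast
        then have "card I \<le> max_sidon A"
          using I ind finite_subset[OF AV V(1)] by (intro card_le_max_sidon) auto
        then show "real (card I) < m N / 2" using less small by simp
      qed
    qed simp
    also have "\<dots> \<le> N ^ 4 * (P n / p) powr (- m N / 2)"
      by (rule prob_no_large_ind_set_bound[OF p pP' _ \<alpha> _ m0])
         (use elim N1 ineq in \<open>simp_all add: V\<close>)
    also have "\<dots> \<le> N ^ 4 * (N powr \<delta>) powr (- m N / 2)"
      using pP m0 N1 by (intro mult_left_mono powr_mono2') auto
    finally show ?case by (simp add: V_def N_def)
  qed
  moreover have "(\<lambda>n. real (n ^ d) ^ 4 * (real (n ^ d) powr \<delta>) powr (- m (real (n ^ d)) / 2)) \<longlonglongrightarrow> 0"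
    using filterlim_compose[OF fail lim] by simp
  ultimately show ?thesis
    by (rule tendsto_sandwich[OF _ _ tendsto_const, rotated]) auto
qed

text \<open>Chosen so that a quarter of it pays for the other two terms in the exponent of
  \<open>prob_max_sidon_gt_le\<close> and one unit of decay is left. The 2^d is the growth of the
  box under addition, and d^(4/3) comes from ln N = d ln n in s0 ln N.\<close>

definition upper_const :: "nat \<Rightarrow> real" where
  "upper_const d = 4 * ((1 + 12 * 2 ^ d) * (2 * real d powr (4/3)) + 50 * (2 * exp 1 * 2 ^ d) + 1)"

lemma upper_const_pos: "0 < upper_const d"
  unfolding upper_const_def by (intro mult_pos_pos add_nonneg_pos add_nonneg_nonneg) auto

lemma asymptotic_upper:
  fixes r a :: real
  assumes r: "1 \<le> r" and a: "0 < a"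
  shows "\<forall>\<^sub>F x in at_top. exp 1 * (x powr (- r / 3) * ln x powr (8/3)) \<le> 1"
    and "\<forall>\<^sub>F x in at_top. (r * x powr r * ln x) powr (1/3) + 1 \<le> a * (x powr (r / 3) * ln x powr (4/3))"
    and "\<forall>\<^sub>F x in at_top. (a * (x powr (r / 3) * ln x powr (4/3))) ^ 2 \<le> x powr r"
    and "\<forall>\<^sub>F x in at_top. 3 \<le> x powr r"
    and "\<forall>\<^sub>F x in at_top. 1 \<le> (r * x powr r * ln x) powr (1/3)"
    and "((\<lambda>x. exp (- (x powr (r / 3) * ln x powr (4/3)))) \<longlongrightarrow> 0) at_top"
    and "\<forall>\<^sub>F x in at_top. x powr (- r / 3) * ln x powr (8/3) < 1"
  using r a by real_asymp+

lemma max_sidon_upper_bound_whp: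
  fixes P :: "nat \<Rightarrow> real"
  assumes d: "1 \<le> d"
    and P: "\<forall>\<^sub>F n in sequentially. 0 \<le> P n \<and> P n \<le> real n powr (- real d / 3) * ln (real n) powr (8 / 3)"
  shows "(\<lambda>n. measure_pmf.prob (random_subset (vec_box d n) (P n))
      {A. upper_const d * real n powr (real d / 3) * ln (real n) powr (4/3) < real (max_sidon A)}) \<longlonglongrightarrow> 0"
proof -
  define r where "r = real d"
  have r: "1 \<le> r" using d by (simp add: r_def)
  define C D :: real where "C = 2 ^ d" and "D = 2 * exp 1 * C"
  have C: "1 \<le> C" by (simp add: C_def)
  have D: "0 < D" using C by (simp add: D_def)
  define B where "B = (\<lambda>x. x powr (r / 3) * ln x powr (4/3))"
  define a where "a = upper_const d"
  have a: "0 < a" by (simp add: a_def upper_const_pos)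
  note ev = eventually_compose_filterlim[OF _ filterlim_real_sequentially]
  have ev_gt: "\<forall>\<^sub>F x :: real in at_top. 1 < x" by (rule eventually_gt_at_top)
  have "\<forall>\<^sub>F n in sequentially. measure_pmf.prob (random_subset (vec_box d n) (P n))
      {A. a * B (real n) < real (max_sidon A)} \<le> exp (- B (real n))"
    using P ev[OF asymptotic_upper(1)[OF r a]] ev[OF asymptotic_upper(2)[OF r a]]
      ev[OF asymptotic_upper(3)[OF r a]] ev[OF asymptotic_upper(4)[OF r a]]
      ev[OF asymptotic_upper(5)[OF r a]] ev[OF ev_gt]
  proof eventually_elim
    case (elim n)
    define x where "x = real n"
    have x: "1 < x" using elim by (simp add: x_def)
    have lnx: "0 < ln x" using x by simp
    define V where "V = vec_box d n"
    define N where "N = card V"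
    have N: "real N = x powr r"
      using x by (simp add: N_def V_def card_vec_box x_def r_def powr_realpow)
    have lnN: "ln N = r * ln x" using x by (simp add: N ln_powr)
    have B: "0 < B x" using x by (simp add: B_def)
    define root where "root = (r * x powr r * ln x) powr (1/3)"
    define s0 where "s0 = nat \<lceil>root\<rceil>"
    have root: "1 \<le> root" using elim by (simp add: root_def x_def)
    have s0: "root \<le> s0" "s0 \<le> root + 1" using root by (auto simp: s0_def)
    have root3: "root ^ 3 = N * ln N"
      using r x lnx by (simp add: root_def N lnN powr_powr mult_ac flip: powr_numeral)
    have "measure_pmf.prob (random_subset V (P n)) {A. a * B x < max_sidon A}
        \<le> exp ((1 + 12 * C) * (s0 * ln N) + 50 * D * B x - a * B x / 4)"
      unfolding N_def
    proof (rule prob_max_sidon_gt_le[where W = "vec_box d (2 * n)" and P = "x powr (- r / 3) * ln x powr (8 / 3)"])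
      show "finite V" "finite (vec_box d (2 * n))" by (simp_all add: V_def finite_vec_box)
      show "u + v \<in> vec_box d (2 * n)" if "u \<in> V" "v \<in> V" for u v
        using that by (simp add: V_def vec_box_add)
      show "real (card (vec_box d (2 * n))) \<le> C * real (card V)"
        by (simp add: card_vec_box C_def V_def power_mult_distrib)
      show "3 \<le> card V" using elim N unfolding N_def x_def by linarith
      show "0 < s0" using s0 root by linarith
      have "root ^ 3 \<le> real s0 ^ 3" using s0 root by (intro power_mono) auto
      then show "real (card V) * ln (real (card V)) \<le> real s0 ^ 3" unfolding root3 N_def .
      show "0 \<le> P n" "P n \<le> x powr (- r / 3) * ln x powr (8 / 3)" "exp 1 * (x powr (- r / 3) * ln x powr (8 / 3)) \<le> 1"
        using elim by (simp_all add: x_def r_def)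
      \<comment> \<open>\<open>B x\<close> is the square root of N times the upper end of the range
        of p; hence the exponent 4/3 as half of 8/3.\<close>
      have "(B x) ^ 2 = x powr (r * 2 / 3) * ln x powr (8/3)"
        by (simp add: B_def power_mult_distrib powr_powr flip: powr_numeral)
      moreover have "x powr r * x powr (- r / 3) = x powr (r * 2 / 3)"
        by (simp add: mult.commute flip: powr_add)
      ultimately have "real N * (x powr (- r / 3) * ln x powr (8/3)) = (B x) ^ 2"
        by (simp add: N)
      then have "2 * C * real N * (exp 1 * (x powr (- r / 3) * ln x powr (8 / 3))) * exp 1
          = 2 * C * (exp 1) ^ 2 * (B x) ^ 2"
        by (simp add: power2_eq_square mult_ac)
      also have "\<dots> \<le> 4 * C * C * (exp 1) ^ 2 * (B x) ^ 2"
        using C by (intro mult_right_mono) auto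
      also have "\<dots> = (D * B x) ^ 2" by (simp add: D_def power2_eq_square mult_ac)
      finally show "2 * C * real (card V) * (exp 1 * (x powr (- r / 3) * ln x powr (8 / 3))) * exp 1 \<le> (D * B x) ^ 2"
        by (simp add: N_def)
      show "real s0 \<le> a * B x" using s0 elim by (simp add: root_def x_def B_def)
      show "(a * B x) ^ 2 \<le> real (card V)" using elim N by (simp add: N_def B_def x_def)
    qed (use C D B in auto)
    also have "\<dots> \<le> exp (- B x)"
    proof -
      have "s0 * ln N \<le> (2 * root) * (r * ln x)"
        unfolding lnN using s0 root r lnx by (intro mult_right_mono) auto
      \<comment> \<open>The power 4/3 of the logarithm arises here a second time, as 1/3 from s0
        plus 1 from ln N.\<close>
      also have "\<dots> = 2 * r powr (4/3) * B x"
      proof -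
        have r43: "r powr (1/3) * r = r powr (4/3)" and l43: "ln x powr (1/3) * ln x = ln x powr (4/3)"
          using r lnx powr_mult_base[of r "1/3"] powr_mult_base[of "ln x" "1/3"]
          by (simp_all add: mult.commute)
        have "root = r powr (1/3) * x powr (r / 3) * ln x powr (1/3)"
          using r x lnx by (simp add: root_def powr_mult powr_powr)
        then have "2 * root * (r * ln x)
            = 2 * (r powr (1/3) * r) * (x powr (r / 3) * (ln x powr (1/3) * ln x))"
          by (simp add: mult_ac)
        then show ?thesis by (simp only: r43 l43 B_def)
      qed
      finally have "(1 + 12 * C) * (s0 * ln N) \<le> (1 + 12 * C) * (2 * r powr (4/3) * B x)"
        using C by (intro mult_left_mono) auto
      moreover have "a / 4 * B x = (1 + 12 * C) * (2 * r powr (4/3) * B x) + 50 * D * B x + B x"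
        by (simp add: a_def upper_const_def C_def D_def r_def algebra_simps)
      ultimately show ?thesis unfolding exp_le_cancel_iff by linarith
    qed
    finally show ?case by (simp add: V_def x_def)
  qed
  moreover have "(\<lambda>n. exp (- B (real n))) \<longlonglongrightarrow> 0"
    unfolding B_def using filterlim_compose[OF asymptotic_upper(6)[OF r a] filterlim_real_sequentially] by simp
  ultimately have "(\<lambda>n. measure_pmf.prob (random_subset (vec_box d n) (P n))
      {A. a * B (real n) < real (max_sidon A)}) \<longlonglongrightarrow> 0"
    by (rule tendsto_sandwich[OF _ _ tendsto_const, rotated]) auto
  then show ?thesis by (simp add: a_def B_def r_def mult.assoc)
qed

text \<open>One \<delta> has to serve every admissible d. If \<epsilon> \<ge> 0, the slack 1/3 -
  \<epsilon>/d grows with d, so the least admissible d decides. If \<epsilon> < 0, the slack is at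
  least 1/3 and \<delta> \<le> 1/100 suffices.\<close>

lemma exponent_margin:
  fixes \<epsilon> :: real
  shows "\<exists>\<delta>. 0 < \<delta> \<and> \<delta> \<le> 1 / 100 \<and> (\<forall>d\<ge>1. \<epsilon> < real d / 3 \<longrightarrow> 2 * real d * \<delta> \<le> real d / 3 - \<epsilon>)"
proof -
  define k where "k = (LEAST d. 1 \<le> d \<and> \<epsilon> < real d / 3)"
  obtain d0 :: nat where "max 1 (3 * \<epsilon>) < real d0" using reals_Archimedean2 by blast
  then have "1 \<le> d0 \<and> \<epsilon> < real d0 / 3" by auto
  then have k: "1 \<le> k" "\<epsilon> < real k / 3"
    unfolding k_def by (metis (mono_tags, lifting) LeastI)+
  define t where "t = 1 / 3 - \<epsilon> / k"
  define \<delta> where "\<delta> = min (1 / 100) (t / 2)"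
  have "0 < t" using k by (simp add: t_def field_simps)
  then have \<delta>: "0 < \<delta>" "\<delta> \<le> 1 / 100" "2 * \<delta> \<le> 1 / 3 - \<epsilon> / k"
    unfolding t_def[symmetric] by (auto simp: \<delta>_def)
  have "2 * real d * \<delta> \<le> real d / 3 - \<epsilon>" if d: "1 \<le> d" "\<epsilon> < real d / 3" for d
  proof -
    have kd: "k \<le> d" unfolding k_def using d by (intro Least_le) auto
    have "2 * \<delta> \<le> 1 / 3 - \<epsilon> / d"
    proof (cases "0 \<le> \<epsilon>")
      case True
      then have "\<epsilon> / d \<le> \<epsilon> / k" using kd k by (intro divide_left_mono) auto
      then show ?thesis using \<delta> by linarith
    next
      case False
      then have "\<epsilon> / d \<le> 0" using d by (simp add: divide_nonpos_pos)
      then show ?thesis using \<delta> by linarith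
    qed
    then have "real d * (2 * \<delta>) \<le> real d * (1 / 3 - \<epsilon> / d)" by (intro mult_left_mono) auto
    then show ?thesis using d by (simp add: algebra_simps)
  qed
  then show ?thesis using \<delta> by blast
qed

lemma asym_almost_surely_conj:
  assumes "(\<lambda>n. measure_pmf.prob (M n) {x. \<not> P n x}) \<longlonglongrightarrow> 0"
    and "(\<lambda>n. measure_pmf.prob (M n) {x. \<not> Q n x}) \<longlonglongrightarrow> 0"
  shows "asym_almost_surely M (\<lambda>n x. P n x \<and> Q n x)"
  unfolding asym_almost_surely_def
proof (rule tendsto_sandwich[OF _ _ _ tendsto_const])
  show "\<forall>\<^sub>F n in sequentially. 1 - measure_pmf.prob (M n) {x. \<not> P n x} - measure_pmf.prob (M n) {x. \<not> Q n x}
      \<le> measure_pmf.prob (M n) {x. P n x \<and> Q n x}"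
  proof (intro always_eventually allI)
    fix n
    have "measure_pmf.prob (M n) ({x. \<not> P n x} \<union> {x. \<not> Q n x})
        \<le> measure_pmf.prob (M n) {x. \<not> P n x} + measure_pmf.prob (M n) {x. \<not> Q n x}"
      by (intro measure_Un_le) auto
    moreover have "measure_pmf.prob (M n) {x. P n x \<and> Q n x}
        = 1 - measure_pmf.prob (M n) ({x. \<not> P n x} \<union> {x. \<not> Q n x})"
      by (subst measure_pmf.prob_compl[symmetric]) (auto intro!: arg_cong[where f = "measure_pmf.prob (M n)"])
    ultimately show "1 - measure_pmf.prob (M n) {x. \<not> P n x} - measure_pmf.prob (M n) {x. \<not> Q n x}
      \<le> measure_pmf.prob (M n) {x. P n x \<and> Q n x}" by linarith
  qed
  show "(\<lambda>n. 1 - measure_pmf.prob (M n) {x. \<not> P n x} - measure_pmf.prob (M n) {x. \<not> Q n x}) \<longlonglongrightarrow> 1"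
    using tendsto_diff[OF tendsto_diff[OF tendsto_const[of 1] assms(1)] assms(2)] by simp
qed (auto simp: always_eventually)

theorem theorem2p6:
  shows "\<exists>c4 :: nat \<Rightarrow> real. (\<forall>d. c4 d > 0) \<and>
    (\<forall>\<epsilon> :: real. \<exists>c3 :: real. c3 > 0 \<and>
      (\<forall>d :: nat. d \<ge> 1 \<longrightarrow> \<epsilon> < real d / 3 \<longrightarrow>
        (\<forall>p :: nat \<Rightarrow> real.
          (\<forall>n. 0 \<le> p n \<and> p n \<le> 1) \<longrightarrow>
          (\<forall>\<^sub>F n in sequentially.
             real n powr (- real d / 3 - \<epsilon>) \<le> p n \<and>
             p n \<le> real n powr (- real d / 3) * ln (real n) powr (8 / 3)) \<longrightarrow>
          asym_almost_surely
            (\<lambda>n. random_subset (vec_box d n) (p n))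
            (\<lambda>n A. c3 * real n powr (real d / 3) * ln (real n) powr (1 / 3) \<le> real (max_sidon A) \<and>
                   real (max_sidon A) \<le> c4 d * real n powr (real d / 3) * ln (real n) powr (4 / 3)))))"
proof (intro exI[of _ upper_const] conjI allI upper_const_pos)
  fix \<epsilon> :: real
  obtain \<delta> where \<delta>: "0 < \<delta>" "\<delta> \<le> 1 / 100"
    and margin: "\<And>d. 1 \<le> d \<Longrightarrow> \<epsilon> < real d / 3 \<Longrightarrow> 2 * real d * \<delta> \<le> real d / 3 - \<epsilon>"
    using exponent_margin[of \<epsilon>] by blast
  define c3 where "c3 = (\<delta> / (32 * 36)) powr (1/3) / 2"
  show "\<exists>c3 :: real. c3 > 0 \<and>
      (\<forall>d :: nat. d \<ge> 1 \<longrightarrow> \<epsilon> < real d / 3 \<longrightarrow>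
        (\<forall>p :: nat \<Rightarrow> real.
          (\<forall>n. 0 \<le> p n \<and> p n \<le> 1) \<longrightarrow>
          (\<forall>\<^sub>F n in sequentially.
             real n powr (- real d / 3 - \<epsilon>) \<le> p n \<and>
             p n \<le> real n powr (- real d / 3) * ln (real n) powr (8 / 3)) \<longrightarrow>
          asym_almost_surely
            (\<lambda>n. random_subset (vec_box d n) (p n))
            (\<lambda>n A. c3 * real n powr (real d / 3) * ln (real n) powr (1 / 3) \<le> real (max_sidon A) \<and>
                   real (max_sidon A) \<le> upper_const d * real n powr (real d / 3) * ln (real n) powr (4 / 3))))"
  proof (intro exI[of _ c3] conjI allI impI)
    show "0 < c3" using \<delta> by (simp add: c3_def)
    fix d :: nat and p :: "nat \<Rightarrow> real"
    assume d: "1 \<le> d" "\<epsilon> < real d / 3" and p01: "\<forall>n. 0 \<le> p n \<and> p n \<le> 1"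
      and p: "\<forall>\<^sub>F n in sequentially. real n powr (- real d / 3 - \<epsilon>) \<le> p n \<and>
             p n \<le> real n powr (- real d / 3) * ln (real n) powr (8 / 3)"
    have r: "1 \<le> real d" using d by simp
    have ev_gt: "\<forall>\<^sub>F x :: real in at_top. 1 < x" by (rule eventually_gt_at_top)
    have "\<forall>\<^sub>F n in sequentially. real (n ^ d) powr (-2/3 + 2 * \<delta>) \<le> p n \<and> p n < 1"
      using p eventually_compose_filterlim[OF asymptotic_upper(7)[OF r zero_less_one] filterlim_real_sequentially]
        eventually_compose_filterlim[OF ev_gt filterlim_real_sequentially]
    proof eventually_elim
      case (elim n)
      have "real (n ^ d) powr (-2/3 + 2 * \<delta>) = real n powr (real d * (-2/3 + 2 * \<delta>))"
        using elim by (simp add: powr_powr flip: powr_realpow)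
      \<comment> \<open>The exponents d (-2/3 + 2\<delta>) and -d/3 - \<epsilon> are compared; this
        is exactly the margin 2 d \<delta> \<le> d/3 - \<epsilon>.\<close>
      also have "\<dots> \<le> real n powr (- real d / 3 - \<epsilon>)"
        using elim margin[OF d] by (intro powr_mono) (auto simp: algebra_simps)
      finally show ?case using elim by linarith
    qed
    then have lower: "(\<lambda>n. measure_pmf.prob (random_subset (vec_box d n) (p n))
        {A. real (max_sidon A) < c3 * real n powr (real d / 3) * ln (real n) powr (1/3)}) \<longlonglongrightarrow> 0"
      unfolding c3_def by (rule max_sidon_lower_bound_whp[OF d(1) \<delta>])
    have "\<forall>\<^sub>F n in sequentially. 0 \<le> p n \<and> p n \<le> real n powr (- real d / 3) * ln (real n) powr (8 / 3)"
      using p by eventually_elim (use p01 in auto)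
    then have upper: "(\<lambda>n. measure_pmf.prob (random_subset (vec_box d n) (p n))
        {A. upper_const d * real n powr (real d / 3) * ln (real n) powr (4/3) < real (max_sidon A)}) \<longlonglongrightarrow> 0"
      by (rule max_sidon_upper_bound_whp[OF d(1)])
    show "asym_almost_surely (\<lambda>n. random_subset (vec_box d n) (p n))
            (\<lambda>n A. c3 * real n powr (real d / 3) * ln (real n) powr (1 / 3) \<le> real (max_sidon A) \<and>
                   real (max_sidon A) \<le> upper_const d * real n powr (real d / 3) * ln (real n) powr (4 / 3))"
      by (rule asym_almost_surely_conj) (use lower upper in \<open>simp_all only: not_le\<close>)
  qed
qed

end
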